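(* Let $(\Omega,\mathcal{F})$ be a measurable space, $T:\Omega\to\Omega$ measurable, and $V$ a $T$-invariant upper probability. The following are equivalent: (i) $V$ is weakly mixing; (ii) there exists $Q\in\operatorname{core}(V)\cap\mathcal{M}^{wm}(T)$ such that for every $P\in\operatorname{core}(V)$, $\lim_{n\to\infty}\frac{1}{n}\sum_{i=0}^{n-1}|P(B\cap T^{-i}C)-P(B)Q(C)|^2=0$ for all $B,C\in\mathcal{F}$; (iii) there exists $Q\in\operatorname{core}(V)\cap\mathcal{M}(T)$ such that for every $P\in\operatorname{core}(V)$, $\lim_{n\to\infty}\frac{1}{n}\sum_{i=0}^{n-1}|P(B\cap T^{-i}C)-P(B)Q(C)|^2=0$ for all $B,C\in\mathcal{F}$.
   Context: A capacity is a monotone map $\mu:\mathcal{F}\to[0,1]$ with $\mu(\emptyset)=0,\mu(\Omega)=1$. An upper probability is a capacity $V$ with $V(A)=\max_{P\in\Lambda}P(A)$ for a weak* (setwise convergence) compact set $\Lambda$ of probabilities; $\operatorname{core}(V)$ is the set of finitely additive normalized $P\le V$. A $T$-invariant capacity $\mu$ is weakly mixing if every measurable $f:\Omega\to\mathbb{C}$ with $f\circ T=\lambda f$ $\mu$-a.s. for some $\lambda\in\mathbb{C}$ is constant $\mu$-a.s. $\mathcal{M}(T)$: $T$-invariant probabilities; $\mathcal{M}^{wm}(T)$: those $P\in\mathcal{M}(T)$ with $P\times P$ ergodic for $T\times T$. *)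

theory Defs
  imports "HOL-Probability.Probability"
begin

text \<open>The measurable space (Omega, F) is represented by a measure M (only space M
and sets M are used). Set functions are maps of type 'a set => real.\<close>

definition capacity :: "'a measure \<Rightarrow> ('a set \<Rightarrow> real) \<Rightarrow> bool" where
  "capacity M \<mu> \<longleftrightarrow> \<mu> {} = 0 \<and> \<mu> (space M) = 1 \<and>
     (\<forall>A\<in>sets M. \<forall>B\<in>sets M. A \<subseteq> B \<longrightarrow> \<mu> A \<le> \<mu> B) \<and>
     (\<forall>A\<in>sets M. 0 \<le> \<mu> A \<and> \<mu> A \<le> 1)"

definition invariant_capacity :: "'a measure \<Rightarrow> ('a \<Rightarrow> 'a) \<Rightarrow> ('a set \<Rightarrow> real) \<Rightarrow> bool" where
  "invariant_capacity M T \<mu> \<longleftrightarrow> capacity M \<mu> \<and>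
     (\<forall>A\<in>sets M. \<mu> (T -` A \<inter> space M) = \<mu> A)"

text \<open>Upper probability: V(A) = max over a compact set Lambda of (countably additive)
probabilities on (Omega,F). The topology of setwise convergence on Lambda is the initial
topology of the maps P |-> P(A), A in F; compactness of Lambda in it is expressed as
compactness of the image of Lambda under P |-> (A |-> P(A)) in the product topology
on 'a set => real (coordinates outside F are identically 0).\<close>
definition upper_probability :: "'a measure \<Rightarrow> ('a set \<Rightarrow> real) \<Rightarrow> bool" where
  "upper_probability M V \<longleftrightarrow> capacity M V \<and>
     (\<exists>\<Lambda>. \<Lambda> \<noteq> {} \<and> (\<forall>P\<in>\<Lambda>. prob_space P \<and> sets P = sets M) \<and>
        compact ((\<lambda>P A. measure P A) ` \<Lambda>) \<and>
        (\<forall>A\<in>sets M. (\<forall>P\<in>\<Lambda>. measure P A \<le> V A) \<and> (\<exists>P\<in>\<Lambda>. measure P A = V A)))"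

definition core :: "'a measure \<Rightarrow> ('a set \<Rightarrow> real) \<Rightarrow> ('a set \<Rightarrow> real) set" where
  "core M V = {p. (\<forall>A\<in>sets M. 0 \<le> p A) \<and> p (space M) = 1 \<and>
     (\<forall>A\<in>sets M. \<forall>B\<in>sets M. A \<inter> B = {} \<longrightarrow> p (A \<union> B) = p A + p B) \<and>
     (\<forall>A\<in>sets M. p A \<le> V A) \<and> (\<forall>A. A \<notin> sets M \<longrightarrow> p A = 0)}"

definition cap_AE :: "'a measure \<Rightarrow> ('a set \<Rightarrow> real) \<Rightarrow> ('a \<Rightarrow> bool) \<Rightarrow> bool" where
  "cap_AE M \<mu> P \<longleftrightarrow> (\<exists>N\<in>sets M. {x\<in>space M. \<not> P x} \<subseteq> N \<and> \<mu> N = 0)"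

definition weakly_mixing_cap :: "'a measure \<Rightarrow> ('a \<Rightarrow> 'a) \<Rightarrow> ('a set \<Rightarrow> real) \<Rightarrow> bool" where
  "weakly_mixing_cap M T \<mu> \<longleftrightarrow> invariant_capacity M T \<mu> \<and>
     (\<forall>f::'a \<Rightarrow> complex. f \<in> borel_measurable M \<longrightarrow>
        (\<exists>c. cap_AE M \<mu> (\<lambda>x. f (T x) = c * f x)) \<longrightarrow>
        (\<exists>k. cap_AE M \<mu> (\<lambda>x. f x = k)))"

definition inv_probs :: "'a measure \<Rightarrow> ('a \<Rightarrow> 'a) \<Rightarrow> 'a measure set" where
  "inv_probs M T = {P. prob_space P \<and> sets P = sets M \<and>
     (\<forall>A\<in>sets M. measure P (T -` A \<inter> space M) = measure P A)}"

definition wm_probs :: "'a measure \<Rightarrow> ('a \<Rightarrow> 'a) \<Rightarrow> 'a measure set" where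
  "wm_probs M T = {P \<in> inv_probs M T.
     (\<forall>A\<in>sets (P \<Otimes>\<^sub>M P).
        (\<lambda>(x, y). (T x, T y)) -` A \<inter> space (P \<Otimes>\<^sub>M P) = A \<longrightarrow>
        measure (P \<Otimes>\<^sub>M P) A = 0 \<or> measure (P \<Otimes>\<^sub>M P) A = 1)}"

definition mixing_wrt :: "'a measure \<Rightarrow> ('a \<Rightarrow> 'a) \<Rightarrow> ('a set \<Rightarrow> real) \<Rightarrow> 'a measure \<Rightarrow> bool" where
  "mixing_wrt M T V Q \<longleftrightarrow> (\<forall>P\<in>core M V. \<forall>B\<in>sets M. \<forall>C\<in>sets M.
     (\<lambda>n. (1 / real n) * (\<Sum>i<n. \<bar>P (B \<inter> ((T ^^ i) -` C \<inter> space M)) - P B * measure Q C\<bar>\<^sup>2))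
       \<longlonglongrightarrow> 0)"

end

theory Submission
  imports Defs "HOL-Computational_Algebra.Fundamental_Theorem_Algebra"
begin

text \<open>
  Compactness makes \<open>V\<close> continuous along decreasing sequences with \<open>V\<close>-null limit, so every
  element of the core is a measure and, by a Krylov--Bogoliubov argument, the core contains an
  invariant \<open>Q\<close>. If every invariant \<open>Q\<close>-null set is \<open>V\<close>-null, then so is every \<open>Q\<close>-null set;
  under (i) as well as under (iii) this identifies the null sets of \<open>V\<close> with those of \<open>Q\<close>, and
  every element of the core has a density with respect to \<open>Q\<close>. What remains is the classical
  equivalence for \<open>Q\<close> between the absence of nonconstant eigenfunctions and mixing on average.

  If mixing fails for \<open>f = 1\<^sub>C - Q(C)\<close>, the kernels \<open>1/n \<Sum>\<^sub>i\<^sub><\<^sub>n f(T\<^sup>i x) f(T\<^sup>i y)\<close> converge in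
  \<open>L\<^sup>2(Q \<times> Q)\<close> to a \<open>T \<times> T\<close>-invariant kernel whose integral operator is nonzero, positive, compact
  and commutes with composition by \<open>T\<close>. An eigenspace for its largest eigenvalue is finite
  dimensional, \<open>T\<close>-invariant and orthogonal to the constants, hence contains a nonconstant
  eigenfunction of \<open>T\<close>.
\<close>

section \<open>Bounded functions in \<open>L\<^sup>2\<close> and the mean ergodic theorem\<close>

text \<open>No Hilbert space and no spectral theorem enter: all functions stay bounded and
  measurable, and only integrals of their products occur. This works because the kernel is bounded
  by 1, so its operator sends a bounded function to one whose sup norm is at most the L^1 norm of
  the argument, and eigenvectors come out bounded. Compactness is read off from the averaged
  kernels, which have rank at most \<open>n\<close> and square error \<open>\<epsilon> n\<close>.
  The finite dimensional eigenspace is never formed either: enough iterates \<open>u\<close>,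
  \<open>u o T\<close>, \<open>u o T^2\<close>, ... of one eigenvector are linearly dependent, and
  factoring the corresponding complex polynomial produces the eigenfunction of \<open>T\<close>. In
  the definition of weak mixing, eigenfunctions are merely measurable and the eigenvalue is an
  arbitrary complex number. Hence the direction from mixing to weak mixing must pass to bounded
  functions with unimodular eigenvalue before correlations can be formed. In the other direction an
  element of the core has only an integrable density, which is truncated to reach the bounded
  theory.\<close>

lemma discriminant_le_if_nonneg:
  fixes a b c :: real
  assumes nonneg: "\<And>t. 0 \<le> c + 2 * b * t + a * t\<^sup>2" and a: "0 \<le> a"
  shows "b\<^sup>2 \<le> a * c"
proof (cases "a = 0")
  case True
  have "b = 0"
  proof (rule ccontr)
    assume "b \<noteq> 0"
    \<comment> \<open>At this point the affine function takes the value -1.\<close>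
    then show False using nonneg[of "- (c + 1) / (2 * b)"] True by simp
  qed
  then show ?thesis using True by simp
next
  case False
  then have "0 \<le> (c + 2 * b * (- b / a) + a * (- b / a)\<^sup>2) * a"
    using nonneg[of "- b / a"] a by (intro mult_nonneg_nonneg) auto
  also have "\<dots> = a * c - b\<^sup>2"
    using False by (simp add: field_simps power2_eq_square)
  finally show ?thesis by simp
qed

lemma square_add_le: "(a + b)\<^sup>2 \<le> 2 * a\<^sup>2 + 2 * b\<^sup>2" for a b :: real
proof -
  have "0 \<le> (a - b)\<^sup>2" by simp
  then show ?thesis by (simp add: power2_eq_square algebra_simps)
qed

text \<open>The bound holds at every point of the space, not almost everywhere. Such functions form
  an algebra stable under composition with measurable maps, so sections of functions on a product
  stay in the class without exceptional sets.\<close>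

definition bounded_measurable :: "'a measure \<Rightarrow> ('a \<Rightarrow> real) set" where
  "bounded_measurable M = {f \<in> borel_measurable M. \<exists>c. \<forall>x\<in>space M. \<bar>f x\<bar> \<le> c}"

lemma bounded_measurableI:
  "f \<in> borel_measurable M \<Longrightarrow> (\<And>x. x \<in> space M \<Longrightarrow> \<bar>f x\<bar> \<le> c) \<Longrightarrow> f \<in> bounded_measurable M"
  by (auto simp: bounded_measurable_def)

lemma bounded_measurable_borel:
  "f \<in> bounded_measurable M \<Longrightarrow> f \<in> borel_measurable M"
  by (simp add: bounded_measurable_def)

lemma bounded_measurableE:
  assumes "f \<in> bounded_measurable M"
  obtains c where "0 \<le> c" "\<And>x. x \<in> space M \<Longrightarrow> \<bar>f x\<bar> \<le> c"
proof -
  obtain c where "\<forall>x\<in>space M. \<bar>f x\<bar> \<le> c"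
    using assms by (auto simp: bounded_measurable_def)
  then show ?thesis using that[of "max 0 c"] by fastforce
qed

lemma bounded_measurable_const [simp]: "(\<lambda>x. c) \<in> bounded_measurable M"
  by (rule bounded_measurableI[where c="\<bar>c\<bar>"]) auto

lemma bounded_measurable_add:
  assumes "f \<in> bounded_measurable M" "g \<in> bounded_measurable M"
  shows "(\<lambda>x. f x + g x) \<in> bounded_measurable M"
proof -
  obtain a b where "\<And>x. x \<in> space M \<Longrightarrow> \<bar>f x\<bar> \<le> a" "\<And>x. x \<in> space M \<Longrightarrow> \<bar>g x\<bar> \<le> b"
    using assms by (metis bounded_measurableE)
  then show ?thesis
    using assms[THEN bounded_measurable_borel]
    by (intro bounded_measurableI[where c="a + b"]) (auto intro!: order_trans[OF abs_triangle_ineq] add_mono)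
qed

lemma bounded_measurable_mult:
  assumes "f \<in> bounded_measurable M" "g \<in> bounded_measurable M"
  shows "(\<lambda>x. f x * g x) \<in> bounded_measurable M"
proof -
  obtain a b where "\<And>x. x \<in> space M \<Longrightarrow> \<bar>f x\<bar> \<le> a" "\<And>x. x \<in> space M \<Longrightarrow> \<bar>g x\<bar> \<le> b" "0 \<le> a" "0 \<le> b"
    using assms by (metis bounded_measurableE)
  then show ?thesis
    using assms[THEN bounded_measurable_borel]
    by (intro bounded_measurableI[where c="a * b"]) (auto simp: abs_mult intro!: mult_mono)
qed

lemma bounded_measurable_cmult:
  "f \<in> bounded_measurable M \<Longrightarrow> (\<lambda>x. c * f x) \<in> bounded_measurable M"
  by (intro bounded_measurable_mult) auto

lemma bounded_measurable_diff:
  assumes "f \<in> bounded_measurable M" "g \<in> bounded_measurable M"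
  shows "(\<lambda>x. f x - g x) \<in> bounded_measurable M"
  using bounded_measurable_add[OF assms(1) bounded_measurable_cmult[OF assms(2), of "-1"]] by simp

lemma bounded_measurable_power2:
  "f \<in> bounded_measurable M \<Longrightarrow> (\<lambda>x. (f x)\<^sup>2) \<in> bounded_measurable M"
  by (simp add: power2_eq_square bounded_measurable_mult)

lemma bounded_measurable_sum:
  "(\<And>i. i \<in> I \<Longrightarrow> f i \<in> bounded_measurable M) \<Longrightarrow> (\<lambda>x. \<Sum>i\<in>I. f i x) \<in> bounded_measurable M"
  by (induction I rule: infinite_finite_induct) (auto intro: bounded_measurable_add)

lemma bounded_measurable_abs:
  "f \<in> bounded_measurable M \<Longrightarrow> (\<lambda>x. \<bar>f x\<bar>) \<in> bounded_measurable M"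
  by (auto simp: bounded_measurable_def)

lemma bounded_measurable_comp:
  assumes "f \<in> bounded_measurable N" "T \<in> measurable M N"
  shows "(\<lambda>x. f (T x)) \<in> bounded_measurable M"
proof -
  obtain c where "\<And>x. x \<in> space N \<Longrightarrow> \<bar>f x\<bar> \<le> c" using assms(1) by (metis bounded_measurableE)
  then show ?thesis
    using assms(2) measurable_space[OF assms(2)] bounded_measurable_borel[OF assms(1)]
    by (intro bounded_measurableI[where c=c]) auto
qed

lemmas bounded_measurable_intros = bounded_measurable_const bounded_measurable_add
  bounded_measurable_mult bounded_measurable_diff bounded_measurable_power2 bounded_measurable_sum
  bounded_measurable_abs

section \<open>Cauchy-Schwarz and L^2 completeness for bounded functions\<close>

context prob_space
begin

lemma bounded_measurable_integrable: "f \<in> bounded_measurable M \<Longrightarrow> integrable M f"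
  by (metis (mono_tags) AE_I2 bounded_measurableE bounded_measurable_borel integrable_const_bound real_norm_def)

text \<open>A non-integrable function has integral 0 by convention; \<open>0 \<le> c\<close> covers
  that case, so callers need only measurability.\<close>

lemma integral_le_bound:
  assumes "f \<in> borel_measurable M" "\<And>x. x \<in> space M \<Longrightarrow> f x \<le> (c::real)" "0 \<le> c"
  shows "(\<integral>x. f x \<partial>M) \<le> c"
proof (cases "integrable M f")
  case True
  then have "(\<integral>x. f x \<partial>M) \<le> (\<integral>x. c \<partial>M)"
    using assms by (intro integral_mono) auto
  then show ?thesis by (simp add: prob_space)
qed (use assms in \<open>simp add: not_integrable_integral_eq\<close>)

text \<open>Cauchy-Schwarz, from the nonnegative quadratic polynomial t -> integral of (g + t
  f)^2.\<close>

lemma square_integral_mult_le: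
  assumes "f \<in> bounded_measurable M" "g \<in> bounded_measurable M"
  shows "(\<integral>x. f x * g x \<partial>M)\<^sup>2 \<le> (\<integral>x. (f x)\<^sup>2 \<partial>M) * (\<integral>x. (g x)\<^sup>2 \<partial>M)"
proof (rule discriminant_le_if_nonneg)
  fix t :: real
  note bm = bounded_measurable_intros bounded_measurable_integrable assms
  have "0 \<le> (\<integral>x. (g x + t * f x)\<^sup>2 \<partial>M)" by simp
  also have "(\<lambda>x. (g x + t * f x)\<^sup>2) = (\<lambda>x. (g x)\<^sup>2 + 2 * t * (f x * g x) + t\<^sup>2 * (f x)\<^sup>2)"
    by (simp add: power2_eq_square algebra_simps fun_eq_iff)
  also have "(\<integral>x. (g x)\<^sup>2 + 2 * t * (f x * g x) + t\<^sup>2 * (f x)\<^sup>2 \<partial>M) =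
     (\<integral>x. (g x)\<^sup>2 \<partial>M) + (\<integral>x. 2 * t * (f x * g x) \<partial>M) + (\<integral>x. t\<^sup>2 * (f x)\<^sup>2 \<partial>M)"
    by (subst Bochner_Integration.integral_add; (subst Bochner_Integration.integral_add)?; (intro bm)?) simp
  finally show "0 \<le> (\<integral>x. (g x)\<^sup>2 \<partial>M) + 2 * (\<integral>x. f x * g x \<partial>M) * t + (\<integral>x. (f x)\<^sup>2 \<partial>M) * t\<^sup>2"
    by (simp only: integral_mult_right_zero) (simp add: algebra_simps)
qed simp

lemma square_integral_le:
  assumes "f \<in> bounded_measurable M"
  shows "(\<integral>x. f x \<partial>M)\<^sup>2 \<le> (\<integral>x. (f x)\<^sup>2 \<partial>M)"
  using square_integral_mult_le[OF assms, of "\<lambda>_. 1"] by (simp add: prob_space)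

lemma integral_square_add_le:
  assumes "f \<in> bounded_measurable M" "g \<in> bounded_measurable M"
  shows "(\<integral>x. (f x + g x)\<^sup>2 \<partial>M) \<le> 2 * (\<integral>x. (f x)\<^sup>2 \<partial>M) + 2 * (\<integral>x. (g x)\<^sup>2 \<partial>M)"
proof -
  note bm = bounded_measurable_intros bounded_measurable_integrable assms
  have "(\<integral>x. (f x + g x)\<^sup>2 \<partial>M) \<le> (\<integral>x. 2 * (f x)\<^sup>2 + 2 * (g x)\<^sup>2 \<partial>M)"
    by (intro integral_mono square_add_le bm)
  also have "\<dots> = (\<integral>x. 2 * (f x)\<^sup>2 \<partial>M) + (\<integral>x. 2 * (g x)\<^sup>2 \<partial>M)"
    by (intro Bochner_Integration.integral_add bm)
  finally show ?thesis by simp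
qed

lemma integral_square_zero_AE:
  assumes "f \<in> bounded_measurable M" "(\<integral>x. (f x)\<^sup>2 \<partial>M) = 0"
  shows "AE x in M. f x = 0"
  using integral_nonneg_eq_0_iff_AE[OF bounded_measurable_integrable[OF bounded_measurable_power2[OF assms(1)]]] assms(2)
  by simp

text \<open>A subsequence with summable L^1 increments converges almost everywhere, and the uniform
  bound turns this into L^2 convergence of the whole sequence by dominated convergence.\<close>

lemma L2_limit_of_bounded_Cauchy:
  fixes F :: "nat \<Rightarrow> 'a \<Rightarrow> real"
  assumes F: "\<And>n. F n \<in> borel_measurable M" and bound: "\<And>n x. x \<in> space M \<Longrightarrow> \<bar>F n x\<bar> \<le> c"
    and Cauchy: "\<And>e. e > 0 \<Longrightarrow> \<exists>N. \<forall>m\<ge>N. \<forall>n\<ge>N. (\<integral>x. (F m x - F n x)\<^sup>2 \<partial>M) < e"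
  obtains K where "K \<in> borel_measurable M" "\<And>x. x \<in> space M \<Longrightarrow> \<bar>K x\<bar> \<le> c"
    "(\<lambda>n. \<integral>x. (F n x - K x)\<^sup>2 \<partial>M) \<longlonglongrightarrow> 0"
proof -
  note F[measurable]
  have Fb: "F n \<in> bounded_measurable M" for n
    using F bound by (rule bounded_measurableI)
  note bm = bounded_measurable_intros bounded_measurable_integrable Fb
  obtain x0 where "x0 \<in> space M" using not_empty by blast
  then have c: "0 \<le> c" using bound[of x0 0] by linarith
  \<comment> \<open>The rate (1/4)^k for squares gives (1/2)^k for the L^1 norms of the increments,
    which is summable.\<close>
  have "\<exists>N. \<forall>m\<ge>N. \<forall>n\<ge>N. (\<integral>x. (F m x - F n x)\<^sup>2 \<partial>M) < (1/4)^k" for k :: nat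
    by (rule Cauchy) simp
  then obtain N where N: "\<And>k m n. m \<ge> N k \<Longrightarrow> n \<ge> N k \<Longrightarrow> (\<integral>x. (F m x - F n x)\<^sup>2 \<partial>M) < (1/4)^k"
    by metis
  \<comment> \<open>The sum dominates \<open>N k\<close> at both \<open>k\<close> and
    \<open>Suc k\<close> although \<open>N\<close> need not be monotone; the summand
    \<open>k\<close> makes \<open>r\<close> unbounded.\<close>
  define r where "r k = k + (\<Sum>j\<le>k. N j)" for k
  have rN: "r k \<ge> N k" "r (Suc k) \<ge> N k" "r k \<ge> k" for k
    using member_le_sum[of k "{..k}" N] by (auto simp: r_def)
  define D where "D k x = \<bar>F (r (Suc k)) x - F (r k) x\<bar>" for k x
  have D[measurable]: "D k \<in> borel_measurable M" for k unfolding D_def by measurable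
  have Db: "D k \<in> bounded_measurable M" for k unfolding D_def by (intro bm)
  have "(\<integral>x. D k x \<partial>M) \<le> (1/2)^k" for k
  proof (rule power2_le_imp_le)
    have "(\<integral>x. D k x \<partial>M)\<^sup>2 \<le> (\<integral>x. (D k x)\<^sup>2 \<partial>M)" by (rule square_integral_le[OF Db])
    also have "\<dots> \<le> (1/4)^k" using N[of k "r (Suc k)" "r k"] rN[of k] by (simp add: D_def)
    also have "\<dots> = ((1/2)^k)\<^sup>2" by (simp add: power_even_eq power2_eq_square flip: power_mult_distrib)
    finally show "(\<integral>x. D k x \<partial>M)\<^sup>2 \<le> ((1/2)^k)\<^sup>2" .
  qed simp
  then have "(\<integral>\<^sup>+x. ennreal (D k x) \<partial>M) \<le> ennreal ((1/2)^k)" for k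
    using Db by (subst nn_integral_eq_integral) (auto simp: D_def[abs_def] intro!: ennreal_leI bounded_measurable_integrable)
  then have "(\<integral>\<^sup>+x. (\<Sum>k. ennreal (D k x)) \<partial>M) \<le> (\<Sum>k. ennreal ((1/2)^k))"
    by (subst nn_integral_suminf) (auto intro!: suminf_le)
  also have "\<dots> = ennreal (\<Sum>k. (1/2)^k)" by (intro suminf_ennreal2) auto
  also have "\<dots> < \<infinity>" by simp
  finally have "AE x in M. (\<Sum>k. ennreal (D k x)) \<noteq> \<infinity>"
    by (intro nn_integral_noteq_infinite) auto
  then have conv: "AE x in M. convergent (\<lambda>k. F (r k) x)"
  proof eventually_elim
    fix x assume "(\<Sum>k. ennreal (D k x)) \<noteq> \<infinity>"
    then have "summable (\<lambda>k. D k x)" by (intro summable_suminf_not_top) (auto simp: D_def)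
    then have "summable (\<lambda>k. F (r (Suc k)) x - F (r k) x)"
      unfolding D_def by (rule summable_rabs_cancel)
    then have "convergent (\<lambda>n. \<Sum>k<n. F (r (Suc k)) x - F (r k) x)"
      by (simp add: summable_iff_convergent)
    moreover have "(\<lambda>n. F (r n) x) = (\<lambda>n. (\<Sum>k<n. F (r (Suc k)) x - F (r k) x) + F (r 0) x)"
      by (rule ext) (subst sum_lessThan_telescope, simp)
    ultimately show "convergent (\<lambda>k. F (r k) x)"
      by (simp add: convergent_add_const_right_iff)
  qed
  \<comment> \<open>\<open>lim\<close> is unspecified where the subsequence diverges. Clamping to
    [-c, c] keeps the bound at every point and changes nothing where it converges.\<close>
  define K where "K x = max (- c) (min c (lim (\<lambda>k. F (r k) x)))" for x
  have K[measurable]: "K \<in> borel_measurable M" unfolding K_def by measurable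
  have Kc: "\<bar>K x\<bar> \<le> c" for x using c by (auto simp: K_def)
  have lim: "AE x in M. (\<lambda>k. F (r k) x) \<longlonglongrightarrow> K x"
    using conv AE_space
  proof eventually_elim
    fix x assume *: "convergent (\<lambda>k. F (r k) x)" "x \<in> space M"
    then have L: "(\<lambda>k. F (r k) x) \<longlonglongrightarrow> lim (\<lambda>k. F (r k) x)" by (simp add: convergent_LIMSEQ_iff)
    have "\<bar>lim (\<lambda>k. F (r k) x)\<bar> \<le> c"
      by (rule LIMSEQ_le_const2[OF tendsto_rabs[OF L]]) (use * bound in auto)
    then have "K x = lim (\<lambda>k. F (r k) x)" by (simp add: K_def)
    then show "(\<lambda>k. F (r k) x) \<longlonglongrightarrow> K x" using L by simp
  qed
  have "(\<lambda>n. \<integral>x. (F n x - K x)\<^sup>2 \<partial>M) \<longlonglongrightarrow> 0"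
  proof (rule LIMSEQ_I)
    fix e :: real assume "e > 0"
    then obtain N where N: "\<And>m n. m \<ge> N \<Longrightarrow> n \<ge> N \<Longrightarrow> (\<integral>x. (F m x - F n x)\<^sup>2 \<partial>M) < e/2"
      using Cauchy[of "e/2"] by auto
    have "norm ((\<integral>x. (F n x - K x)\<^sup>2 \<partial>M) - 0) < e" if "n \<ge> N" for n
    proof -
      have "(\<lambda>k. \<integral>x. (F n x - F (r k) x)\<^sup>2 \<partial>M) \<longlonglongrightarrow> (\<integral>x. (F n x - K x)\<^sup>2 \<partial>M)"
      proof (rule integral_dominated_convergence[where w="\<lambda>_. (2 * c)\<^sup>2"])
        show "AE x in M. (\<lambda>k. (F n x - F (r k) x)\<^sup>2) \<longlonglongrightarrow> (F n x - K x)\<^sup>2"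
          using lim by eventually_elim (intro tendsto_intros)
        show "AE x in M. norm ((F n x - F (r k) x)\<^sup>2) \<le> (2 * c)\<^sup>2" for k
          using AE_space
        proof eventually_elim
          fix x assume "x \<in> space M"
          then have "\<bar>F n x - F (r k) x\<bar> \<le> \<bar>2 * c\<bar>" using bound[of x n] bound[of x "r k"] c by linarith
          then show "norm ((F n x - F (r k) x)\<^sup>2) \<le> (2 * c)\<^sup>2" by (simp add: abs_le_square_iff)
        qed
      qed auto
      then have "(\<integral>x. (F n x - K x)\<^sup>2 \<partial>M) \<le> e/2"
        using N[OF that] rN(3) by (elim LIMSEQ_le_const2) (meson less_imp_le order_trans)
      then show ?thesis using \<open>e > 0\<close> by simp
    qed
    then show "\<exists>N. \<forall>n\<ge>N. norm ((\<integral>x. (F n x - K x)\<^sup>2 \<partial>M) - 0) < e" by blast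
  qed
  with K Kc show ?thesis by (intro that) auto
qed

end

section \<open>Time averages of a measure preserving map\<close>

locale measure_preserving_map = prob_space M for M :: "'a measure" +
  fixes T :: "'a \<Rightarrow> 'a"
  assumes T_measurable [measurable]: "T \<in> measurable M M" and distr_T: "distr M M T = M"
begin

lemma T_power_measurable [measurable]: "(T ^^ i) \<in> measurable M M"
  by (induction i) auto

lemma T_power_space: "x \<in> space M \<Longrightarrow> (T ^^ i) x \<in> space M"
  using T_power_measurable by (rule measurable_space)

lemma distr_T_power: "distr M M (T ^^ i) = M"
proof (induction i)
  case (Suc i)
  have "distr M M (T ^^ Suc i) = distr (distr M M (T ^^ i)) M T"
    by (subst distr_distr) auto
  then show ?case by (simp only: Suc distr_T)
qed (simp add: id_def)

lemma integral_T_power: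
  fixes f :: "'a \<Rightarrow> 'b::{banach, second_countable_topology}"
  assumes "f \<in> borel_measurable M"
  shows "(\<integral>x. f ((T ^^ i) x) \<partial>M) = (\<integral>x. f x \<partial>M)"
  using integral_distr[OF T_power_measurable assms, of i] by (simp add: distr_T_power)

lemma integral_T:
  fixes f :: "'a \<Rightarrow> 'b::{banach, second_countable_topology}"
  assumes "f \<in> borel_measurable M"
  shows "(\<integral>x. f (T x) \<partial>M) = (\<integral>x. f x \<partial>M)"
  using integral_T_power[OF assms, of 1] by simp

lemma integrable_T_power:
  fixes f :: "'a \<Rightarrow> 'b::{banach, second_countable_topology}"
  assumes "integrable M f"
  shows "integrable M (\<lambda>x. f ((T ^^ i) x))"
  using assms by (subst integrable_distr_eq[OF T_power_measurable, of f, symmetric]) (auto simp: distr_T_power)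

lemma AE_T:
  assumes "AE x in M. P x"
  shows "AE x in M. P (T x)"
  using assms by (intro AE_distrD[OF T_measurable]) (simp only: distr_T)

lemma prob_vimage_T_power:
  assumes "A \<in> sets M"
  shows "prob ((T ^^ i) -` A \<inter> space M) = prob A"
  using measure_distr[OF T_power_measurable assms, of i] by (simp add: distr_T_power)

lemma bounded_measurable_T_power:
  "f \<in> bounded_measurable M \<Longrightarrow> (\<lambda>x. f ((T ^^ i) x)) \<in> bounded_measurable M"
  by (rule bounded_measurable_comp[OF _ T_power_measurable])

definition avg :: "nat \<Rightarrow> ('a \<Rightarrow> real) \<Rightarrow> 'a \<Rightarrow> real" where
  "avg n v x = (\<Sum>i<n. v ((T ^^ i) x)) / real n"

lemma avg_bounded_measurable:
  assumes "v \<in> bounded_measurable M" shows "avg n v \<in> bounded_measurable M"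
proof -
  have "(\<lambda>x. (1 / real n) * (\<Sum>i<n. v ((T ^^ i) x))) \<in> bounded_measurable M"
    by (intro bounded_measurable_intros assms bounded_measurable_T_power)
  then show ?thesis by (simp add: avg_def[abs_def])
qed

lemma avg_abs_le:
  assumes "\<And>x. x \<in> space M \<Longrightarrow> \<bar>v x\<bar> \<le> c" "0 \<le> c" "x \<in> space M"
  shows "\<bar>avg n v x\<bar> \<le> c"
proof (cases "n = 0")
  case False
  have "\<bar>\<Sum>i<n. v ((T ^^ i) x)\<bar> \<le> (\<Sum>i<n. c)"
    by (rule order_trans[OF sum_abs]) (intro sum_mono assms T_power_space)
  then show ?thesis using False by (simp add: avg_def field_simps)
qed (simp add: avg_def assms)

text \<open>After cancellation of the common terms, at most k terms of size c survive at either end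
  of the two orbit segments.\<close>

lemma avg_shift:
  assumes "\<And>x. x \<in> space M \<Longrightarrow> \<bar>v x\<bar> \<le> c" "x \<in> space M"
  shows "\<bar>avg n v ((T ^^ k) x) - avg n v x\<bar> \<le> 2 * c * real k / real n"
proof -
  define a where "a i = v ((T ^^ i) x)" for i
  have a: "\<bar>a i\<bar> \<le> c" for i unfolding a_def by (intro assms T_power_space)
  have "(\<Sum>i<n. v ((T ^^ i) ((T ^^ k) x))) = (\<Sum>i<n. a (i + k))"
    by (simp add: a_def funpow_add)
  also have "(\<Sum>i<n. a (i + k)) = (\<Sum>i<n+k. a i) - (\<Sum>i<k. a i)"
    by (induction n) auto
  also have "(\<Sum>i<n+k. a i) = (\<Sum>i<n. a i) + (\<Sum>i<k. a (i + n))"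
    by (induction k) (auto simp: ac_simps)
  finally have "\<bar>(\<Sum>i<n. v ((T ^^ i) ((T ^^ k) x))) - (\<Sum>i<n. a i)\<bar> =
      \<bar>(\<Sum>i<k. a (i + n)) - (\<Sum>i<k. a i)\<bar>" by simp
  also have "\<dots> \<le> (\<Sum>i<k. c) + (\<Sum>i<k. c)"
    by (rule order_trans[OF abs_triangle_ineq4])
      (intro add_mono order_trans[OF sum_abs] sum_mono a)
  finally show ?thesis
    by (cases "n = 0") (auto simp: avg_def a_def field_simps simp flip: diff_divide_distrib)
qed

text \<open>Exchanging the two sums exhibits the double average as the mean of the averages of
  length N started at the points T^k x with k < n, and each of these is compared with the one
  started at x by \<open>avg_shift\<close>.\<close>

lemma avg_avg:
  assumes "\<And>x. x \<in> space M \<Longrightarrow> \<bar>v x\<bar> \<le> c" "x \<in> space M" "0 < n"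
  shows "\<bar>avg N (avg n v) x - avg N v x\<bar> \<le> 2 * c * real n / real N"
proof -
  have c: "0 \<le> c" using assms(1)[OF assms(2)] by linarith
  have "avg N (avg n v) x = (\<Sum>j<N. \<Sum>k<n. v ((T ^^ k) ((T ^^ j) x))) / (real n * real N)"
    by (simp add: avg_def flip: sum_divide_distrib)
  also have "(\<Sum>j<N. \<Sum>k<n. v ((T ^^ k) ((T ^^ j) x))) = (\<Sum>k<n. \<Sum>j<N. v ((T ^^ j) ((T ^^ k) x)))"
    by (subst sum.swap) (simp add: add.commute flip: funpow_add[THEN fun_cong, unfolded o_apply])
  also have "\<dots> / (real n * real N) = (\<Sum>k<n. avg N v ((T ^^ k) x)) / real n"
    by (simp add: avg_def mult.commute flip: sum_divide_distrib)
  finally have "avg N (avg n v) x = (\<Sum>k<n. avg N v ((T ^^ k) x)) / real n" .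
  then have "avg N (avg n v) x - avg N v x = (\<Sum>k<n. avg N v ((T ^^ k) x) - avg N v x) / real n"
    using assms(3) by (simp add: sum_subtractf field_simps)
  also have "\<bar>\<dots>\<bar> \<le> (\<Sum>k<n. 2 * c * real n / real N) / real n"
    unfolding abs_divide
  proof (intro divide_mono order_trans[OF sum_abs] sum_mono)
    fix k assume "k \<in> {..<n}"
    then have "2 * c * real k / real N \<le> 2 * c * real n / real N"
      using c by (intro divide_right_mono mult_left_mono) auto
    then show "\<bar>avg N v ((T ^^ k) x) - avg N v x\<bar> \<le> 2 * c * real n / real N"
      using avg_shift[of v c x N k, OF assms(1,2)] by linarith
  qed (use assms c in \<open>auto intro!: sum_nonneg\<close>)
  finally show ?thesis using assms(3) by simp
qed

text \<open>Convexity of the square, followed by invariance of the measure: averaging is an L^2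
  contraction.\<close>

lemma integral_square_avg_le:
  assumes "w \<in> bounded_measurable M"
  shows "(\<integral>x. (avg n w x)\<^sup>2 \<partial>M) \<le> (\<integral>x. (w x)\<^sup>2 \<partial>M)"
proof (cases "n = 0")
  case False
  note bm = bounded_measurable_intros avg_bounded_measurable bounded_measurable_T_power
    bounded_measurable_integrable assms
  have "(avg n w x)\<^sup>2 \<le> (\<Sum>i<n. (w ((T ^^ i) x))\<^sup>2) / real n" for x
    using sum_squared_le_sum_of_squares[of "\<lambda>i. w ((T ^^ i) x)" "{..<n}"] False
    by (simp add: avg_def power_divide field_simps power2_eq_square)
  then have "(\<integral>x. (avg n w x)\<^sup>2 \<partial>M) \<le> (\<integral>x. (\<Sum>i<n. (w ((T ^^ i) x))\<^sup>2) / real n \<partial>M)"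
    by (intro integral_mono integrable_divide bm)
  also have "\<dots> = (\<Sum>i<n. (\<integral>x. (w ((T ^^ i) x))\<^sup>2 \<partial>M)) / real n"
    by (subst integral_divide_zero, subst Bochner_Integration.integral_sum) (intro bm, simp)
  also have "\<dots> = (\<integral>x. (w x)\<^sup>2 \<partial>M)"
    using False integral_T_power[of "\<lambda>x. (w x)\<^sup>2"] bounded_measurable_borel[OF assms] by simp
  finally show ?thesis .
qed (simp add: avg_def)


text \<open>Averaging the midpoint of two fixed averages over a long segment differs from averaging
  \<open>v\<close> itself by O(1/N) uniformly, and averaging does not increase the L^2 norm of the
  midpoint. The error term arises from a difference of at most c (n + m) / N times a sum of at most
  2 c.\<close>

lemma integral_square_avg_le_midpoint:
  assumes v: "v \<in> borel_measurable M" and c: "\<And>x. x \<in> space M \<Longrightarrow> \<bar>v x\<bar> \<le> c"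
    and pos: "0 < n" "0 < m"
  shows "(\<integral>x. (avg N v x)\<^sup>2 \<partial>M)
    \<le> (\<integral>x. ((avg n v x + avg m v x) / 2)\<^sup>2 \<partial>M) + 2 * c\<^sup>2 * (real n + real m) / real N"
proof -
  have vb: "v \<in> bounded_measurable M" using v c by (rule bounded_measurableI)
  define w where "w x = (1/2) * (avg n v x + avg m v x)" for x
  have wb: "w \<in> bounded_measurable M"
    unfolding w_def by (intro bounded_measurable_intros avg_bounded_measurable vb)
  note bm = bounded_measurable_integrable bounded_measurable_intros avg_bounded_measurable vb wb
  have pt: "(avg N v x)\<^sup>2 \<le> (avg N w x)\<^sup>2 + 2 * c\<^sup>2 * (real n + real m) / real N" if x: "x \<in> space M" for x
  proof -
    have c0: "0 \<le> c" using c[OF x] by linarith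
    have wc: "\<bar>w y\<bar> \<le> c" if "y \<in> space M" for y
      using avg_abs_le[of v c y n] avg_abs_le[of v c y m] c c0 that by (auto simp: w_def abs_le_iff)
    have "avg N w x = (avg N (avg n v) x + avg N (avg m v) x) / 2"
      by (simp add: avg_def[of N] w_def sum.distrib flip: sum_divide_distrib add_divide_distrib)
    then have "avg N v x - avg N w x = ((avg N v x - avg N (avg n v) x) + (avg N v x - avg N (avg m v) x)) / 2"
      by simp
    also have "\<bar>\<dots>\<bar> \<le> (2 * c * real n / real N + 2 * c * real m / real N) / 2"
    proof -
      have "\<bar>(a + b) / 2\<bar> \<le> (p + q) / 2" if "\<bar>a\<bar> \<le> p" "\<bar>b\<bar> \<le> q" for a b p q :: real
        using that by (auto simp: abs_le_iff field_simps)
      moreover have "\<bar>avg N v x - avg N (avg n v) x\<bar> \<le> 2 * c * real n / real N"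
        "\<bar>avg N v x - avg N (avg m v) x\<bar> \<le> 2 * c * real m / real N"
        by (subst abs_minus_commute, intro avg_avg; use c x pos in simp)+
      ultimately show ?thesis by blast
    qed
    also have "\<dots> = c * (real n + real m) / real N" by (simp add: algebra_simps add_divide_distrib)
    finally have diff: "\<bar>avg N v x - avg N w x\<bar> \<le> c * (real n + real m) / real N" .
    have "(avg N v x)\<^sup>2 - (avg N w x)\<^sup>2 = (avg N v x - avg N w x) * (avg N v x + avg N w x)"
      by (simp add: power2_eq_square algebra_simps)
    also have "\<dots> \<le> \<bar>avg N v x - avg N w x\<bar> * \<bar>avg N v x + avg N w x\<bar>"
      by (simp add: abs_mult[symmetric])
    also have "\<dots> \<le> (c * (real n + real m) / real N) * (2 * c)"
      using diff avg_abs_le[of v c x N, OF c c0 x] avg_abs_le[of w c x N, OF wc c0 x] c0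
      by (intro mult_mono) auto
    finally show ?thesis by (simp add: power2_eq_square algebra_simps)
  qed
  have "(\<integral>x. (avg N v x)\<^sup>2 \<partial>M) \<le> (\<integral>x. (avg N w x)\<^sup>2 + 2 * c\<^sup>2 * (real n + real m) / real N \<partial>M)"
    by (intro integral_mono pt bm)
  also have "\<dots> = (\<integral>x. (avg N w x)\<^sup>2 \<partial>M) + 2 * c\<^sup>2 * (real n + real m) / real N"
    by (subst Bochner_Integration.integral_add; (intro bm)?) (simp add: prob_space)
  also have "\<dots> \<le> (\<integral>x. (w x)\<^sup>2 \<partial>M) + 2 * c\<^sup>2 * (real n + real m) / real N"
    using integral_square_avg_le[OF wb] by simp
  finally show ?thesis by (simp add: w_def)
qed

text \<open>Riesz's argument: the midpoint of two late averages cannot have much smaller norm than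
  the averages themselves, so the parallelogram law makes the averages a Cauchy sequence.\<close>

lemma mean_ergodic:
  assumes v: "v \<in> borel_measurable M" and c: "\<And>x. x \<in> space M \<Longrightarrow> \<bar>v x\<bar> \<le> c"
  obtains K where "K \<in> borel_measurable M" "\<And>x. x \<in> space M \<Longrightarrow> \<bar>K x\<bar> \<le> c"
    "(\<lambda>n. \<integral>x. (avg n v x - K x)\<^sup>2 \<partial>M) \<longlonglongrightarrow> 0" "AE x in M. K (T x) = K x"
proof -
  obtain x0 where x0: "x0 \<in> space M" using not_empty by blast
  have c0: "0 \<le> c" using c[OF x0] by linarith
  have vb: "v \<in> bounded_measurable M" using v c by (rule bounded_measurableI)
  note bm = bounded_measurable_integrable bounded_measurable_intros avg_bounded_measurable vb
  define s where "s n = (\<integral>x. (avg n v x)\<^sup>2 \<partial>M)" for n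
  \<comment> \<open>The index 0 is excluded: the empty average is 0 and would make the infimum
    trivial.\<close>
  define \<delta> where "\<delta> = Inf (s ` {0<..})"
  have bdd: "bdd_below (s ` {0<..})"
    by (intro bdd_belowI[of _ 0]) (auto simp: s_def)
  have \<delta>_le: "\<delta> \<le> s n" if "n > 0" for n
    unfolding \<delta>_def using that by (intro cInf_lower bdd) auto
  have mid: "\<delta> \<le> (\<integral>x. ((avg n v x + avg m v x) / 2)\<^sup>2 \<partial>M)" if "n > 0" "m > 0" for n m
  proof (rule LIMSEQ_le_const)
    have "(\<lambda>N. 2 * c\<^sup>2 * (real n + real m) / real N) \<longlonglongrightarrow> 0"
      by (rule lim_const_over_n)
    then show "(\<lambda>N. (\<integral>x. ((avg n v x + avg m v x) / 2)\<^sup>2 \<partial>M) + 2 * c\<^sup>2 * (real n + real m) / real N)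
      \<longlonglongrightarrow> (\<integral>x. ((avg n v x + avg m v x) / 2)\<^sup>2 \<partial>M)"
      using tendsto_add[OF tendsto_const] by force
    have "\<delta> \<le> (\<integral>x. ((avg n v x + avg m v x) / 2)\<^sup>2 \<partial>M) + 2 * c\<^sup>2 * (real n + real m) / real N"
      if "N \<ge> 1" for N
      using \<delta>_le[of N] integral_square_avg_le_midpoint[of v c n m N, OF v c \<open>n > 0\<close> \<open>m > 0\<close>] that
      by (simp add: s_def)
    then show "\<exists>N. \<forall>n'\<ge>N. \<delta> \<le> (\<integral>x. ((avg n v x + avg m v x) / 2)\<^sup>2 \<partial>M) + 2 * c\<^sup>2 * (real n + real m) / real n'"
      by blast
  qed
  \<comment> \<open>Using the midpoint bound with both averages equal to one nearly minimal average
    shows that all late averages are nearly minimal, not only those along a subsequence.\<close>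
  have late: "\<exists>N>0. \<forall>n\<ge>N. s n < \<delta> + e" if "e > 0" for e
  proof -
    have "\<exists>y\<in>s ` {0<..}. y < \<delta> + e/2"
      unfolding \<delta>_def using that cInf_lessD[of "s ` {0<..}" "Inf (s ` {0<..}) + e/2"] by auto
    then obtain k where k: "k > 0" "s k < \<delta> + e/2" by auto
    have "(\<lambda>N. 2 * c\<^sup>2 * (real k + real k) / real N) \<longlonglongrightarrow> 0"
      by (rule lim_const_over_n)
    then obtain N where N: "\<And>n. n \<ge> N \<Longrightarrow> norm (2 * c\<^sup>2 * (real k + real k) / real n - 0) < e/2"
      using LIMSEQ_D[of _ 0 "e/2"] \<open>e > 0\<close> by (metis half_gt_zero)
    have "s n < \<delta> + e" if "n \<ge> max N 1" for n
    proof -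
      have "s n \<le> s k + 2 * c\<^sup>2 * (real k + real k) / real n"
        using integral_square_avg_le_midpoint[of v c k k n, OF v c k(1) k(1)] by (simp add: s_def)
      also have "2 * c\<^sup>2 * (real k + real k) / real n < e/2" using N[of n] that by simp
      finally show ?thesis using k by simp
    qed
    then show ?thesis by (intro exI[of _ "max N 1"]) auto
  qed
  have "\<exists>N. \<forall>m\<ge>N. \<forall>n\<ge>N. (\<integral>x. (avg m v x - avg n v x)\<^sup>2 \<partial>M) < e" if e: "e > 0" for e
  proof -
    obtain N where N: "N > 0" "\<And>n. n \<ge> N \<Longrightarrow> s n < \<delta> + e/4" using late[of "e/4"] e by auto
    have "(\<integral>x. (avg m v x - avg n v x)\<^sup>2 \<partial>M) < e" if "m \<ge> N" "n \<ge> N" for m n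
    proof -
      have "(\<integral>x. (avg m v x - avg n v x)\<^sup>2 \<partial>M) =
        (\<integral>x. (2 * (avg m v x)\<^sup>2 + 2 * (avg n v x)\<^sup>2) - 4 * ((1/2) * (avg m v x + avg n v x))\<^sup>2 \<partial>M)"
        by (intro Bochner_Integration.integral_cong) (auto simp: power2_eq_square field_simps)
      also have "\<dots> = (\<integral>x. 2 * (avg m v x)\<^sup>2 + 2 * (avg n v x)\<^sup>2 \<partial>M) - (\<integral>x. 4 * ((1/2) * (avg m v x + avg n v x))\<^sup>2 \<partial>M)"
        by (intro Bochner_Integration.integral_diff bm)
      also have "(\<integral>x. 2 * (avg m v x)\<^sup>2 + 2 * (avg n v x)\<^sup>2 \<partial>M) = (\<integral>x. 2 * (avg m v x)\<^sup>2 \<partial>M) + (\<integral>x. 2 * (avg n v x)\<^sup>2 \<partial>M)"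
        by (intro Bochner_Integration.integral_add bm)
      finally have "(\<integral>x. (avg m v x - avg n v x)\<^sup>2 \<partial>M) = 2 * s m + 2 * s n - 4 * (\<integral>x. ((avg m v x + avg n v x) / 2)\<^sup>2 \<partial>M)"
        by (simp add: s_def)
      then show ?thesis using mid[of m n] N(1) N(2)[OF that(1)] N(2)[OF that(2)] that by linarith
    qed
    then show ?thesis by blast
  qed
  then obtain K where K: "K \<in> borel_measurable M" "\<And>x. x \<in> space M \<Longrightarrow> \<bar>K x\<bar> \<le> c"
    "(\<lambda>n. \<integral>x. (avg n v x - K x)\<^sup>2 \<partial>M) \<longlonglongrightarrow> 0"
    using avg_abs_le[of v c, OF c c0] bounded_measurable_borel[OF avg_bounded_measurable[OF vb]]
    by (elim L2_limit_of_bounded_Cauchy[of "\<lambda>n. avg n v" c, rotated 2]) auto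
  have Kb: "K \<in> bounded_measurable M" using K(1,2) by (rule bounded_measurableI)
  note bmT = bounded_measurable_comp[OF _ T_measurable]
  \<comment> \<open>Write K o T - K = (K o T - A o T) + (A o T - A) + (A - K) with A the n-th
    average. The inequality (a + b)^2 \<le> 2 a^2 + 2 b^2 is used twice; the first and last terms
    have the same norm by invariance, giving 2 + 4 = 6.\<close>
  have "(\<integral>x. (K (T x) - K x)\<^sup>2 \<partial>M) \<le> 6 * (\<integral>x. (avg n v x - K x)\<^sup>2 \<partial>M) + 4 * (2 * c / real n)\<^sup>2" for n
  proof -
    have AT: "(\<integral>x. (K (T x) - avg n v (T x))\<^sup>2 \<partial>M) = (\<integral>x. (avg n v x - K x)\<^sup>2 \<partial>M)"
      using integral_T[of "\<lambda>x. (K x - avg n v x)\<^sup>2"] K(1) bounded_measurable_borel[OF avg_bounded_measurable[OF vb, of n]]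
      by (simp add: power2_commute)
    have sh: "(\<integral>x. (avg n v (T x) - avg n v x)\<^sup>2 \<partial>M) \<le> (2 * c / real n)\<^sup>2"
    proof (rule integral_le_bound)
      fix x assume "x \<in> space M"
      then have "\<bar>avg n v (T x) - avg n v x\<bar> \<le> \<bar>2 * c / real n\<bar>"
        using avg_shift[of v c x n 1] c c0 by auto
      then show "(avg n v (T x) - avg n v x)\<^sup>2 \<le> (2 * c / real n)\<^sup>2" by (simp only: abs_le_square_iff)
    qed (use bounded_measurable_borel[OF avg_bounded_measurable[OF vb, of n]] in auto)
    have 1: "(\<lambda>x. K (T x) - avg n v (T x)) \<in> bounded_measurable M"
      by (intro bm bmT[of "\<lambda>x. K x - avg n v x"] Kb)
    have 2: "(\<lambda>x. avg n v (T x) - avg n v x) \<in> bounded_measurable M"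
      by (intro bm bmT[of "avg n v"])
    have 3: "(\<lambda>x. avg n v x - K x) \<in> bounded_measurable M" by (intro bm Kb)
    have 4: "(\<lambda>x. (avg n v (T x) - avg n v x) + (avg n v x - K x)) \<in> bounded_measurable M"
      using 2 3 by (rule bounded_measurable_add)
    show ?thesis
      using integral_square_add_le[OF 1 4] integral_square_add_le[OF 2 3] AT sh by simp
  qed
  moreover have "(\<lambda>n. 6 * (\<integral>x. (avg n v x - K x)\<^sup>2 \<partial>M) + 4 * (2 * c / real n)\<^sup>2) \<longlonglongrightarrow> 6 * 0 + 4 * 0\<^sup>2"
    by (intro tendsto_intros K lim_const_over_n)
  ultimately have "(\<integral>x. (K (T x) - K x)\<^sup>2 \<partial>M) \<le> 0"
    by (intro LIMSEQ_le_const[of _ 0]) auto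
  then have "(\<integral>x. (K (T x) - K x)\<^sup>2 \<partial>M) = 0" by (intro antisym) auto
  then have "AE x in M. K (T x) - K x = 0"
    by (intro integral_square_zero_AE bm bmT Kb)
  then show ?thesis using K by (intro that[of K]) auto
qed

end

section \<open>The invariant kernel and its integral operator\<close>

context prob_space
begin

definition ip :: "('a \<Rightarrow> real) \<Rightarrow> ('a \<Rightarrow> real) \<Rightarrow> real" where
  "ip g h = (\<integral>x. g x * h x \<partial>M)"

lemma ip_commute: "ip g h = ip h g"
  by (simp add: ip_def mult.commute)

lemma ip_self: "ip g g = (\<integral>x. (g x)\<^sup>2 \<partial>M)"
  by (simp add: ip_def power2_eq_square)

lemma ip_self_nonneg: "0 \<le> ip g g"
  by (simp add: ip_self)

lemma ip_cong:
  "(\<And>x. x \<in> space M \<Longrightarrow> g x = g' x) \<Longrightarrow> (\<And>x. x \<in> space M \<Longrightarrow> h x = h' x) \<Longrightarrow> ip g h = ip g' h'"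
  unfolding ip_def by (intro Bochner_Integration.integral_cong) auto

lemma ip_linear_right:
  assumes "g \<in> bounded_measurable M" "h \<in> bounded_measurable M" "k \<in> bounded_measurable M"
  shows "ip k (\<lambda>x. a * g x + b * h x) = a * ip k g + b * ip k h"
proof -
  have "ip k (\<lambda>x. a * g x + b * h x) = (\<integral>x. a * (k x * g x) + b * (k x * h x) \<partial>M)"
    unfolding ip_def by (intro Bochner_Integration.integral_cong) (auto simp: algebra_simps)
  also have "\<dots> = (\<integral>x. a * (k x * g x) \<partial>M) + (\<integral>x. b * (k x * h x) \<partial>M)"
    by (intro Bochner_Integration.integral_add bounded_measurable_integrable bounded_measurable_intros assms)
  finally show ?thesis by (simp only: ip_def integral_mult_right_zero)
qed

lemma ip_linear_left:
  assumes "g \<in> bounded_measurable M" "h \<in> bounded_measurable M" "k \<in> bounded_measurable M"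
  shows "ip (\<lambda>x. a * g x + b * h x) k = a * ip g k + b * ip h k"
  using ip_linear_right[OF assms] by (simp add: ip_commute)

lemma ip_diff_right:
  assumes "g \<in> bounded_measurable M" "h \<in> bounded_measurable M" "k \<in> bounded_measurable M"
  shows "ip k (\<lambda>x. g x - h x) = ip k g - ip k h"
  using ip_linear_right[OF assms, of 1 "-1"] by simp

lemma ip_sum_right:
  assumes "\<And>i. i \<in> I \<Longrightarrow> g i \<in> bounded_measurable M" "k \<in> bounded_measurable M"
  shows "ip k (\<lambda>x. \<Sum>i\<in>I. c i * g i x) = (\<Sum>i\<in>I. c i * ip k (g i))"
  using assms(1)
proof (induction I rule: infinite_finite_induct)
  case (insert i I)
  have "(\<lambda>x. \<Sum>i\<in>I. c i * g i x) \<in> bounded_measurable M"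
    by (intro bounded_measurable_intros) (use insert in auto)
  then have "ip k (\<lambda>x. c i * g i x + 1 * (\<Sum>i\<in>I. c i * g i x)) = c i * ip k (g i) + 1 * ip k (\<lambda>x. \<Sum>i\<in>I. c i * g i x)"
    using insert assms(2) by (intro ip_linear_right) auto
  then show ?case using insert by simp
qed (auto simp: ip_def)

lemma ip_diff_cmult_self:
  assumes "g \<in> bounded_measurable M" "h \<in> bounded_measurable M"
  shows "ip (\<lambda>x. g x - c * h x) (\<lambda>x. g x - c * h x) = ip g g - 2 * c * ip g h + c\<^sup>2 * ip h h"
proof -
  have d: "(\<lambda>x. g x - c * h x) \<in> bounded_measurable M" by (intro bounded_measurable_intros assms)
  have "ip (\<lambda>x. g x - c * h x) (\<lambda>x. g x - c * h x) = ip g (\<lambda>x. g x - c * h x) - c * ip h (\<lambda>x. g x - c * h x)"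
    using ip_linear_left[OF assms d, of 1 "-c"] by simp
  also have "ip k (\<lambda>x. g x - c * h x) = ip k g - c * ip k h" if "k \<in> bounded_measurable M" for k
    using ip_linear_right[OF assms that, of 1 "-c"] by simp
  note this[OF assms(1)]
  also have "ip h (\<lambda>x. g x - c * h x) = ip g h - c * ip h h"
    using ip_linear_right[OF assms assms(2), of 1 "-c"] by (simp add: ip_commute)
  finally show ?thesis by (simp add: power2_eq_square algebra_simps)
qed

lemma ip_square_le:
  assumes "g \<in> bounded_measurable M" "h \<in> bounded_measurable M"
  shows "(ip g h)\<^sup>2 \<le> ip g g * ip h h"
  using square_integral_mult_le[OF assms] by (simp add: ip_self ip_def[of g h])

lemma ip_add_self_le:
  assumes "g \<in> bounded_measurable M" "h \<in> bounded_measurable M"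
  shows "ip (\<lambda>x. g x + h x) (\<lambda>x. g x + h x) \<le> 2 * ip g g + 2 * ip h h"
  using integral_square_add_le[OF assms] by (simp add: ip_self)

lemma ip_diff_self_le:
  assumes "g \<in> bounded_measurable M" "h \<in> bounded_measurable M"
  shows "ip (\<lambda>x. g x - h x) (\<lambda>x. g x - h x) \<le> 2 * ip g g + 2 * ip h h"
  using ip_add_self_le[OF assms(1) bounded_measurable_cmult[OF assms(2), of "-1"]] by (simp add: ip_self)

lemma ip_self_zero_AE:
  "g \<in> bounded_measurable M \<Longrightarrow> ip g g = 0 \<Longrightarrow> AE x in M. g x = 0"
  using integral_square_zero_AE by (simp add: ip_self)

lemma ip_self_cmult: "ip (\<lambda>x. c * g x) (\<lambda>x. c * g x) = c\<^sup>2 * ip g g"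
  by (simp add: ip_self power_mult_distrib)

lemma abs_integral_le_ip:
  assumes "g \<in> bounded_measurable M"
  shows "(\<integral>x. \<bar>g x\<bar> \<partial>M)\<^sup>2 \<le> ip g g"
  using square_integral_le[OF bounded_measurable_abs[OF assms]] by (simp add: ip_self)

lemma prob_space_pair_self: "pair_prob_space M M"
  by unfold_locales

lemma bounded_measurable_tensor:
  assumes "g \<in> bounded_measurable M" "h \<in> bounded_measurable M"
  shows "(\<lambda>z. g (fst z) * h (snd z)) \<in> bounded_measurable (M \<Otimes>\<^sub>M M)"
  by (intro bounded_measurable_mult bounded_measurable_comp[OF assms(1)] bounded_measurable_comp[OF assms(2)]) auto

lemma integral_pair_iterated:
  assumes "\<phi> \<in> bounded_measurable (M \<Otimes>\<^sub>M M)"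
  shows "(\<integral>z. \<phi> z \<partial>(M \<Otimes>\<^sub>M M)) = (\<integral>x. \<integral>y. \<phi> (x, y) \<partial>M \<partial>M)"
proof -
  interpret P: pair_prob_space M M by (rule prob_space_pair_self)
  show ?thesis using P.integral_fst'[OF P.bounded_measurable_integrable[OF assms]] by simp
qed

lemma integral_tensor:
  assumes "g \<in> bounded_measurable M" "h \<in> bounded_measurable M"
  shows "(\<integral>z. g (fst z) * h (snd z) \<partial>(M \<Otimes>\<^sub>M M)) = (\<integral>x. g x \<partial>M) * (\<integral>x. h x \<partial>M)"
  by (simp add: integral_pair_iterated[OF bounded_measurable_tensor[OF assms]])

end

section \<open>The product system and its limit kernel\<close>

lemma (in measure_preserving_map) measure_preserving_map_prod:
  "measure_preserving_map (M \<Otimes>\<^sub>M M) (\<lambda>(x, y). (T x, T y))"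
proof -
  interpret P: pair_prob_space M M by (rule prob_space_pair_self)
  show ?thesis
  proof
    show "(\<lambda>(x, y). (T x, T y)) \<in> (M \<Otimes>\<^sub>M M) \<rightarrow>\<^sub>M (M \<Otimes>\<^sub>M M)" by measurable
    show "distr (M \<Otimes>\<^sub>M M) (M \<Otimes>\<^sub>M M) (\<lambda>(x, y). (T x, T y)) = M \<Otimes>\<^sub>M M"
      using pair_measure_distr[OF T_measurable T_measurable] sigma_finite_measure_axioms by (simp add: distr_T)
  qed
qed

lemma funpow_prod_map:
  fixes T :: "'a \<Rightarrow> 'a"
  shows "((\<lambda>(x, y). (T x, T y)) ^^ i) z = ((T ^^ i) (fst z), (T ^^ i) (snd z))"
  by (induction i arbitrary: z) (auto split: prod.splits)

text \<open>The bound on \<open>K\<close> is required at every point of the product, so that each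
  section of \<open>K\<close> is bounded and the integral operator acts on functions rather than on
  classes. Invariance, coming from an L^2 limit, is only available almost everywhere.\<close>

locale averaged_kernel = measure_preserving_map M T for M :: "'a measure" and T :: "'a \<Rightarrow> 'a" +
  fixes f :: "'a \<Rightarrow> real" and K :: "'a \<times> 'a \<Rightarrow> real"
  assumes f_measurable [measurable]: "f \<in> borel_measurable M"
    and f_le: "\<And>x. x \<in> space M \<Longrightarrow> \<bar>f x\<bar> \<le> 1"
    and K_measurable [measurable]: "K \<in> borel_measurable (M \<Otimes>\<^sub>M M)"
    and K_le: "\<And>z. z \<in> space (M \<Otimes>\<^sub>M M) \<Longrightarrow> \<bar>K z\<bar> \<le> 1"
    and K_limit: "(\<lambda>n. \<integral>z. ((\<Sum>i<n. f ((T ^^ i) (fst z)) * f ((T ^^ i) (snd z))) / real n - K z)\<^sup>2 \<partial>(M \<Otimes>\<^sub>M M)) \<longlonglongrightarrow> 0"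
    and K_invariant: "AE z in M \<Otimes>\<^sub>M M. K (T (fst z), T (snd z)) = K z"

lemma (in measure_preserving_map) averaged_kernel_exists:
  assumes f: "f \<in> borel_measurable M" "\<And>x. x \<in> space M \<Longrightarrow> \<bar>f x\<bar> \<le> 1"
  shows "\<exists>K. averaged_kernel M T f K"
proof -
  interpret S: measure_preserving_map "M \<Otimes>\<^sub>M M" "\<lambda>(x, y). (T x, T y)"
    by (rule measure_preserving_map_prod)
  have fb: "f \<in> bounded_measurable M" using f by (rule bounded_measurableI)
  obtain K where K: "K \<in> borel_measurable (M \<Otimes>\<^sub>M M)" "\<And>z. z \<in> space (M \<Otimes>\<^sub>M M) \<Longrightarrow> \<bar>K z\<bar> \<le> 1"
    "(\<lambda>n. \<integral>z. (S.avg n (\<lambda>z. f (fst z) * f (snd z)) z - K z)\<^sup>2 \<partial>(M \<Otimes>\<^sub>M M)) \<longlonglongrightarrow> 0"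
    "AE z in M \<Otimes>\<^sub>M M. K ((\<lambda>(x, y). (T x, T y)) z) = K z"
  proof (rule S.mean_ergodic[of "\<lambda>z. f (fst z) * f (snd z)" 1])
    show "\<bar>f (fst z) * f (snd z)\<bar> \<le> 1" if "z \<in> space (M \<Otimes>\<^sub>M M)" for z
      using that f(2)[of "fst z"] f(2)[of "snd z"]
      by (auto simp: abs_mult space_pair_measure intro!: mult_le_one)
  qed (use f in auto)
  show ?thesis
    using K by (intro exI[of _ K], unfold_locales)
      (auto simp: f S.avg_def funpow_prod_map split_beta)
qed

section \<open>The operator and the quadratic form of the limit kernel\<close>

context averaged_kernel
begin

sublocale prod: pair_prob_space M M
  by (rule prob_space_pair_self)

lemma f_bm: "f \<in> bounded_measurable M"
  by (rule bounded_measurableI[OF f_measurable f_le])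

lemma K_bm: "K \<in> bounded_measurable (M \<Otimes>\<^sub>M M)"
  by (rule bounded_measurableI[OF K_measurable K_le])

definition fT :: "nat \<Rightarrow> 'a \<Rightarrow> real" where "fT i x = f ((T ^^ i) x)"

lemma fT_bm: "fT i \<in> bounded_measurable M"
  unfolding fT_def by (rule bounded_measurable_T_power[OF f_bm])

lemma fT_le: "x \<in> space M \<Longrightarrow> \<bar>fT i x\<bar> \<le> 1"
  unfolding fT_def by (intro f_le T_power_space)

definition F :: "nat \<Rightarrow> 'a \<times> 'a \<Rightarrow> real" where
  "F n z = (1 / real n) * (\<Sum>i<n. fT i (fst z) * fT i (snd z))"

lemma F_bm: "F n \<in> bounded_measurable (M \<Otimes>\<^sub>M M)"
  unfolding F_def by (intro bounded_measurable_intros bounded_measurable_tensor fT_bm bounded_measurable_comp[OF fT_bm]) auto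

definition \<epsilon> :: "nat \<Rightarrow> real" where "\<epsilon> n = (\<integral>z. (F n z - K z)\<^sup>2 \<partial>(M \<Otimes>\<^sub>M M))"

lemma \<epsilon>_limit: "\<epsilon> \<longlonglongrightarrow> 0"
  using K_limit by (simp add: \<epsilon>_def[abs_def] F_def fT_def)

lemma \<epsilon>_nonneg: "0 \<le> \<epsilon> n"
  by (simp add: \<epsilon>_def)

definition op :: "('a \<Rightarrow> real) \<Rightarrow> 'a \<Rightarrow> real" where "op g x = (\<integral>y. K (x, y) * g y \<partial>M)"

text \<open>Taken as an integral over the product rather than as \<open>ip g (op h)\<close>, so that
  L^2 convergence of kernels passes to it by Cauchy-Schwarz on the product space.\<close>

definition form :: "('a \<Rightarrow> real) \<Rightarrow> ('a \<Rightarrow> real) \<Rightarrow> real" where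
  "form g h = (\<integral>z. K z * (g (fst z) * h (snd z)) \<partial>(M \<Otimes>\<^sub>M M))"

lemma section_bm: "\<phi> \<in> bounded_measurable (M \<Otimes>\<^sub>M M) \<Longrightarrow> x \<in> space M \<Longrightarrow> (\<lambda>y. \<phi> (x, y)) \<in> bounded_measurable M"
  by (rule bounded_measurable_comp) auto

lemma op_le:
  assumes g: "g \<in> bounded_measurable M" and x: "x \<in> space M"
  shows "\<bar>op g x\<bar> \<le> (\<integral>y. \<bar>g y\<bar> \<partial>M)"
proof -
  note bm = bounded_measurable_integrable bounded_measurable_intros section_bm[OF K_bm x] g
  have "\<bar>op g x\<bar> \<le> (\<integral>y. \<bar>K (x, y) * g y\<bar> \<partial>M)" unfolding op_def by (rule integral_abs_bound)
  also have "\<dots> \<le> (\<integral>y. \<bar>g y\<bar> \<partial>M)"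
  proof (intro integral_mono bm)
    fix y assume "y \<in> space M"
    then show "\<bar>K (x, y) * g y\<bar> \<le> \<bar>g y\<bar>"
      using K_le[of "(x, y)"] x by (auto simp: abs_mult space_pair_measure intro!: mult_left_le_one_le)
  qed
  finally show ?thesis .
qed

lemma op_bm: assumes g: "g \<in> bounded_measurable M" shows "op g \<in> bounded_measurable M"
proof (rule bounded_measurableI)
  note [measurable] = bounded_measurable_borel[OF g]
  show "op g \<in> borel_measurable M" unfolding op_def by measurable
qed (rule op_le[OF g])

lemma op_linear:
  assumes "g \<in> bounded_measurable M" "h \<in> bounded_measurable M" "x \<in> space M"
  shows "op (\<lambda>y. a * g y + b * h y) x = a * op g x + b * op h x"
  using ip_linear_right[OF assms(1,2) section_bm[OF K_bm assms(3)], of a b] by (simp add: ip_def op_def)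

lemma op_diff:
  assumes "g \<in> bounded_measurable M" "h \<in> bounded_measurable M" "x \<in> space M"
  shows "op (\<lambda>y. g y - h y) x = op g x - op h x"
  using op_linear[OF assms, of 1 "-1"] by simp

lemma op_sum:
  assumes "\<And>i. i \<in> I \<Longrightarrow> g i \<in> bounded_measurable M" "x \<in> space M"
  shows "op (\<lambda>y. \<Sum>i\<in>I. c i * g i y) x = (\<Sum>i\<in>I. c i * op (g i) x)"
  using ip_sum_right[of I g "\<lambda>y. K (x, y)" c] assms section_bm[OF K_bm assms(2)] by (simp add: ip_def op_def)

lemma op_contraction:
  assumes g: "g \<in> bounded_measurable M"
  shows "ip (op g) (op g) \<le> ip g g"
  unfolding ip_self[of "op g"]
proof (rule integral_le_bound)
  fix x assume "x \<in> space M"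
  then have "\<bar>op g x\<bar> \<le> \<bar>\<integral>y. \<bar>g y\<bar> \<partial>M\<bar>" using op_le[OF g] by simp
  then have "(op g x)\<^sup>2 \<le> (\<integral>y. \<bar>g y\<bar> \<partial>M)\<^sup>2" by (simp only: abs_le_square_iff)
  then show "(op g x)\<^sup>2 \<le> ip g g" using abs_integral_le_ip[OF g] by linarith
qed (auto intro!: ip_self_nonneg bounded_measurable_borel bounded_measurable_power2 op_bm g)

lemma form_eq_ip:
  assumes "g \<in> bounded_measurable M" "h \<in> bounded_measurable M"
  shows "form g h = ip g (op h)"
proof -
  have "form g h = (\<integral>x. \<integral>y. K (x, y) * (g x * h y) \<partial>M \<partial>M)"
    unfolding form_def
    by (subst integral_pair_iterated) (auto intro!: bounded_measurable_mult K_bm bounded_measurable_tensor assms)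
  also have "\<dots> = (\<integral>x. g x * op h x \<partial>M)"
    by (simp add: op_def mult.left_commute)
  finally show ?thesis by (simp add: ip_def)
qed

text \<open>The sum is the form of the averaged kernel \<open>F n\<close>. Its distance to
  \<open>form g h\<close> is an inner product of \<open>F n - K\<close> with the tensor product of g
  and h, whose square norm is \<open>ip g g * ip h h\<close>. The error is thus uniform on the unit
  ball.\<close>

lemma form_approx:
  assumes "g \<in> bounded_measurable M" "h \<in> bounded_measurable M"
  shows "((\<Sum>i<n. ip (fT i) g * ip (fT i) h) / real n - form g h)\<^sup>2 \<le> \<epsilon> n * (ip g g * ip h h)"
proof -
  define \<phi> where "\<phi> z = g (fst z) * h (snd z)" for z
  have \<phi>: "\<phi> \<in> bounded_measurable (M \<Otimes>\<^sub>M M)"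
    unfolding \<phi>_def by (intro bounded_measurable_tensor assms)
  have coeff: "prod.ip \<phi> (\<lambda>z. fT i (fst z) * fT i (snd z)) = ip (fT i) g * ip (fT i) h" for i
  proof -
    have "prod.ip \<phi> (\<lambda>z. fT i (fst z) * fT i (snd z)) =
      (\<integral>z. (fT i (fst z) * g (fst z)) * (fT i (snd z) * h (snd z)) \<partial>(M \<Otimes>\<^sub>M M))"
      unfolding prod.ip_def \<phi>_def by (intro Bochner_Integration.integral_cong) auto
    also have "\<dots> = ip (fT i) g * ip (fT i) h"
      unfolding ip_def by (intro integral_tensor bounded_measurable_mult fT_bm assms)
    finally show ?thesis .
  qed
  have "prod.ip (\<lambda>z. F n z - K z) \<phi> = prod.ip \<phi> (F n) - form g h"
    using prod.ip_diff_right[OF F_bm[of n] K_bm \<phi>] 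
    by (simp add: prod.ip_commute[of _ \<phi>] form_def prod.ip_def[of _ K] \<phi>_def mult.commute)
  also have "prod.ip \<phi> (F n) = (\<Sum>i<n. (1 / real n) * prod.ip \<phi> (\<lambda>z. fT i (fst z) * fT i (snd z)))"
    unfolding F_def sum_distrib_left by (rule prod.ip_sum_right) (intro bounded_measurable_tensor fT_bm \<phi>)+
  finally have "prod.ip (\<lambda>z. F n z - K z) \<phi> = (\<Sum>i<n. ip (fT i) g * ip (fT i) h) / real n - form g h"
    by (simp add: coeff sum_divide_distrib)
  moreover have "prod.ip \<phi> \<phi> = ip g g * ip h h"
  proof -
    have "prod.ip \<phi> \<phi> = (\<integral>z. (g (fst z) * g (fst z)) * (h (snd z) * h (snd z)) \<partial>(M \<Otimes>\<^sub>M M))"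
      unfolding prod.ip_def \<phi>_def by (intro Bochner_Integration.integral_cong) auto
    also have "\<dots> = ip g g * ip h h"
      unfolding ip_def by (intro integral_tensor bounded_measurable_mult assms)
    finally show ?thesis .
  qed
  moreover have "prod.ip (\<lambda>z. F n z - K z) (\<lambda>z. F n z - K z) = \<epsilon> n"
    by (simp add: prod.ip_self \<epsilon>_def)
  ultimately show ?thesis
    using prod.ip_square_le[OF bounded_measurable_diff[OF F_bm[of n] K_bm] \<phi>] by simp
qed

text \<open>Symmetry and positivity of the form are evident for the approximating sums and are
  inherited through this limit.\<close>

lemma form_limit:
  assumes "g \<in> bounded_measurable M" "h \<in> bounded_measurable M"
  shows "(\<lambda>n. (\<Sum>i<n. ip (fT i) g * ip (fT i) h) / real n) \<longlonglongrightarrow> form g h"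
proof -
  have "(\<lambda>n. ((\<Sum>i<n. ip (fT i) g * ip (fT i) h) / real n - form g h)\<^sup>2) \<longlonglongrightarrow> 0"
  proof (rule tendsto_sandwich[OF _ _ tendsto_const])
    show "(\<lambda>n. \<epsilon> n * (ip g g * ip h h)) \<longlonglongrightarrow> 0"
      using tendsto_mult_right[OF \<epsilon>_limit] by simp
  qed (use form_approx[OF assms] in auto)
  then have "(\<lambda>n. (\<Sum>i<n. ip (fT i) g * ip (fT i) h) / real n - form g h) \<longlonglongrightarrow> 0"
    using tendsto_real_sqrt by (fastforce simp: tendsto_rabs_zero_iff)
  then show ?thesis by (simp add: LIM_zero_iff)
qed

lemma form_commute:
  assumes "g \<in> bounded_measurable M" "h \<in> bounded_measurable M"
  shows "form g h = form h g"
  using form_limit[OF assms] form_limit[OF assms(2,1)]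
  by (intro LIMSEQ_unique) (auto simp: mult.commute)

lemma form_nonneg: "g \<in> bounded_measurable M \<Longrightarrow> 0 \<le> form g g"
  by (rule LIMSEQ_le_const[OF form_limit]) (auto intro!: divide_nonneg_nonneg sum_nonneg)

lemma form_linear_right:
  assumes "g \<in> bounded_measurable M" "h \<in> bounded_measurable M" "k \<in> bounded_measurable M"
  shows "form k (\<lambda>x. a * g x + b * h x) = a * form k g + b * form k h"
proof -
  have "form k (\<lambda>x. a * g x + b * h x) = ip k (op (\<lambda>x. a * g x + b * h x))"
    by (intro form_eq_ip assms bounded_measurable_intros)
  also have "\<dots> = ip k (\<lambda>x. a * op g x + b * op h x)"
    by (intro ip_cong op_linear assms) auto
  finally show ?thesis using assms by (simp add: ip_linear_right op_bm form_eq_ip)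
qed

text \<open>Cauchy-Schwarz for a form that is only positive semidefinite, which is why the
  discriminant inequality has to admit a vanishing leading coefficient.\<close>

lemma form_square_le:
  assumes g: "g \<in> bounded_measurable M" and h: "h \<in> bounded_measurable M"
  shows "(form g h)\<^sup>2 \<le> form g g * form h h"
proof (rule discriminant_le_if_nonneg)
  fix t :: real
  define k where "k x = t * g x + 1 * h x" for x
  have k: "k \<in> bounded_measurable M" unfolding k_def by (intro bounded_measurable_intros g h)
  have "form k k = t * form k g + form k h"
    using form_linear_right[OF g h k, of t 1] by (simp add: k_def[abs_def])
  also have "form k g = t * form g g + form g h"
    using form_linear_right[OF g h g, of t 1] form_commute[OF k g] by (simp add: k_def[abs_def])
  also have "form k h = t * form g h + form h h"
    using form_linear_right[OF g h h, of t 1] form_commute[OF k h] form_commute[OF g h] by (simp add: k_def[abs_def])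
  finally show "0 \<le> form h h + 2 * form g h * t + form g g * t\<^sup>2"
    using form_nonneg[OF k] by (simp add: algebra_simps power2_eq_square)
qed (rule form_nonneg[OF g])

lemma form_le_ip:
  assumes g: "g \<in> bounded_measurable M"
  shows "form g g \<le> ip g g"
proof (rule power2_le_imp_le)
  have "(form g g)\<^sup>2 \<le> ip g g * ip (op g) (op g)"
    unfolding form_eq_ip[OF g g] by (intro ip_square_le g op_bm)
  also have "\<dots> \<le> ip g g * ip g g"
    by (intro mult_left_mono op_contraction g ip_self_nonneg)
  finally show "(form g g)\<^sup>2 \<le> (ip g g)\<^sup>2" by (simp add: power2_eq_square)
qed (rule ip_self_nonneg)

lemma form_cmult:
  assumes "g \<in> bounded_measurable M"
  shows "form (\<lambda>x. c * g x) (\<lambda>x. c * g x) = c\<^sup>2 * form g g"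
  by (simp add: form_def power2_eq_square algebra_simps flip: integral_mult_right_zero)

text \<open>The operator of \<open>F n\<close> kills every g orthogonal to the first n translates of
  f, so on such g the operator of \<open>K\<close> acts like that of \<open>K - F n\<close>, whose
  Hilbert-Schmidt norm squared is \<open>\<epsilon> n\<close>. This is the quantitative compactness
  that makes eigenspaces finite dimensional.\<close>

lemma ip_op_le_if_orthogonal:
  assumes g: "g \<in> bounded_measurable M" and orth: "\<And>i. i < n \<Longrightarrow> ip (fT i) g = 0"
  shows "ip (op g) (op g) \<le> \<epsilon> n * ip g g"
proof -
  define D where "D z = F n z - K z" for z
  have D: "D \<in> bounded_measurable (M \<Otimes>\<^sub>M M)" unfolding D_def by (intro bounded_measurable_diff F_bm K_bm)
  have pt: "(op g x)\<^sup>2 \<le> (\<integral>y. (D (x, y))\<^sup>2 \<partial>M) * ip g g" if x: "x \<in> space M" for x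
  proof -
    have "ip g (\<lambda>y. F n (x, y)) = ip g (\<lambda>y. \<Sum>i<n. (fT i x / real n) * fT i y)"
      unfolding F_def by (simp add: sum_divide_distrib)
    also have "\<dots> = (\<Sum>i<n. (fT i x / real n) * ip g (fT i))"
      by (intro ip_sum_right fT_bm g)
    also have "\<dots> = 0" using orth by (simp add: ip_commute)
    finally have "ip g (\<lambda>y. D (x, y)) = - op g x"
      using ip_diff_right[OF section_bm[OF F_bm[of n] x] section_bm[OF K_bm x] g]
      by (simp add: D_def op_def ip_def[of g "\<lambda>y. K (x, y)"] mult.commute)
    then have "(op g x)\<^sup>2 = (ip g (\<lambda>y. D (x, y)))\<^sup>2" by simp
    also have "\<dots> \<le> ip g g * ip (\<lambda>y. D (x, y)) (\<lambda>y. D (x, y))"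
      by (intro ip_square_le g section_bm D x)
    finally show ?thesis by (simp add: ip_self[of "\<lambda>y. D (x, y)"] mult.commute)
  qed
  have D2: "(\<lambda>z. (D z)\<^sup>2) \<in> bounded_measurable (M \<Otimes>\<^sub>M M)"
    by (intro bounded_measurable_intros D)
  have "ip (op g) (op g) = (\<integral>x. (op g x)\<^sup>2 \<partial>M)" by (rule ip_self)
  also have "\<dots> \<le> (\<integral>x. (\<integral>y. (D (x, y))\<^sup>2 \<partial>M) * ip g g \<partial>M)"
    using prod.integrable_fst'[OF prod.bounded_measurable_integrable[OF D2]]
    by (intro integral_mono pt bounded_measurable_integrable[OF bounded_measurable_power2] op_bm g
        Bochner_Integration.integrable_mult_left) auto
  also have "\<dots> = (\<integral>z. (D z)\<^sup>2 \<partial>(M \<Otimes>\<^sub>M M)) * ip g g"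
    by (simp add: integral_pair_iterated[OF D2])
  finally show ?thesis by (simp add: \<epsilon>_def D_def)
qed

end

section \<open>Eigenfunctions from a nonzero kernel\<close>

text \<open>The sequences of inner products with all translates of f live in this cube. Its
  compactness replaces a diagonal extraction of subsequences.\<close>

lemma compact_cube: "compact {c :: nat \<Rightarrow> real. \<forall>i. \<bar>c i\<bar> \<le> 1}"
proof -
  have "{c :: nat \<Rightarrow> real. \<forall>i. \<bar>c i\<bar> \<le> 1} = PiE UNIV (\<lambda>_. {-1..1})"
    by (auto simp: PiE_UNIV_domain abs_le_iff minus_le_iff)
  moreover have "compactin (product_topology (\<lambda>_. euclidean) UNIV) (PiE (UNIV :: nat set) (\<lambda>_. {-1..1 :: real}))"
    by (subst compactin_PiE) auto
  ultimately show ?thesis by (simp add: euclidean_product_topology)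
qed

text \<open>Gaussian elimination: an equation j with nonzero coefficient at the unknown p is solved
  for p and substituted into the others, leaving one equation and one unknown fewer.\<close>

lemma homogeneous_system_nontrivial:
  fixes a :: "'i \<Rightarrow> 'j \<Rightarrow> real"
  assumes "finite J" "finite I" "card J < card I"
  shows "\<exists>c. (\<exists>i\<in>I. c i \<noteq> 0) \<and> (\<forall>j\<in>J. (\<Sum>i\<in>I. c i * a i j) = 0)"
  using assms
proof (induction J arbitrary: I a rule: finite_induct)
  case empty
  then have "I \<noteq> {}" by auto
  then show ?case by (intro exI[of _ "\<lambda>_. 1"]) auto
next
  case (insert j J)
  show ?case
  proof (cases "\<forall>i\<in>I. a i j = 0")
    case True
    then show ?thesis using insert.IH[of I a] insert.hyps insert.prems by auto
  next
    case False
    then obtain p where p: "p \<in> I" "a p j \<noteq> 0" by auto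
    define a' where "a' i k = a i k - a i j / a p j * a p k" for i k
    have "\<exists>c. (\<exists>i\<in>I - {p}. c i \<noteq> 0) \<and> (\<forall>j\<in>J. (\<Sum>i\<in>I - {p}. c i * a' i j) = 0)"
      using insert.hyps insert.prems p by (intro insert.IH) auto
    then obtain c where c: "\<exists>i\<in>I - {p}. c i \<noteq> 0" "\<And>k. k \<in> J \<Longrightarrow> (\<Sum>i\<in>I - {p}. c i * a' i k) = 0"
      by auto
    \<comment> \<open>At p stands the value forced by equation j.\<close>
    define c' where "c' i = (if i = p then - (\<Sum>i\<in>I - {p}. c i * a i j) / a p j else c i)" for i
    have sum_eq: "(\<Sum>i\<in>I. c' i * a i k) = (\<Sum>i\<in>I - {p}. c i * a' i k)" for k
    proof -
      have "(\<Sum>i\<in>I. c' i * a i k) = c' p * a p k + (\<Sum>i\<in>I - {p}. c' i * a i k)"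
        using insert.prems p by (intro sum.remove) auto
      also have "(\<Sum>i\<in>I - {p}. c' i * a i k) = (\<Sum>i\<in>I - {p}. c i * a i k)"
        by (intro sum.cong) (auto simp: c'_def)
      also have "c' p * a p k = - (\<Sum>i\<in>I - {p}. c i * (a i j / a p j * a p k))"
        by (simp add: c'_def sum_divide_distrib sum_distrib_right mult.assoc)
      finally show ?thesis by (simp add: a'_def right_diff_distrib sum_subtractf)
    qed
    have "a' i j = 0" for i using p by (simp add: a'_def)
    then have "\<forall>k\<in>insert j J. (\<Sum>i\<in>I. c' i * a i k) = 0"
      using c by (auto simp: sum_eq)
    moreover have "\<exists>i\<in>I. c' i \<noteq> 0" using c by (auto simp: c'_def)
    ultimately show ?thesis by blast
  qed
qed

section \<open>Eigenvectors of the kernel operator and their orbits\<close>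

context averaged_kernel
begin

text \<open>The eigenvector is a limit of vectors almost maximising the quadratic form on the unit ball;
  the limit exists because the form is a uniform limit of forms of finite rank.\<close>

lemma eigenvector_exists:
  assumes g0: "g0 \<in> bounded_measurable M" "form g0 g0 \<noteq> 0"
  obtains u s where "u \<in> bounded_measurable M" "0 < s" "AE x in M. op u x = s * u x" "ip u u \<noteq> 0"
proof -
  define B where "B = {g \<in> bounded_measurable M. ip g g \<le> 1}"
  define s where "s = Sup ((\<lambda>g. form g g) ` B)"
  have bdd: "bdd_above ((\<lambda>g. form g g) ` B)"
    by (intro bdd_aboveI[of _ 1]) (auto simp: B_def intro: order_trans[OF form_le_ip])
  have form_le_s: "form g g \<le> s" if "g \<in> B" for g
    unfolding s_def using that by (intro cSup_upper bdd) auto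
  have "(\<lambda>_. 0) \<in> B" by (simp add: B_def ip_def)
  then have B_ne: "B \<noteq> {}" by auto
  have s_le: "s \<le> 1"
    unfolding s_def using B_ne by (intro cSup_least) (auto simp: B_def intro: order_trans[OF form_le_ip])
  have normalize: "form g g / ip g g \<le> s" if g: "g \<in> bounded_measurable M" "0 < ip g g" for g
  proof -
    define c where "c = 1 / sqrt (ip g g)"
    have c2: "c\<^sup>2 = 1 / ip g g" using g by (simp add: c_def power_divide)
    have "(\<lambda>x. c * g x) \<in> B"
      using g by (simp add: B_def bounded_measurable_cmult ip_self_cmult c2)
    then have "form (\<lambda>x. c * g x) (\<lambda>x. c * g x) \<le> s" by (rule form_le_s)
    then show ?thesis by (simp add: form_cmult g c2)
  qed
  have "0 < form g0 g0" using g0 form_nonneg[of g0] by linarith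
  moreover have "0 < ip g0 g0" using form_le_ip[OF g0(1)] calculation by linarith
  ultimately have s_pos: "0 < s" using normalize[OF g0(1)] by (meson divide_pos_pos less_le_trans)
  have form_le: "form g g \<le> s * ip g g" if g: "g \<in> bounded_measurable M" for g
  proof (cases "ip g g = 0")
    case True then show ?thesis using form_le_ip[OF g] by simp
  next
    case False
    then have "0 < ip g g" using ip_self_nonneg[of g] by simp
    then show ?thesis using normalize[OF g] by (simp add: field_simps)
  qed
  \<comment> \<open>Since \<open>ip (op g) (op g) = form (op g) g\<close>, Cauchy-Schwarz for the
    form bounds the L^2 norm of \<open>op g\<close> by the form at g. Smallness of the form on
    differences is therefore enough for an L^2 Cauchy sequence.\<close>
  have op_form: "ip (op g) (op g) \<le> s * form g g" if g: "g \<in> bounded_measurable M" for g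
  proof (cases "ip (op g) (op g) = 0")
    case True then show ?thesis using s_pos form_nonneg[OF g] by simp
  next
    case False
    then have pos: "0 < ip (op g) (op g)" using ip_self_nonneg[of "op g"] by simp
    have "(ip (op g) (op g))\<^sup>2 = (form (op g) g)\<^sup>2" by (simp add: form_eq_ip g op_bm)
    also have "\<dots> \<le> form (op g) (op g) * form g g" by (intro form_square_le g op_bm)
    also have "\<dots> \<le> (s * ip (op g) (op g)) * form g g"
      by (intro mult_right_mono form_le form_nonneg g op_bm)
    finally show ?thesis using pos by (simp add: power2_eq_square mult.commute)
  qed
  have "\<exists>g\<in>B. s - 1 / real (Suc n) < form g g" for n
    using less_cSupD[of "(\<lambda>g. form g g) ` B" "s - 1 / real (Suc n)"] B_ne by (auto simp: s_def)
  then obtain g where g: "\<And>n. g n \<in> B" "\<And>n. s - 1 / real (Suc n) < form (g n) (g n)" by metis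
  have g_bm: "g n \<in> bounded_measurable M" and g_ip: "ip (g n) (g n) \<le> 1" for n
    using g(1)[of n] by (auto simp: B_def)
  have form_g: "(\<lambda>n. form (g n) (g n)) \<longlonglongrightarrow> s"
  proof (rule tendsto_sandwich)
    have "(\<lambda>n. s - 1 / real (Suc n)) \<longlonglongrightarrow> s - 0" by (intro tendsto_intros LIMSEQ_Suc lim_const_over_n)
    then show "(\<lambda>n. s - 1 / real (Suc n)) \<longlonglongrightarrow> s" by simp
    show "\<forall>\<^sub>F n in sequentially. s - 1 / real (Suc n) \<le> form (g n) (g n)"
      using g(2) by (intro always_eventually allI less_imp_le)
    show "\<forall>\<^sub>F n in sequentially. form (g n) (g n) \<le> s"
      by (intro always_eventually allI form_le_s g(1))
  qed simp
  \<comment> \<open>By \<open>form_approx\<close> finitely many of these coefficients determine the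
    form on bounded sets up to a small error, so it suffices to make each of them converge along a
    subsequence.\<close>
  define co where "co n i = ip (fT i) (g n)" for n i
  have "co n \<in> {c. \<forall>i. \<bar>c i\<bar> \<le> 1}" for n
  proof (intro CollectI allI)
    fix i
    have "ip (fT i) (fT i) \<le> 1"
      unfolding ip_self
    proof (rule integral_le_bound)
      show "(\<lambda>x. (fT i x)\<^sup>2) \<in> borel_measurable M"
        by (intro bounded_measurable_borel bounded_measurable_power2 fT_bm)
      show "(fT i x)\<^sup>2 \<le> 1" if "x \<in> space M" for x
        using fT_le[OF that, of i] by (simp add: abs_square_le_1)
    qed simp
    then have "ip (fT i) (fT i) * ip (g n) (g n) \<le> 1"
      using g_ip[of n] ip_self_nonneg by (intro mult_le_one) auto
    then have "(co n i)\<^sup>2 \<le> 1"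
      using ip_square_le[OF fT_bm[of i] g_bm[of n]] by (simp add: co_def)
    then show "\<bar>co n i\<bar> \<le> 1" by (simp add: abs_square_le_1)
  qed
  then obtain l r where r: "strict_mono (r :: nat \<Rightarrow> nat)" and l: "(co \<circ> r) \<longlonglongrightarrow> l"
    using compact_imp_seq_compact[OF compact_cube] unfolding seq_compact_def by metis
  have co_lim: "(\<lambda>n. co (r n) i) \<longlonglongrightarrow> l i" for i
    using continuous_on_tendsto_compose[OF continuous_on_product_coordinates[of i] l] by (simp add: o_def)
  have Cauchy: "\<exists>N. \<forall>m\<ge>N. \<forall>n\<ge>N. (\<integral>x. (op (g (r m)) x - op (g (r n)) x)\<^sup>2 \<partial>M) < e" if e: "e > 0" for e
  proof -
    \<comment> \<open>A difference d of two unit ball elements has \<open>ip d d \<le> 4\<close>, so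
      \<open>4 * sqrt (\<epsilon> k)\<close> bounds the error of the form at d. It contributes less
      than e/2 and the first k coefficients at most e/4.\<close>
    have "(\<lambda>n. 4 * sqrt (\<epsilon> n)) \<longlonglongrightarrow> 4 * sqrt 0" by (intro tendsto_intros \<epsilon>_limit)
    from order_tendstoD(2)[OF this, of "e/2"] have "eventually (\<lambda>n. 4 * sqrt (\<epsilon> n) < e/2) sequentially"
      using e by simp
    then obtain k where k: "4 * sqrt (\<epsilon> k) < e/2" by (auto dest: eventually_happens)
    have "eventually (\<lambda>n. \<forall>i\<in>{..<k}. dist (co (r n) i) (l i) < sqrt e / 4) sequentially"
      using e co_lim by (intro eventually_ball_finite ballI tendstoD) auto
    then obtain N where N: "\<And>n i. n \<ge> N \<Longrightarrow> i < k \<Longrightarrow> dist (co (r n) i) (l i) < sqrt e / 4"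
      by (auto simp: eventually_sequentially)
    have "(\<integral>x. (op (g (r m)) x - op (g (r n)) x)\<^sup>2 \<partial>M) < e" if mn: "m \<ge> N" "n \<ge> N" for m n
    proof -
      define d where "d x = g (r m) x - g (r n) x" for x
      have d: "d \<in> bounded_measurable M" unfolding d_def by (intro bounded_measurable_diff g_bm)
      have d4: "ip d d \<le> 4"
        using ip_diff_self_le[OF g_bm[of "r m"] g_bm[of "r n"]] g_ip[of "r m"] g_ip[of "r n"]
        unfolding d_def by linarith
      have small: "(ip (fT i) d)\<^sup>2 \<le> e / 4" if "i < k" for i
      proof -
        have "ip (fT i) d = co (r m) i - co (r n) i"
          unfolding d_def co_def by (intro ip_diff_right g_bm fT_bm)
        then have "\<bar>ip (fT i) d\<bar> = dist (co (r m) i) (co (r n) i)" by (simp add: dist_real_def)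
        also have "\<dots> \<le> sqrt e / 2"
          using dist_triangle2[of "co (r m) i" "co (r n) i" "l i"] N[OF mn(1) that] N[OF mn(2) that] by linarith
        finally have "\<bar>ip (fT i) d\<bar> \<le> \<bar>sqrt e / 2\<bar>" by linarith
        then have "(ip (fT i) d)\<^sup>2 \<le> (sqrt e / 2)\<^sup>2" by (simp only: abs_le_square_iff)
        then show ?thesis using e by (simp add: power_divide)
      qed
      have "(\<Sum>i<k. ip (fT i) d * ip (fT i) d) \<le> (\<Sum>i<k. e / 4)"
        using small by (intro sum_mono) (auto simp: power2_eq_square)
      then have sum_le: "(\<Sum>i<k. ip (fT i) d * ip (fT i) d) / real k \<le> e / 4"
        using e by (cases "k = 0") (auto simp: field_simps)
      have "((\<Sum>i<k. ip (fT i) d * ip (fT i) d) / real k - form d d)\<^sup>2 \<le> \<epsilon> k * (ip d d)\<^sup>2"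
        using form_approx[OF d d, of k] by (simp add: power2_eq_square)
      also have "\<dots> \<le> \<epsilon> k * 4\<^sup>2"
        using d4 by (intro mult_left_mono power_mono \<epsilon>_nonneg ip_self_nonneg)
      also have "\<dots> = (4 * sqrt (\<epsilon> k))\<^sup>2" using \<epsilon>_nonneg[of k] by (simp add: power_mult_distrib)
      finally have "\<bar>(\<Sum>i<k. ip (fT i) d * ip (fT i) d) / real k - form d d\<bar> \<le> 4 * sqrt (\<epsilon> k)"
        using \<epsilon>_nonneg[of k] by (subst (asm) power2_le_iff_abs_le) auto
      then have form_d: "form d d < e" using sum_le k e by linarith
      have "(\<integral>x. (op (g (r m)) x - op (g (r n)) x)\<^sup>2 \<partial>M) = ip (op d) (op d)"
        unfolding ip_self d_def
        by (intro Bochner_Integration.integral_cong) (simp_all add: op_diff g_bm)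
      also have "\<dots> \<le> s * form d d" by (rule op_form[OF d])
      also have "\<dots> \<le> form d d" using s_le s_pos form_nonneg[OF d] by (intro mult_left_le_one_le) auto
      finally show ?thesis using form_d by simp
    qed
    then show ?thesis by blast
  qed
  have op_g_le: "\<bar>op (g n) x\<bar> \<le> 1" if "x \<in> space M" for n x
  proof -
    have "(\<integral>y. \<bar>g n y\<bar> \<partial>M)\<^sup>2 \<le> 1\<^sup>2"
      using abs_integral_le_ip[OF g_bm[of n]] g_ip[of n] by simp
    then have "(\<integral>y. \<bar>g n y\<bar> \<partial>M) \<le> 1" by (rule power2_le_imp_le) simp
    then show ?thesis using op_le[OF g_bm[of n] that] by linarith
  qed
  \<comment> \<open>The limit is taken of the images \<open>op (g (r n))\<close>; the maximising
    sequence itself is not shown to converge.\<close>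
  obtain u where u: "u \<in> borel_measurable M" "\<And>x. x \<in> space M \<Longrightarrow> \<bar>u x\<bar> \<le> 1"
    "(\<lambda>n. \<integral>x. (op (g (r n)) x - u x)\<^sup>2 \<partial>M) \<longlonglongrightarrow> 0"
    by (rule L2_limit_of_bounded_Cauchy[of "\<lambda>n. op (g (r n))" 1])
      (use op_g_le Cauchy in \<open>auto intro!: bounded_measurable_borel op_bm g_bm\<close>)
  have u_bm: "u \<in> bounded_measurable M" using u(1,2) by (rule bounded_measurableI)
  define D where "D n = ip (\<lambda>x. op (g (r n)) x - u x) (\<lambda>x. op (g (r n)) x - u x)" for n
  have D_lim: "D \<longlonglongrightarrow> 0" using u(3) by (simp add: D_def[abs_def] ip_self)
  have form_gr: "(\<lambda>n. form (g (r n)) (g (r n))) \<longlonglongrightarrow> s"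
    using LIMSEQ_subseq_LIMSEQ[OF form_g r] by (simp add: o_def)
  \<comment> \<open>With h = \<open>g (r n)\<close>, decompose op u - s u = op (u - op h) + op (op h
    - s h) + s (op h - u). The outer terms are controlled by \<open>D n\<close>, the middle one by
    how nearly h maximises the form.\<close>
  have main: "ip (\<lambda>x. op u x - s * u x) (\<lambda>x. op u x - s * u x)
     \<le> 2 * D n + 4 * (s * (s - form (g (r n)) (g (r n)))) + 4 * s\<^sup>2 * D n" for n
  proof -
    define h where "h = g (r n)"
    define w where "w x = op h x - s * h x" for x
    have h: "h \<in> bounded_measurable M" by (simp add: h_def g_bm)
    note bm = bounded_measurable_intros op_bm h u_bm
    have w: "w \<in> bounded_measurable M" unfolding w_def by (intro bm)
    have uo: "(\<lambda>x. u x - op h x) \<in> bounded_measurable M" by (intro bm)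
    have ou: "(\<lambda>x. s * (op h x - u x)) \<in> bounded_measurable M" by (intro bm)
    have D_eq: "D n = ip (\<lambda>x. u x - op h x) (\<lambda>x. u x - op h x)"
      by (simp add: D_def ip_self h_def power2_commute)
    \<comment> \<open>Expanding the square, the bound \<open>op_form\<close> on the first term turns
      -2 s form(h, h) into -s form(h, h), and \<open>ip h h \<le> 1\<close> bounds the last term by
      s^2.\<close>
    have w_le: "ip w w \<le> s * (s - form h h)"
    proof -
      have "ip w w = ip (op h) (op h) - 2 * s * form h h + s\<^sup>2 * ip h h"
        unfolding w_def ip_diff_cmult_self[OF op_bm[OF h] h] by (simp add: form_eq_ip[OF h h] ip_commute)
      moreover have "s\<^sup>2 * ip h h \<le> s\<^sup>2" using g_ip[of "r n"] by (simp add: h_def mult_left_le)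
      ultimately show ?thesis using op_form[OF h] by (simp add: power2_eq_square algebra_simps)
    qed
    have "ip (\<lambda>x. op u x - s * u x) (\<lambda>x. op u x - s * u x) =
      ip (\<lambda>x. op (\<lambda>x. u x - op h x) x + (op w x + s * (op h x - u x)))
         (\<lambda>x. op (\<lambda>x. u x - op h x) x + (op w x + s * (op h x - u x)))"
    proof (intro ip_cong)
      fix x assume x: "x \<in> space M"
      have "op w x = op (op h) x - s * op h x"
        using op_linear[OF op_bm[OF h] h x, of 1 "-s"] by (simp add: w_def[abs_def])
      then show "op u x - s * u x = op (\<lambda>x. u x - op h x) x + (op w x + s * (op h x - u x))"
        by (simp add: op_diff[OF u_bm op_bm[OF h] x] algebra_simps)
      then show "op u x - s * u x = op (\<lambda>x. u x - op h x) x + (op w x + s * (op h x - u x))" .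
    qed
    also have "\<dots> \<le> 2 * ip (op (\<lambda>x. u x - op h x)) (op (\<lambda>x. u x - op h x)) +
        2 * ip (\<lambda>x. op w x + s * (op h x - u x)) (\<lambda>x. op w x + s * (op h x - u x))"
      by (intro ip_add_self_le bounded_measurable_add op_bm uo w ou)
    also have "ip (op (\<lambda>x. u x - op h x)) (op (\<lambda>x. u x - op h x)) \<le> D n"
      unfolding D_eq by (rule op_contraction[OF uo])
    also have "ip (\<lambda>x. op w x + s * (op h x - u x)) (\<lambda>x. op w x + s * (op h x - u x)) \<le>
       2 * ip (op w) (op w) + 2 * ip (\<lambda>x. s * (op h x - u x)) (\<lambda>x. s * (op h x - u x))"
      by (intro ip_add_self_le op_bm w ou)
    also have "ip (\<lambda>x. s * (op h x - u x)) (\<lambda>x. s * (op h x - u x)) = s\<^sup>2 * D n"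
      by (simp add: ip_self_cmult D_def h_def)
    also have "ip (op w) (op w) \<le> s * (s - form h h)"
      using op_contraction[OF w] w_le by linarith
    finally show ?thesis by (simp add: h_def)
  qed
  have "(\<lambda>n. 2 * D n + 4 * (s * (s - form (g (r n)) (g (r n)))) + 4 * s\<^sup>2 * D n) \<longlonglongrightarrow> 2 * 0 + 4 * (s * (s - s)) + 4 * s\<^sup>2 * 0"
    by (intro tendsto_intros D_lim form_gr)
  then have "ip (\<lambda>x. op u x - s * u x) (\<lambda>x. op u x - s * u x) \<le> 0"
    by (intro LIMSEQ_le_const[of _ 0]) (use main in auto)
  then have "ip (\<lambda>x. op u x - s * u x) (\<lambda>x. op u x - s * u x) = 0"
    using ip_self_nonneg by (intro antisym)
  then have "AE x in M. op u x - s * u x = 0"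
    by (intro ip_self_zero_AE bounded_measurable_intros op_bm u_bm)
  moreover have "ip u u \<noteq> 0"
  proof
    assume u0: "ip u u = 0"
    \<comment> \<open>If u were null, the images of the maximising sequence would tend to 0 in L^2
      and the form along it with them, against its limit s > 0.\<close>
    have "(form (g (r n)) (g (r n)))\<^sup>2 \<le> 2 * D n" for n
    proof -
      define h where "h = g (r n)"
      have h: "h \<in> bounded_measurable M" by (simp add: h_def g_bm)
      have "(form h h)\<^sup>2 \<le> ip h h * ip (op h) (op h)"
        unfolding form_eq_ip[OF h h] by (intro ip_square_le h op_bm)
      also have "\<dots> \<le> ip (op h) (op h)"
        using g_ip[of "r n"] by (intro mult_left_le_one_le) (auto simp: h_def ip_self_nonneg)
      also have "ip (op h) (op h) \<le> 2 * D n + 2 * ip u u"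
        using ip_add_self_le[OF bounded_measurable_diff[OF op_bm[OF h] u_bm] u_bm] by (simp add: D_def h_def)
      finally show ?thesis using u0 by (simp add: h_def)
    qed
    then have "s\<^sup>2 \<le> 2 * 0"
      by (intro LIMSEQ_le[OF tendsto_power[OF form_gr] tendsto_mult_left[OF D_lim]]) auto
    then show False using s_pos by simp
  qed
  ultimately show ?thesis using u_bm s_pos by (intro that[of u s]) auto
qed

text \<open>Invariance of the measure replaces y by T y under the integral; invariance of the kernel
  then removes T from both arguments of \<open>K\<close>. Consequently composition with T maps
  eigenvectors to eigenvectors.\<close>

lemma op_comp_T:
  assumes g: "g \<in> bounded_measurable M"
  shows "AE x in M. op (\<lambda>y. g (T y)) x = op g (T x)"
proof -
  note [measurable] = bounded_measurable_borel[OF g]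
  have "AE x in M. AE y in M. K (T x, T y) = K (x, y)"
    using prod.AE_pair[OF K_invariant] by simp
  then show ?thesis using AE_space
  proof eventually_elim
    fix x assume ae: "AE y in M. K (T x, T y) = K (x, y)" and x[measurable]: "x \<in> space M"
    have Tx[measurable]: "T x \<in> space M" using x by (rule measurable_space[OF T_measurable])
    have "op g (T x) = (\<integral>y. K (T x, T y) * g (T y) \<partial>M)"
      unfolding op_def by (subst integral_T[of "\<lambda>y. K (T x, y) * g y"]) auto
    also have "\<dots> = op (\<lambda>y. g (T y)) x"
      unfolding op_def using ae by (intro integral_cong_AE) auto
    finally show "op (\<lambda>y. g (T y)) x = op g (T x)" ..
  qed
qed

lemma eigenvector_T_power:
  assumes u: "u \<in> bounded_measurable M" "AE x in M. op u x = s * u x"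
  shows "AE x in M. op (\<lambda>y. u ((T ^^ i) y)) x = s * u ((T ^^ i) x)"
proof (induction i)
  case (Suc i)
  show ?case
    using AE_T[OF Suc] op_comp_T[OF bounded_measurable_T_power[OF u(1), of i]]
    by eventually_elim (simp add: funpow_swap1)
qed (use u in simp)

text \<open>Choose N with \<open>\<epsilon> N < s^2\<close>. Among N + 1 iterates some nontrivial
  combination g is orthogonal to the first N translates of f. Being again an eigenvector for s, it
  satisfies s^2 |g|^2 = |op g|^2 \<le> \<open>\<epsilon> N\<close> |g|^2, which forces g to be
  null.\<close>

lemma eigenvector_orbit_dependent:
  assumes u: "u \<in> bounded_measurable M" "AE x in M. op u x = s * u x" and s: "0 < s"
  obtains N c where "\<exists>i\<le>N. c i \<noteq> (0::real)" "AE x in M. (\<Sum>i\<le>N. c i * u ((T ^^ i) x)) = 0"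
proof -
  define uT where "uT i x = u ((T ^^ i) x)" for i x
  have uT: "uT i \<in> bounded_measurable M" for i unfolding uT_def by (rule bounded_measurable_T_power[OF u(1)])
  have "eventually (\<lambda>n. \<epsilon> n < s\<^sup>2) sequentially"
    using s by (intro order_tendstoD[OF \<epsilon>_limit]) auto
  then obtain N where N: "\<epsilon> N < s\<^sup>2" by (auto dest: eventually_happens)
  obtain c where c: "\<exists>i\<in>{..N}. c i \<noteq> 0" "\<forall>j\<in>{..<N}. (\<Sum>i\<in>{..N}. c i * ip (fT j) (uT i)) = 0"
    using homogeneous_system_nontrivial[of "{..<N}" "{..N}" "\<lambda>i j. ip (fT j) (uT i)"] by auto
  define g where "g x = (\<Sum>i\<le>N. c i * uT i x)" for x
  have g: "g \<in> bounded_measurable M" unfolding g_def by (intro bounded_measurable_intros uT)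
  have "AE x in M. \<forall>i. op (uT i) x = s * uT i x"
    unfolding uT_def AE_all_countable by (intro allI eigenvector_T_power u)
  then have "AE x in M. op g x = s * g x"
    using AE_space
  proof eventually_elim
    fix x assume "\<forall>i. op (uT i) x = s * uT i x" "x \<in> space M"
    then show "op g x = s * g x"
      unfolding g_def by (subst op_sum) (auto simp: uT sum_distrib_left mult.left_commute)
  qed
  then have "ip (op g) (op g) = ip (\<lambda>x. s * g x) (\<lambda>x. s * g x)"
    unfolding ip_def using bounded_measurable_borel[OF g] bounded_measurable_borel[OF op_bm[OF g]]
    by (intro integral_cong_AE) auto
  then have "s\<^sup>2 * ip g g \<le> \<epsilon> N * ip g g"
    using ip_op_le_if_orthogonal[OF g, of N] c(2)
    by (simp add: ip_self_cmult g_def[abs_def] ip_sum_right uT fT_bm)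
  then have "ip g g = 0"
    using N ip_self_nonneg[of g] by (smt (verit) mult_right_less_imp_less mult_strict_right_mono)
  then have "AE x in M. g x = 0" by (rule ip_self_zero_AE[OF g])
  then show ?thesis using c(1) that[of N c] by (auto simp: g_def uT_def)
qed

text \<open>Every translate of f has mean 0 and so is orthogonal to the constant 1. Hence the form
  of 1 and u is 0, while it also equals the integral of op u, that is, s times the integral of
  u.\<close>

lemma integral_eigenvector:
  assumes u: "u \<in> bounded_measurable M" "AE x in M. op u x = s * u x" and s: "s \<noteq> 0"
    and f0: "(\<integral>x. f x \<partial>M) = 0"
  shows "(\<integral>x. u x \<partial>M) = 0"
proof -
  have "ip (fT i) (\<lambda>_. 1) = 0" for i
    using integral_T_power[OF f_measurable] by (simp add: ip_def fT_def f0)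
  then have "form (\<lambda>_. 1) u = 0"
    using form_limit[of "\<lambda>_. 1" u] u by (simp add: LIMSEQ_const_iff)
  moreover have "form (\<lambda>_. 1) u = (\<integral>x. op u x \<partial>M)"
    using form_eq_ip[of "\<lambda>_. 1" u] u by (simp add: ip_def)
  moreover have "(\<integral>x. op u x \<partial>M) = (\<integral>x. s * u x \<partial>M)"
    using u bounded_measurable_borel[OF u(1)] bounded_measurable_borel[OF op_bm[OF u(1)]]
    by (intro integral_cong_AE) auto
  ultimately show ?thesis using s by simp
qed

end

section \<open>Polynomials in the composition operator\<close>

context measure_preserving_map
begin

text \<open>The polynomial p in the operator u -> u o T, applied to u. A divisor of p thus
  corresponds to a factor of the operator.\<close>

definition poly_orbit :: "complex poly \<Rightarrow> ('a \<Rightarrow> complex) \<Rightarrow> 'a \<Rightarrow> complex" where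
  "poly_orbit p u x = (\<Sum>i\<le>degree p. coeff p i * u ((T ^^ i) x))"

lemma poly_orbit_altdef:
  "degree p \<le> n \<Longrightarrow> poly_orbit p u x = (\<Sum>i\<le>n. coeff p i * u ((T ^^ i) x))"
  unfolding poly_orbit_def by (intro sum.mono_neutral_left) (auto simp: coeff_eq_0)

lemma poly_orbit_linear_factor:
  "poly_orbit ([:- \<mu>, 1:] * q) u x = poly_orbit q u (T x) - \<mu> * poly_orbit q u x"
proof -
  have deg: "degree ([:- \<mu>, 1:] * q) \<le> Suc (degree q)"
    by (rule order_trans[OF degree_mult_le]) auto
  have "poly_orbit ([:- \<mu>, 1:] * q) u x = (\<Sum>i\<le>Suc (degree q). coeff (pCons 0 q) i * u ((T ^^ i) x))
     - (\<Sum>i\<le>Suc (degree q). \<mu> * (coeff q i * u ((T ^^ i) x)))"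
    unfolding poly_orbit_altdef[OF deg] sum_subtractf[symmetric]
    by (intro sum.cong) (auto simp: algebra_simps)
  also have "(\<Sum>i\<le>Suc (degree q). coeff (pCons 0 q) i * u ((T ^^ i) x)) = poly_orbit q u (T x)"
    unfolding poly_orbit_def sum.atMost_Suc_shift by (simp add: funpow_swap1)
  also have "(\<Sum>i\<le>Suc (degree q). \<mu> * (coeff q i * u ((T ^^ i) x))) = \<mu> * poly_orbit q u x"
    by (simp add: poly_orbit_altdef[of q "Suc (degree q)"] flip: sum_distrib_left)
  finally show ?thesis .
qed

text \<open>Linear factors are split off an annihilating polynomial until the quotient q no longer
  annihilates u. At that moment the function given by q is not null but is killed by the last
  factor, so it is an eigenfunction for the root of that factor.\<close>

lemma eigenfunction_from_annihilator:
  assumes "p \<noteq> 0" "AE x in M. poly_orbit p u x = 0" and u: "\<not> (AE x in M. u x = 0)"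
  shows "\<exists>q \<mu>. \<not> (AE x in M. poly_orbit q u x = 0) \<and> (AE x in M. poly_orbit q u (T x) = \<mu> * poly_orbit q u x)"
  using assms(1,2)
proof (induction "degree p" arbitrary: p rule: less_induct)
  case less
  show ?case
  proof (cases "degree p = 0")
    case True
    \<comment> \<open>A nonzero constant cannot annihilate u, so the process stops before this
      degree.\<close>
    then obtain c where "p = [:c:]" "c \<noteq> 0" using less.prems by (metis degree_eq_zeroE pCons_0_0)
    then show ?thesis using less.prems u by (simp add: poly_orbit_def)
  next
    case False
    then obtain \<mu> where "poly p \<mu> = 0"
      using fundamental_theorem_of_algebra[of p] by (auto simp: constant_degree)
    then obtain q where q: "p = [:- \<mu>, 1:] * q" by (auto simp: poly_eq_0_iff_dvd)
    then have q0: "q \<noteq> 0" using less.prems by auto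
    have deg: "degree q < degree p" unfolding q by (subst degree_mult_eq) (use q0 in auto)
    show ?thesis
    proof (cases "AE x in M. poly_orbit q u x = 0")
      case True
      then show ?thesis using less.hyps[OF deg q0] by blast
    next
      case False
      moreover have "AE x in M. poly_orbit q u (T x) = \<mu> * poly_orbit q u x"
        using less.prems(2) unfolding q poly_orbit_linear_factor by simp
      ultimately show ?thesis by blast
    qed
  qed
qed

text \<open>The property of \<open>weakly_mixing_cap\<close> for a probability: the same functions
  and arbitrary complex eigenvalues, with its own null sets in place of those of V.\<close>

definition eigenfunctions_constant :: bool where
  "eigenfunctions_constant \<longleftrightarrow> (\<forall>f :: 'a \<Rightarrow> complex. \<forall>c. f \<in> borel_measurable M \<longrightarrow>
     (AE x in M. f (T x) = c * f x) \<longrightarrow> (\<exists>k. AE x in M. f x = k))"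

text \<open>The averages converge to the form at \<phi>. A nonzero value would yield an
  eigenfunction of T that is not null but has mean 0, and such a function cannot be
  constant.\<close>

theorem weak_mixing_averages:
  assumes eig: eigenfunctions_constant
    and f: "f \<in> borel_measurable M" "\<And>x. x \<in> space M \<Longrightarrow> \<bar>f x\<bar> \<le> 1" "(\<integral>x. f x \<partial>M) = 0"
    and \<phi>: "\<phi> \<in> bounded_measurable M"
  shows "(\<lambda>n. (\<Sum>i<n. (\<integral>x. \<phi> x * f ((T ^^ i) x) \<partial>M)\<^sup>2) / real n) \<longlonglongrightarrow> 0"
proof -
  obtain K where "averaged_kernel M T f K" using averaged_kernel_exists[OF f(1,2)] by auto
  then interpret K: averaged_kernel M T f K .
  have "K.form \<phi> \<phi> = 0"
  proof (rule ccontr)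
    assume "K.form \<phi> \<phi> \<noteq> 0"
    then obtain u s where u: "u \<in> bounded_measurable M" "0 < s" "AE x in M. K.op u x = s * u x" "ip u u \<noteq> 0"
      using K.eigenvector_exists[OF \<phi>] by metis
    have u_mean: "(\<integral>x. u x \<partial>M) = 0"
      using u f by (intro K.integral_eigenvector[of u s]) auto
    obtain N c where c: "\<exists>i\<le>N. c i \<noteq> 0" "AE x in M. (\<Sum>i\<le>N. c i * u ((T ^^ i) x)) = 0"
      using K.eigenvector_orbit_dependent[OF u(1,3,2)] by metis
    \<comment> \<open>The kernel operator is real, but the eigenvalues of T on its eigenspaces need
      not be; complex scalars are needed to split the annihilating polynomial.\<close>
    define v where "v x = complex_of_real (u x)" for x
    define p where "p = (\<Sum>i\<le>N. monom (complex_of_real (c i)) i)"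
    have coeff_p: "coeff p i = (if i \<le> N then complex_of_real (c i) else 0)" for i
      by (simp add: p_def coeff_sum)
    have p0: "p \<noteq> 0" using c(1) coeff_p by (metis coeff_0 of_real_eq_0_iff)
    have deg_p: "degree p \<le> N" by (rule degree_le) (simp add: coeff_p)
    have "poly_orbit p v x = complex_of_real (\<Sum>i\<le>N. c i * u ((T ^^ i) x))" for x
      by (simp add: poly_orbit_altdef[OF deg_p] coeff_p v_def)
    with c(2) have "AE x in M. poly_orbit p v x = 0" by (auto simp only: of_real_0)
    moreover have "\<not> (AE x in M. v x = 0)"
    proof
      assume "AE x in M. v x = 0"
      then have "AE x in M. u x = 0" by (simp add: v_def)
      then have "AE x in M. u x * u x = 0" by eventually_elim simp
      then have "ip u u = 0" unfolding ip_def by (rule integral_eq_zero_AE)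
      then show False using u by simp
    qed
    ultimately obtain q \<mu> where q: "\<not> (AE x in M. poly_orbit q v x = 0)"
      "AE x in M. poly_orbit q v (T x) = \<mu> * poly_orbit q v x"
      using eigenfunction_from_annihilator[OF p0] by blast
    have v[measurable]: "v \<in> borel_measurable M"
      unfolding v_def using bounded_measurable_borel[OF u(1)] by measurable
    have "(\<lambda>x. poly_orbit q v x) \<in> borel_measurable M"
      unfolding poly_orbit_def by measurable
    then obtain k where k: "AE x in M. poly_orbit q v x = k"
      using eig q(2) unfolding eigenfunctions_constant_def by blast
    have v_int: "integrable M (\<lambda>x. v ((T ^^ i) x))" for i
      unfolding v_def by (intro integrable_of_real bounded_measurable_integrable bounded_measurable_T_power u)
    have v_mean: "(\<integral>x. v ((T ^^ i) x) \<partial>M) = 0" for i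
      using integral_T_power[OF v] u_mean by (simp add: v_def)
    have "(\<integral>x. poly_orbit q v x \<partial>M) = 0"
      unfolding poly_orbit_def by (subst Bochner_Integration.integral_sum) (simp_all add: v_int v_mean)
    moreover have "(\<integral>x. poly_orbit q v x \<partial>M) = (\<integral>x. k \<partial>M)"
      using k by (intro integral_cong_AE) (auto simp: poly_orbit_def)
    ultimately have "k = 0" by (simp add: prob_space)
    then show False using k q(1) by simp
  qed
  then show ?thesis
    using K.form_limit[OF \<phi> \<phi>] by (simp add: ip_def K.fT_def power2_eq_square mult.commute)
qed

end

section \<open>Mixing on average\<close>

text \<open>With absolute values in place of squares, estimates by the triangle inequality stay
  linear. For sequences bounded by 1 the two versions are interchangeable, by Cauchy-Schwarz in one
  direction and a^2 \<le> |a| in the other.\<close>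

definition cesaro_null :: "(nat \<Rightarrow> real) \<Rightarrow> bool" where
  "cesaro_null a \<longleftrightarrow> (\<lambda>n. (\<Sum>i<n. \<bar>a i\<bar>) / real n) \<longlonglongrightarrow> 0"

lemma cesaro_nullI_squares:
  assumes "(\<lambda>n. (1 / real n) * (\<Sum>i<n. \<bar>a i\<bar>\<^sup>2)) \<longlonglongrightarrow> 0"
  shows "cesaro_null a"
proof -
  have "((\<Sum>i<n. \<bar>a i\<bar>) / real n)\<^sup>2 \<le> (1 / real n) * (\<Sum>i<n. \<bar>a i\<bar>\<^sup>2)" for n
    using sum_squared_le_sum_of_squares[of "\<lambda>i. \<bar>a i\<bar>" "{..<n}"]
    by (cases "n = 0") (auto simp: field_simps power2_eq_square)
  then have "(\<lambda>n. ((\<Sum>i<n. \<bar>a i\<bar>) / real n)\<^sup>2) \<longlonglongrightarrow> 0"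
    by (intro tendsto_sandwich[OF _ _ tendsto_const assms]) auto
  then have "(\<lambda>n. sqrt (((\<Sum>i<n. \<bar>a i\<bar>) / real n)\<^sup>2)) \<longlonglongrightarrow> sqrt 0"
    by (rule tendsto_real_sqrt)
  then show ?thesis by (simp add: cesaro_null_def sum_nonneg)
qed

lemma cesaro_null_squares:
  assumes "cesaro_null a" "\<And>i. \<bar>a i\<bar> \<le> 1"
  shows "(\<lambda>n. (1 / real n) * (\<Sum>i<n. \<bar>a i\<bar>\<^sup>2)) \<longlonglongrightarrow> 0"
proof (rule tendsto_sandwich[OF _ _ tendsto_const])
  show "(\<lambda>n. (\<Sum>i<n. \<bar>a i\<bar>) / real n) \<longlonglongrightarrow> 0"
    using assms(1) by (simp add: cesaro_null_def)
  have sq: "\<bar>a i\<bar>\<^sup>2 \<le> \<bar>a i\<bar>" for i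
    using assms(2)[of i] by (simp add: power2_eq_square mult_left_le del: abs_mult_self_eq power2_abs)
  have "(\<Sum>i<n. \<bar>a i\<bar>\<^sup>2) / real n \<le> (\<Sum>i<n. \<bar>a i\<bar>) / real n" for n
    by (intro divide_right_mono sum_mono sq) simp
  then show "\<forall>\<^sub>F n in sequentially. (1 / real n) * (\<Sum>i<n. \<bar>a i\<bar>\<^sup>2) \<le> (\<Sum>i<n. \<bar>a i\<bar>) / real n"
    by simp
qed (auto intro!: always_eventually divide_nonneg_nonneg sum_nonneg)

lemma cesaro_null_dominated:
  assumes "cesaro_null a" "cesaro_null b" and le: "\<And>i. \<bar>c i\<bar> \<le> \<bar>a i\<bar> + \<bar>b i\<bar>"
  shows "cesaro_null c"
proof -
  have "(\<lambda>n. (\<Sum>i<n. \<bar>a i\<bar>) / real n + (\<Sum>i<n. \<bar>b i\<bar>) / real n) \<longlonglongrightarrow> 0 + 0"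
    using assms by (intro tendsto_add) (auto simp: cesaro_null_def)
  then have lim: "(\<lambda>n. (\<Sum>i<n. \<bar>a i\<bar> + \<bar>b i\<bar>) / real n) \<longlonglongrightarrow> 0"
    by (simp add: sum.distrib add_divide_distrib)
  have "(\<Sum>i<n. \<bar>c i\<bar>) / real n \<le> (\<Sum>i<n. \<bar>a i\<bar> + \<bar>b i\<bar>) / real n" for n
    by (intro divide_right_mono sum_mono le) simp
  then show ?thesis
    unfolding cesaro_null_def
    by (intro tendsto_sandwich[OF _ _ tendsto_const lim] always_eventually allI divide_nonneg_nonneg sum_nonneg) auto
qed

lemma cesaro_null_zero: "cesaro_null (\<lambda>_. 0)"
  by (simp add: cesaro_null_def)

lemma cesaro_null_mono: "cesaro_null a \<Longrightarrow> (\<And>i. \<bar>c i\<bar> \<le> \<bar>a i\<bar>) \<Longrightarrow> cesaro_null c"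
  using cesaro_null_dominated[OF _ cesaro_null_zero] by simp

lemma cesaro_null_cmult:
  assumes "cesaro_null a" shows "cesaro_null (\<lambda>i. k * a i)"
proof -
  have "(\<lambda>n. \<bar>k\<bar> * ((\<Sum>i<n. \<bar>a i\<bar>) / real n)) \<longlonglongrightarrow> \<bar>k\<bar> * 0"
    using assms unfolding cesaro_null_def by (rule tendsto_mult_left)
  then show ?thesis by (simp add: cesaro_null_def abs_mult flip: sum_distrib_left)
qed

lemma cesaro_null_const: assumes "cesaro_null (\<lambda>_. c)" shows "c = 0"
proof -
  have "(\<lambda>n. \<bar>c\<bar>) \<longlonglongrightarrow> 0"
  proof (rule Lim_transform_eventually)
    show "(\<lambda>n. (\<Sum>i<n. \<bar>c\<bar>) / real n) \<longlonglongrightarrow> 0" using assms by (simp only: cesaro_null_def)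
    show "\<forall>\<^sub>F n in sequentially. (\<Sum>i<n. \<bar>c\<bar>) / real n = \<bar>c\<bar>"
      using eventually_gt_at_top[of 0] by eventually_elim simp
  qed
  then show ?thesis by (simp add: LIMSEQ_const_iff)
qed

lemma cesaro_null_approx:
  assumes "\<And>e. e > 0 \<Longrightarrow> \<exists>b. cesaro_null b \<and> (\<forall>i. \<bar>a i\<bar> \<le> \<bar>b i\<bar> + e)"
  shows "cesaro_null a"
  unfolding cesaro_null_def
proof (rule LIMSEQ_I)
  fix e :: real assume e: "e > 0"
  obtain b where b: "cesaro_null b" "\<And>i. \<bar>a i\<bar> \<le> \<bar>b i\<bar> + e/2" using assms[of "e/2"] e by auto
  obtain N where N: "\<And>n. n \<ge> N \<Longrightarrow> norm ((\<Sum>i<n. \<bar>b i\<bar>) / real n - 0) < e/2"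
    using LIMSEQ_D[OF b(1)[unfolded cesaro_null_def], of "e/2"] e by auto
  have "norm ((\<Sum>i<n. \<bar>a i\<bar>) / real n - 0) < e" if "n \<ge> N" for n
  proof -
    have "(\<Sum>i<n. \<bar>a i\<bar>) / real n \<le> (\<Sum>i<n. \<bar>b i\<bar> + e/2) / real n"
      by (intro divide_right_mono sum_mono b) simp
    also have "\<dots> \<le> (\<Sum>i<n. \<bar>b i\<bar>) / real n + e/2"
      using e by (cases "n = 0") (auto simp: sum.distrib add_divide_distrib)
    also have "(\<Sum>i<n. \<bar>b i\<bar>) / real n < e/2"
      using N[OF that] by (metis abs_less_iff diff_zero real_norm_def)
    finally show ?thesis by (simp add: sum_nonneg)
  qed
  then show "\<exists>N. \<forall>n\<ge>N. norm ((\<Sum>i<n. \<bar>a i\<bar>) / real n - 0) < e" by blast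
qed

text \<open>Dynkin's argument for a sequence of additive set functions of total mass zero that are
  uniformly dominated by a probability.\<close>

lemma (in prob_space) cesaro_null_Dynkin:
  fixes \<nu> :: "nat \<Rightarrow> 'a set \<Rightarrow> real"
  assumes G: "Int_stable G" "G \<subseteq> Pow (space M)" "sets M = sigma_sets (space M) G"
    and null: "\<And>D. D \<in> G \<Longrightarrow> cesaro_null (\<lambda>i. \<nu> i D)"
    and add: "\<And>i A B. A \<in> sets M \<Longrightarrow> B \<in> sets M \<Longrightarrow> A \<inter> B = {} \<Longrightarrow> \<nu> i (A \<union> B) = \<nu> i A + \<nu> i B"
    and total: "\<And>i. \<nu> i (space M) = 0"
    and dom: "\<And>i A. A \<in> sets M \<Longrightarrow> \<bar>\<nu> i A\<bar> \<le> prob A"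
    and D: "D \<in> sets M"
  shows "cesaro_null (\<lambda>i. \<nu> i D)"
proof -
  have empty: "\<nu> i {} = 0" for i using dom[of "{}" i] by simp
  have "D \<in> sigma_sets (space M) G" using D G by simp
  with G(1,2) show ?thesis
  proof (induction rule: sigma_sets_induct_disjoint)
    case (basic A) then show ?case by (rule null)
  next
    case empty then show ?case by (simp add: \<open>\<And>i. \<nu> i {} = 0\<close> cesaro_null_zero)
  next
    case (compl A)
    then have A: "A \<in> sets M" using G by simp
    then have "A \<union> (space M - A) = space M" using sets.sets_into_space by blast
    then have "\<nu> i (space M - A) = - \<nu> i A" for i
      using add[OF A sets.compl_sets[OF A], of i] total[of i] by auto
    then show ?case using compl(2) by (simp add: cesaro_null_def)
  next
    case (union A)
    then have A: "A j \<in> sets M" for j using G by auto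
    have fin: "cesaro_null (\<lambda>i. \<nu> i (\<Union>j<k. A j))" for k
    proof (induction k)
      case 0 then show ?case by (simp add: \<open>\<And>i. \<nu> i {} = 0\<close> cesaro_null_zero)
    next
      case (Suc k)
      have "(\<Union>j<k. A j) \<inter> A k = {}"
        using union(1) by (auto simp: disjoint_family_on_def) (metis disjoint_iff less_irrefl)
      then have "\<nu> i (\<Union>j<Suc k. A j) = \<nu> i (\<Union>j<k. A j) + \<nu> i (A k)" for i
        using A add[of "\<Union>j<k. A j" "A k" i] by (auto simp: lessThan_Suc Un_commute)
      then show ?case
        by (intro cesaro_null_dominated[OF Suc union(3)[of k]]) auto
    qed
    show ?case
    proof (rule cesaro_null_approx)
      fix e :: real assume "e > 0"
      have "(\<lambda>k. prob (\<Union>j<k. A j)) \<longlonglongrightarrow> prob (\<Union>k. \<Union>j<k. A j)"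
        using A by (intro finite_Lim_measure_incseq monoI UN_mono) auto
      moreover have "(\<Union>k. \<Union>j<k. A j) = (\<Union>j. A j)" by blast
      ultimately have "eventually (\<lambda>k. prob (\<Union>j. A j) - e < prob (\<Union>j<k. A j)) sequentially"
        using \<open>e > 0\<close> order_tendstoD(1)[of _ "prob (\<Union>j. A j)" sequentially "prob (\<Union>j. A j) - e"] by simp
      then obtain k where k: "prob (\<Union>j. A j) - e < prob (\<Union>j<k. A j)" by (auto dest: eventually_happens)
      \<comment> \<open>The tail of the disjoint union. Its probability is below e, so by
        \<open>dom\<close> its mass is below e for all i at once.\<close>
      define R where "R = (\<Union>j. A j) - (\<Union>j<k. A j)"
      have R: "R \<in> sets M" using A by (auto simp: R_def)
      have "prob R = prob (\<Union>j. A j) - prob (\<Union>j<k. A j)"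
        unfolding R_def using A by (intro finite_measure_Diff) auto
      moreover have "(\<Union>j<k. A j) \<union> R = (\<Union>j. A j)" by (auto simp: R_def)
      then have "\<nu> i (\<Union>j. A j) = \<nu> i (\<Union>j<k. A j) + \<nu> i R" for i
        using add[of "\<Union>j<k. A j" R i] A R by (auto simp: R_def)
      ultimately have "\<bar>\<nu> i (\<Union>j. A j)\<bar> \<le> \<bar>\<nu> i (\<Union>j<k. A j)\<bar> + e" for i
        using dom[OF R, of i] k by (simp add: abs_le_iff) linarith
      then show "\<exists>b. cesaro_null b \<and> (\<forall>i. \<bar>\<nu> i (\<Union>j. A j)\<bar> \<le> \<bar>b i\<bar> + e)" using fin by blast
    qed
  qed
qed

section \<open>Correlations of sets, product systems and ergodicity\<close>

context measure_preserving_map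
begin

definition corr :: "'a set \<Rightarrow> 'a set \<Rightarrow> nat \<Rightarrow> real" where
  "corr B C i = prob (B \<inter> ((T ^^ i) -` C \<inter> space M)) - prob B * prob C"

definition mixing_on_average :: bool where
  "mixing_on_average \<longleftrightarrow> (\<forall>B\<in>sets M. \<forall>C\<in>sets M. cesaro_null (corr B C))"

lemma vimage_T_power_sets: "A \<in> sets M \<Longrightarrow> (T ^^ i) -` A \<inter> space M \<in> sets M"
  by (rule measurable_sets[OF T_power_measurable])

text \<open>Both terms of the difference lie between 0 and the probability of B, and by invariance
  also between 0 and that of C. Each bound is the domination required by the Dynkin argument in one
  of the two variables.\<close>

lemma corr_le:
  assumes "B \<in> sets M" "C \<in> sets M"
  shows "\<bar>corr B C i\<bar> \<le> prob B" "\<bar>corr B C i\<bar> \<le> prob C"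
proof -
  have *: "prob (B \<inter> ((T ^^ i) -` C \<inter> space M)) \<le> prob B"
    "prob (B \<inter> ((T ^^ i) -` C \<inter> space M)) \<le> prob ((T ^^ i) -` C \<inter> space M)"
    using assms by (auto intro!: finite_measure_mono vimage_T_power_sets)
  have "prob B * prob C \<le> prob B" "prob B * prob C \<le> prob C"
    by (auto intro!: mult_left_le mult_left_le_one_le)
  moreover have "0 \<le> prob B * prob C" by simp
  moreover have "0 \<le> prob (B \<inter> ((T ^^ i) -` C \<inter> space M))" by simp
  ultimately show "\<bar>corr B C i\<bar> \<le> prob B" "\<bar>corr B C i\<bar> \<le> prob C"
    using * unfolding corr_def prob_vimage_T_power[OF assms(2)] abs_le_iff by linarith+
qed

text \<open>The Dynkin argument is run twice, in C with B fixed in the generator, then in B with C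
  an arbitrary measurable set.\<close>

lemma mixing_on_average_generator:
  assumes G: "Int_stable G" "G \<subseteq> Pow (space M)" "sets M = sigma_sets (space M) G"
    and null: "\<And>B C. B \<in> G \<Longrightarrow> C \<in> G \<Longrightarrow> cesaro_null (corr B C)"
  shows mixing_on_average
proof -
  have G_sets: "B \<in> sets M" if "B \<in> G" for B using that G by auto
  have 1: "cesaro_null (corr B C)" if B: "B \<in> G" and C: "C \<in> sets M" for B C
  proof (rule cesaro_null_Dynkin[OF G, where \<nu>="\<lambda>i C. corr B C i"])
    show "corr B (A \<union> A') i = corr B A i + corr B A' i" if A: "A \<in> sets M" "A' \<in> sets M" "A \<inter> A' = {}" for i A A'
    proof -
      have "B \<inter> ((T ^^ i) -` (A \<union> A') \<inter> space M) =
        (B \<inter> ((T ^^ i) -` A \<inter> space M)) \<union> (B \<inter> ((T ^^ i) -` A' \<inter> space M))" by auto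
      then have "prob (B \<inter> ((T ^^ i) -` (A \<union> A') \<inter> space M)) =
        prob (B \<inter> ((T ^^ i) -` A \<inter> space M)) + prob (B \<inter> ((T ^^ i) -` A' \<inter> space M))"
        using A G_sets[OF B] by (auto intro!: finite_measure_Union vimage_T_power_sets sets.Int)
      then show ?thesis using A by (simp add: corr_def finite_measure_Union algebra_simps)
    qed
    have "B \<inter> ((T ^^ i) -` space M \<inter> space M) = B" for i
      using sets.sets_into_space[OF G_sets[OF B]] T_power_space by auto
    then show "corr B (space M) i = 0" for i by (simp add: corr_def prob_space)
  qed (use B C null corr_le G_sets in auto)
  have "cesaro_null (corr B C)" if B: "B \<in> sets M" and C: "C \<in> sets M" for B C
  proof (rule cesaro_null_Dynkin[OF G, where \<nu>="\<lambda>i B. corr B C i"])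
    show "corr (A \<union> A') C i = corr A C i + corr A' C i" if A: "A \<in> sets M" "A' \<in> sets M" "A \<inter> A' = {}" for i A A'
    proof -
      have "(A \<union> A') \<inter> ((T ^^ i) -` C \<inter> space M) =
        (A \<inter> ((T ^^ i) -` C \<inter> space M)) \<union> (A' \<inter> ((T ^^ i) -` C \<inter> space M))" by auto
      then have "prob ((A \<union> A') \<inter> ((T ^^ i) -` C \<inter> space M)) =
        prob (A \<inter> ((T ^^ i) -` C \<inter> space M)) + prob (A' \<inter> ((T ^^ i) -` C \<inter> space M))"
        using A C by (auto intro!: finite_measure_Union vimage_T_power_sets sets.Int)
      then show ?thesis using A by (simp add: corr_def finite_measure_Union algebra_simps)
    qed
    have "space M \<inter> ((T ^^ i) -` C \<inter> space M) = (T ^^ i) -` C \<inter> space M" for i by auto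
    then show "corr (space M) C i = 0" for i by (simp add: corr_def prob_space prob_vimage_T_power[OF C])
  qed (use B C 1 corr_le in auto)
  then show ?thesis by (simp add: mixing_on_average_def)
qed

text \<open>Measurable rectangles form an intersection stable generator, and on them joint
  probabilities factor.\<close>

lemma mixing_on_average_prod:
  assumes mix: mixing_on_average
  shows "measure_preserving_map.mixing_on_average (M \<Otimes>\<^sub>M M) (\<lambda>(x, y). (T x, T y))"
proof -
  interpret P: pair_prob_space M M by (rule prob_space_pair_self)
  interpret S: measure_preserving_map "M \<Otimes>\<^sub>M M" "\<lambda>(x, y). (T x, T y)"
    by (rule measure_preserving_map_prod)
  have rect: "measure (M \<Otimes>\<^sub>M M) (a \<times> b) = prob a * prob b" if "a \<in> sets M" "b \<in> sets M" for a b
    using that by (simp add: measure_def emeasure_pair_measure_Times enn2real_mult)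
  show ?thesis
  proof (rule S.mixing_on_average_generator)
    show "Int_stable {a \<times> b | a b. a \<in> sets M \<and> b \<in> sets M}" by (rule Int_stable_pair_measure_generator)
    show "{a \<times> b | a b. a \<in> sets M \<and> b \<in> sets M} \<subseteq> Pow (space (M \<Otimes>\<^sub>M M))"
      using pair_measure_closed by (simp add: space_pair_measure)
    show "sets (M \<Otimes>\<^sub>M M) = sigma_sets (space (M \<Otimes>\<^sub>M M)) {a \<times> b | a b. a \<in> sets M \<and> b \<in> sets M}"
      by (simp add: sets_pair_measure space_pair_measure)
    fix E D assume "E \<in> {a \<times> b | a b. a \<in> sets M \<and> b \<in> sets M}" "D \<in> {a \<times> b | a b. a \<in> sets M \<and> b \<in> sets M}"
    then obtain B B' C C' where E: "E = B \<times> B'" and D: "D = C \<times> C'"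
      and sets: "B \<in> sets M" "B' \<in> sets M" "C \<in> sets M" "C' \<in> sets M" by auto
    have "\<bar>S.corr E D i\<bar> \<le> \<bar>corr B C i\<bar> + \<bar>corr B' C' i\<bar>" for i
    proof -
      define x where "x = prob (B \<inter> ((T ^^ i) -` C \<inter> space M))"
      define y where "y = prob (B' \<inter> ((T ^^ i) -` C' \<inter> space M))"
      have "E \<inter> (((\<lambda>(x, y). (T x, T y)) ^^ i) -` D \<inter> space (M \<Otimes>\<^sub>M M)) =
        (B \<inter> ((T ^^ i) -` C \<inter> space M)) \<times> (B' \<inter> ((T ^^ i) -` C' \<inter> space M))"
        by (auto simp: E D funpow_prod_map space_pair_measure)
      then have "S.corr E D i = x * y - (prob B * prob C) * (prob B' * prob C')"
        using sets by (simp add: S.corr_def rect vimage_T_power_sets E D x_def y_def algebra_simps)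
      \<comment> \<open>The identity x y - a b = (x - a) y + a (y - b), in which y and a lie in
        [0, 1].\<close>
      also have "\<dots> = corr B C i * y + (prob B * prob C) * corr B' C' i"
        by (simp add: corr_def x_def y_def algebra_simps)
      also have "\<bar>\<dots>\<bar> \<le> \<bar>corr B C i\<bar> * 1 + 1 * \<bar>corr B' C' i\<bar>"
        by (rule order_trans[OF abs_triangle_ineq], intro add_mono)
          (auto simp: abs_mult y_def intro!: mult_left_le mult_left_le_one_le mult_le_one)
      finally show ?thesis by simp
    qed
    moreover have "cesaro_null (corr B C)" "cesaro_null (corr B' C')"
      using mix sets by (auto simp: mixing_on_average_def)
    ultimately show "cesaro_null (S.corr E D)" by (rule_tac cesaro_null_dominated)
  qed
qed

text \<open>The correlation of an invariant set with itself is the same number p - p^2 at every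
  time, hence 0.\<close>

lemma mixing_on_average_ergodic:
  assumes mix: mixing_on_average and A: "A \<in> sets M" "T -` A \<inter> space M = A"
  shows "prob A = 0 \<or> prob A = 1"
proof -
  have "(T ^^ i) -` A \<inter> space M = A" for i
  proof (induction i)
    case 0 then show ?case using sets.sets_into_space[OF A(1)] by auto
  next
    case (Suc i)
    have "(T ^^ Suc i) -` A \<inter> space M = (T ^^ i) -` (T -` A \<inter> space M) \<inter> space M"
      using T_power_space by (auto simp: funpow_swap1)
    then show ?case by (simp only: A(2) Suc)
  qed
  then have "corr A A = (\<lambda>_. prob A - prob A * prob A)" by (simp add: corr_def fun_eq_iff)
  then have "cesaro_null (\<lambda>_. prob A - prob A * prob A)"
    using mix A by (metis mixing_on_average_def)
  then have "prob A * (1 - prob A) = 0" using cesaro_null_const by (fastforce simp: algebra_simps)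
  then show ?thesis by auto
qed

section \<open>Correlations of functions and eigenfunctions of mixing maps\<close>

lemma integral_indicator_complex:
  "B \<in> sets M \<Longrightarrow> (\<integral>x. (indicator B x :: complex) \<partial>M) = of_real (prob B)"
proof -
  assume B: "B \<in> sets M"
  have "(\<integral>x. (indicator B x :: complex) \<partial>M) = (\<integral>x. complex_of_real (indicator B x) \<partial>M)"
    by (intro Bochner_Integration.integral_cong) (auto simp: indicator_def)
  then show ?thesis using B by (simp add: emeasure_eq_measure)
qed

lemma integrable_indicator_T_power:
  fixes h :: "'a \<Rightarrow> complex"
  assumes "B \<in> sets M" "integrable M h"
  shows "integrable M (\<lambda>x. indicator B x * h ((T ^^ i) x))"
proof -
  have "(\<lambda>x. indicator B x * h ((T ^^ i) x)) = (\<lambda>x. indicator B x *\<^sub>R h ((T ^^ i) x))"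
    by (auto simp: indicator_def fun_eq_iff)
  then show ?thesis
    using integrable_mult_indicator[OF assms(1) integrable_T_power[OF assms(2), of i]] by simp
qed

text \<open>The pairing is bilinear; the conjugate is put into \<phi> when an eigenfunction is
  correlated with itself.\<close>

definition fcorr :: "('a \<Rightarrow> complex) \<Rightarrow> ('a \<Rightarrow> complex) \<Rightarrow> nat \<Rightarrow> real" where
  "fcorr \<phi> \<psi> i = norm ((\<integral>x. \<phi> x * \<psi> ((T ^^ i) x) \<partial>M) - (\<integral>x. \<phi> x \<partial>M) * (\<integral>x. \<psi> x \<partial>M))"

text \<open>Tailored to the limit case of \<open>integrable_induct\<close>; the dominating function
  3 |\<psi>| comes from |\<psi>| + 2 |\<psi>|.\<close>

lemma L1_approx:
  fixes \<psi> :: "'a \<Rightarrow> complex"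
  assumes "\<And>i. integrable M (s i)" "integrable M \<psi>" "\<And>x. x \<in> space M \<Longrightarrow> (\<lambda>i. s i x) \<longlonglongrightarrow> \<psi> x"
    "\<And>i x. x \<in> space M \<Longrightarrow> norm (s i x) \<le> 2 * norm (\<psi> x)" "e > 0"
  shows "\<exists>k. (\<integral>x. norm (\<psi> x - s k x) \<partial>M) < e"
proof -
  have "(\<lambda>k. \<integral>x. norm (\<psi> x - s k x) \<partial>M) \<longlonglongrightarrow> (\<integral>x. 0 \<partial>M)"
  proof (rule integral_dominated_convergence[where w="\<lambda>x. 3 * norm (\<psi> x)"])
    show "AE x in M. (\<lambda>k. norm (\<psi> x - s k x)) \<longlonglongrightarrow> 0"
      using AE_space
    proof eventually_elim
      fix x assume "x \<in> space M"
      then have "(\<lambda>k. norm (\<psi> x - s k x)) \<longlonglongrightarrow> norm (\<psi> x - \<psi> x)" using assms(3) by (intro tendsto_intros)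
      then show "(\<lambda>k. norm (\<psi> x - s k x)) \<longlonglongrightarrow> 0" by simp
    qed
    show "AE x in M. norm (norm (\<psi> x - s k x)) \<le> 3 * norm (\<psi> x)" for k
      using AE_space
    proof eventually_elim
      fix x assume "x \<in> space M"
      then show "norm (norm (\<psi> x - s k x)) \<le> 3 * norm (\<psi> x)"
        using assms(4)[of x k] norm_triangle_ineq4[of "\<psi> x" "s k x"] by simp
    qed
  qed (use assms in auto)
  then have "eventually (\<lambda>k. (\<integral>x. norm (\<psi> x - s k x) \<partial>M) < e) sequentially"
    using assms(5) order_tendstoD(2)[of _ 0 sequentially e] by simp
  then show ?thesis by (auto dest: eventually_happens)
qed

text \<open>An indicator is bounded and T preserves L^1 norms, so these correlations depend on
  \<psi> continuously in L^1, uniformly in the time. This carries the claim from indicators to all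
  integrable \<psi>.\<close>

lemma fcorr_indicator:
  assumes mix: mixing_on_average and B: "B \<in> sets M" and \<psi>: "integrable M \<psi>"
  shows "cesaro_null (fcorr (indicator B) \<psi>)"
  using \<psi>
proof (induction rule: integrable_induct)
  case (base A c)
  have "fcorr (indicator B) (\<lambda>x. indicator A x *\<^sub>R c) i = norm c * \<bar>corr B A i\<bar>" for i
  proof -
    have "(\<integral>x. indicator B x * (indicator A ((T ^^ i) x) *\<^sub>R c) \<partial>M) =
      (\<integral>x. indicator (B \<inter> ((T ^^ i) -` A \<inter> space M)) x *\<^sub>R c \<partial>M)"
      by (intro Bochner_Integration.integral_cong) (auto simp: indicator_def)
    also have "\<dots> = prob (B \<inter> ((T ^^ i) -` A \<inter> space M)) *\<^sub>R c"
      using B base by (subst integral_scaleR_left) (auto intro!: vimage_T_power_sets simp: emeasure_eq_measure)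
    finally have 1: "(\<integral>x. indicator B x * (indicator A ((T ^^ i) x) *\<^sub>R c) \<partial>M) = prob (B \<inter> ((T ^^ i) -` A \<inter> space M)) *\<^sub>R c" .
    note 2 = integral_indicator_complex[OF B]
    have 3: "(\<integral>x. indicator A x *\<^sub>R c \<partial>M) = prob A *\<^sub>R c"
      using base by (subst integral_scaleR_left) (auto simp: emeasure_eq_measure)
    have "fcorr (indicator B) (\<lambda>x. indicator A x *\<^sub>R c) i = norm (corr B A i *\<^sub>R c)"
      unfolding fcorr_def 1 2 3 corr_def by (simp add: scaleR_conv_of_real algebra_simps)
    then show ?thesis by simp
  qed
  then have "\<bar>fcorr (indicator B) (\<lambda>x. indicator A x *\<^sub>R c) i\<bar> \<le> \<bar>norm c * corr B A i\<bar>" for i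
    by (simp add: abs_mult)
  moreover have "cesaro_null (\<lambda>i. norm c * corr B A i)"
    using mix B base by (intro cesaro_null_cmult) (auto simp: mixing_on_average_def)
  ultimately show ?case by (rule cesaro_null_mono[rotated])
next
  case (add f g)
  note int = integrable_indicator_T_power[OF B]
  show ?case
  proof (rule cesaro_null_dominated[OF add.IH])
    fix i
    show "\<bar>fcorr (indicator B) (\<lambda>x. f x + g x) i\<bar> \<le> \<bar>fcorr (indicator B) f i\<bar> + \<bar>fcorr (indicator B) g i\<bar>"
      unfolding fcorr_def abs_norm_cancel
      using add int[OF add.hyps(1), of i] int[OF add.hyps(2), of i]
      by (intro order_trans[OF _ norm_triangle_ineq]) (simp add: algebra_simps)
  qed
next
  case (lim f s)
  note int = integrable_indicator_T_power[OF B]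
  show ?case
  proof (rule cesaro_null_approx)
    fix e :: real assume "e > 0"
    then obtain k where k: "(\<integral>x. norm (f x - s k x) \<partial>M) < e/2"
      using L1_approx[of s f "e/2"] lim by auto
    define d where "d x = f x - s k x" for x
    have d: "integrable M d" unfolding d_def using lim by auto
    have kd: "(\<integral>x. norm (d x) \<partial>M) < e/2" using k by (simp add: d_def)
    have fc: "fcorr (indicator B) d i \<le> e" for i
    proof -
      have "norm (\<integral>x. indicator B x * d ((T ^^ i) x) \<partial>M) \<le> (\<integral>x. norm (indicator B x * d ((T ^^ i) x)) \<partial>M)"
        by (rule integral_norm_bound)
      also have "\<dots> \<le> (\<integral>x. norm (d ((T ^^ i) x)) \<partial>M)"
        by (intro integral_mono integrable_norm int integrable_T_power d) (auto simp: norm_mult indicator_def)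
      also have "\<dots> = (\<integral>x. norm (d x) \<partial>M)"
        using d by (intro integral_T_power) auto
      finally have 1: "norm (\<integral>x. indicator B x * d ((T ^^ i) x) \<partial>M) \<le> e/2" using k by (simp add: d_def)
      have "norm ((\<integral>x. (indicator B x :: complex) \<partial>M) * (\<integral>x. d x \<partial>M)) \<le> 1 * (e/2)"
        unfolding norm_mult
      proof (intro mult_mono)
        show "norm (\<integral>x. (indicator B x :: complex) \<partial>M) \<le> 1" by (simp add: integral_indicator_complex[OF B])
        show "norm (\<integral>x. d x \<partial>M) \<le> e/2"
          using integral_norm_bound[of M d] kd by linarith
      qed auto
      then show ?thesis unfolding fcorr_def
        using 1 norm_triangle_ineq4[of "\<integral>x. indicator B x * d ((T ^^ i) x) \<partial>M" "(\<integral>x. (indicator B x :: complex) \<partial>M) * (\<integral>x. d x \<partial>M)"]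
        by linarith
    qed
    have "\<bar>fcorr (indicator B) f i\<bar> \<le> \<bar>fcorr (indicator B) (s k) i\<bar> + e" for i
    proof -
      have "fcorr (indicator B) f i \<le> fcorr (indicator B) (s k) i + fcorr (indicator B) d i"
        unfolding fcorr_def d_def
        using lim.hyps(1)[of k] lim.hyps(4) int[OF lim.hyps(1)[of k], of i] int[OF lim.hyps(4), of i]
        by (intro order_trans[OF _ norm_triangle_ineq]) (simp add: algebra_simps)
      then show ?thesis using fc[of i] by (simp add: fcorr_def)
    qed
    then show "\<exists>b. cesaro_null b \<and> (\<forall>i. \<bar>fcorr (indicator B) f i\<bar> \<le> \<bar>b i\<bar> + e)" using lim.IH by blast
  qed
qed

text \<open>The same induction in the other variable: a bound on \<psi> makes the correlations
  continuous in \<phi> for the L^1 norm, uniformly in the time.\<close>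

lemma fcorr_integrable:
  assumes mix: mixing_on_average and \<psi>: "\<psi> \<in> borel_measurable M" "\<And>x. norm (\<psi> x) \<le> 1" and \<phi>: "integrable M \<phi>"
  shows "cesaro_null (fcorr \<phi> \<psi>)"
proof -
  have \<psi>_int: "integrable M \<psi>" using \<psi> by (intro integrable_const_bound[of _ 1]) auto
  have int: "integrable M (\<lambda>x. h x * \<psi> ((T ^^ i) x))" if h: "integrable M h" for h :: "'a \<Rightarrow> complex" and i
  proof (rule Bochner_Integration.integrable_bound[OF h])
    show "(\<lambda>x. h x * \<psi> ((T ^^ i) x)) \<in> borel_measurable M" using h \<psi>(1) by measurable
    show "AE x in M. norm (h x * \<psi> ((T ^^ i) x)) \<le> norm (h x)"
      using \<psi>(2) by (auto simp: norm_mult intro!: mult_left_le)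
  qed
  show ?thesis using \<phi>
  proof (induction rule: integrable_induct)
    case (base A c)
    have "fcorr (\<lambda>x. indicator A x *\<^sub>R c) \<psi> i = norm c * fcorr (indicator A) \<psi> i" for i
    proof -
      have "(\<lambda>x. indicator A x *\<^sub>R c * \<psi> ((T ^^ i) x)) = (\<lambda>x. c * (indicator A x * \<psi> ((T ^^ i) x)))"
        "(\<lambda>x. indicator A x *\<^sub>R c) = (\<lambda>x. c * indicator A x)"
        by (auto simp: indicator_def fun_eq_iff)
      then have "fcorr (\<lambda>x. indicator A x *\<^sub>R c) \<psi> i = norm (c * ((\<integral>x. indicator A x * \<psi> ((T ^^ i) x) \<partial>M) - (\<integral>x. indicator A x \<partial>M) * (\<integral>x. \<psi> x \<partial>M)))"
        unfolding fcorr_def by (simp add: algebra_simps)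
      then show ?thesis by (simp add: fcorr_def norm_mult)
    qed
    then show ?case using fcorr_indicator[OF mix base(1) \<psi>_int] cesaro_null_cmult
      by (metis (no_types, lifting) cesaro_null_mono order_refl)
  next
    case (add f g)
    show ?case
    proof (rule cesaro_null_dominated[OF add.IH])
      fix i
      show "\<bar>fcorr (\<lambda>x. f x + g x) \<psi> i\<bar> \<le> \<bar>fcorr f \<psi> i\<bar> + \<bar>fcorr g \<psi> i\<bar>"
        unfolding fcorr_def abs_norm_cancel
        using add int[OF add.hyps(1), of i] int[OF add.hyps(2), of i]
        by (intro order_trans[OF _ norm_triangle_ineq]) (simp add: algebra_simps)
    qed
  next
    case (lim f s)
    show ?case
    proof (rule cesaro_null_approx)
      fix e :: real assume "e > 0"
      then obtain k where k: "(\<integral>x. norm (f x - s k x) \<partial>M) < e/2"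
        using L1_approx[of s f "e/2"] lim by auto
      define d where "d x = f x - s k x" for x
      have d: "integrable M d" unfolding d_def using lim by auto
    have kd: "(\<integral>x. norm (d x) \<partial>M) < e/2" using k by (simp add: d_def)
      have fc: "fcorr d \<psi> i \<le> e" for i
      proof -
        have "norm (\<integral>x. d x * \<psi> ((T ^^ i) x) \<partial>M) \<le> (\<integral>x. norm (d x * \<psi> ((T ^^ i) x)) \<partial>M)"
          by (rule integral_norm_bound)
        also have "\<dots> \<le> (\<integral>x. norm (d x) \<partial>M)"
          using \<psi>(2) by (intro integral_mono integrable_norm int d) (auto simp: norm_mult intro!: mult_left_le)
        finally have 1: "norm (\<integral>x. d x * \<psi> ((T ^^ i) x) \<partial>M) \<le> e/2" using k by (simp add: d_def)
        have "norm ((\<integral>x. d x \<partial>M) * (\<integral>x. \<psi> x \<partial>M)) \<le> (e/2) * 1"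
          unfolding norm_mult
        proof (intro mult_mono)
          have "(\<integral>x. norm (\<psi> x) \<partial>M) \<le> 1" using \<psi> by (intro integral_le_bound) auto
          then show "norm (\<integral>x. \<psi> x \<partial>M) \<le> 1" using integral_norm_bound[of M \<psi>] by linarith
          show "norm (\<integral>x. d x \<partial>M) \<le> e/2"
            using integral_norm_bound[of M d] kd by linarith
        qed (use \<open>e > 0\<close> in auto)
        then show ?thesis unfolding fcorr_def
          using 1 norm_triangle_ineq4[of "\<integral>x. d x * \<psi> ((T ^^ i) x) \<partial>M" "(\<integral>x. d x \<partial>M) * (\<integral>x. \<psi> x \<partial>M)"]
          by linarith
      qed
      have "\<bar>fcorr f \<psi> i\<bar> \<le> \<bar>fcorr (s k) \<psi> i\<bar> + e" for i
      proof -
        have "fcorr f \<psi> i \<le> fcorr (s k) \<psi> i + fcorr d \<psi> i"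
          unfolding fcorr_def d_def
          using lim.hyps(1)[of k] lim.hyps(4) int[OF lim.hyps(1)[of k], of i] int[OF lim.hyps(4), of i]
          by (intro order_trans[OF _ norm_triangle_ineq]) (simp add: algebra_simps)
        then show ?thesis using fc[of i] by (simp add: fcorr_def)
      qed
      then show "\<exists>b. cesaro_null b \<and> (\<forall>i. \<bar>fcorr f \<psi> i\<bar> \<le> \<bar>b i\<bar> + e)" using lim.IH by blast
    qed
  qed
qed

text \<open>Correlating the conjugate of g with g gives c^i a - |m|^2 at time i, where a is the
  second moment and m the mean. Since |c| = 1, its modulus is at least |a - |m|^2| for every i, so a
  = |m|^2: the variance vanishes and g is almost everywhere its mean.\<close>

lemma mixing_bounded_eigenfunction_constant:
  assumes mix: mixing_on_average and g: "g \<in> borel_measurable M" "\<And>x. norm (g x) \<le> 1"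
    and eig: "AE x in M. g (T x) = c * g x" and c: "norm c = 1"
  shows "\<exists>k. AE x in M. g x = (k :: complex)"
proof -
  note [measurable] = g(1)
  have int1: "integrable M g" using g by (intro integrable_const_bound[of _ 1]) auto
  then have int2: "integrable M (\<lambda>x. cnj (g x))" by simp
  note [measurable] = borel_measurable_integrable[OF int2]
  have int3: "integrable M (\<lambda>x. g x * cnj (g x))"
    using g(2) by (intro integrable_const_bound[of _ 1]) (auto simp: norm_mult intro!: mult_le_one)
  define a where "a = (\<integral>x. (norm (g x))\<^sup>2 \<partial>M)"
  define m where "m = (\<integral>x. g x \<partial>M)"
  have a0: "0 \<le> a" by (simp add: a_def)
  have gg: "(\<integral>x. g x * cnj (g x) \<partial>M) = of_real a"
    unfolding a_def complex_norm_square[symmetric] by (simp flip: of_real_power)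
  have mm: "m * cnj m = of_real ((norm m)\<^sup>2)" by (rule complex_norm_square[symmetric])
  have orbit: "AE x in M. g ((T ^^ i) x) = c ^ i * g x" for i
  proof (induction i)
    case (Suc i)
    show ?case using AE_T[OF Suc] eig by eventually_elim (simp add: funpow_swap1)
  qed simp
  have "\<bar>a - (norm m)\<^sup>2\<bar> \<le> \<bar>fcorr (\<lambda>x. cnj (g x)) g i\<bar>" for i
  proof -
    have "(\<integral>x. cnj (g x) * g ((T ^^ i) x) \<partial>M) = (\<integral>x. c ^ i * (g x * cnj (g x)) \<partial>M)"
    proof (rule integral_cong_AE)
      show "AE x in M. cnj (g x) * g ((T ^^ i) x) = c ^ i * (g x * cnj (g x))"
        using orbit[of i] by eventually_elim simp
    qed auto
    then have "fcorr (\<lambda>x. cnj (g x)) g i = norm (c ^ i * of_real a - cnj m * m)"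
      by (simp add: fcorr_def gg m_def)
    also have "\<dots> = norm (c ^ i * of_real a - of_real ((norm m)\<^sup>2))" using mm by (simp add: mult.commute)
    \<comment> \<open>The reverse triangle inequality removes the rotating phase c^i.\<close>
    also have "\<dots> \<ge> \<bar>norm (c ^ i * of_real a) - norm (complex_of_real ((norm m)\<^sup>2))\<bar>"
      by (rule norm_triangle_ineq3)
    finally show ?thesis using c a0 by (simp add: norm_mult norm_power)
  qed
  then have "cesaro_null (\<lambda>_. a - (norm m)\<^sup>2)"
    by (rule cesaro_null_mono[OF fcorr_integrable[OF mix g int2]])
  then have am: "a = (norm m)\<^sup>2" using cesaro_null_const by fastforce
  have "(\<integral>x. (g x - m) * cnj (g x - m) \<partial>M) = (\<integral>x. (g x * cnj (g x) - m * cnj (g x)) - (cnj m * g x - m * cnj m) \<partial>M)"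
    by (intro Bochner_Integration.integral_cong) (auto simp: algebra_simps)
  also have "\<dots> = ((\<integral>x. g x * cnj (g x) \<partial>M) - m * (\<integral>x. cnj (g x) \<partial>M)) - (cnj m * (\<integral>x. g x \<partial>M) - m * cnj m)"
    using int1 int2 int3 by (simp add: prob_space)
  also have "\<dots> = 0" using gg mm am by (simp add: m_def[symmetric] mult.commute)
  finally have "complex_of_real (\<integral>x. (norm (g x - m))\<^sup>2 \<partial>M) = 0"
    unfolding complex_norm_square[symmetric] by (simp flip: of_real_power)
  then have "(\<integral>x. (norm (g x - m))\<^sup>2 \<partial>M) = 0" by simp
  moreover have "norm ((norm (g x - m))\<^sup>2) \<le> (1 + norm m)\<^sup>2" for x
    using g(2)[of x] norm_triangle_ineq4[of "g x" m] by (simp add: power_mono)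
  then have "integrable M (\<lambda>x. (norm (g x - m))\<^sup>2)"
    by (intro integrable_const_bound[of _ "(1 + norm m)\<^sup>2"]) auto
  ultimately have "AE x in M. g x = m"
    by (subst (asm) integral_nonneg_eq_0_iff_AE) auto
  then show ?thesis by blast
qed

text \<open>T multiplies |f| by |c| but preserves its distribution. After squashing |f| to an
  integrable function \<psi>, the functions \<psi> o T and \<psi> are ordered according to whether
  |c| < 1 and have equal integrals, so they agree almost everywhere.\<close>

lemma eigenfunction_zero_if_norm_ne_1:
  assumes f[measurable]: "f \<in> borel_measurable M" and eig: "AE x in M. f (T x) = c * (f x :: complex)" and c: "norm c \<noteq> 1"
  shows "AE x in M. f x = 0"
proof -
  \<comment> \<open>An injective increasing map of the half line into [0, 1]; f itself need not be
    integrable.\<close>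
  define h where "h t = t / (1 + t)" for t :: real
  have h_mono: "h t \<le> h t'" if "0 \<le> t" "t \<le> t'" for t t' using that by (simp add: h_def field_simps)
  have h_inj: "t = t'" if "0 \<le> t" "0 \<le> t'" "h t = h t'" for t t' using that by (simp add: h_def field_simps)
  have h_le: "\<bar>h t\<bar> \<le> 1" if "0 \<le> t" for t using that by (simp add: h_def field_simps)
  define \<psi> where "\<psi> x = h (norm (f x))" for x
  have \<psi>[measurable]: "\<psi> \<in> borel_measurable M" unfolding \<psi>_def h_def by measurable
  have \<psi>_le: "\<bar>\<psi> x\<bar> \<le> 1" for x by (simp add: \<psi>_def h_le)
  have int: "integrable M \<psi>" "integrable M (\<lambda>x. \<psi> (T x))"
    using \<psi>_le by (auto intro!: integrable_const_bound[of _ 1])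
  have eq: "(\<integral>x. \<psi> (T x) \<partial>M) = (\<integral>x. \<psi> x \<partial>M)" by (rule integral_T[OF \<psi>])
  have \<psi>T: "AE x in M. \<psi> (T x) = h (norm c * norm (f x))"
    using eig by eventually_elim (simp add: \<psi>_def norm_mult)
  have "AE x in M. \<psi> (T x) = \<psi> x"
  proof (cases "norm c < 1")
    case True
    have "AE x in M. 0 \<le> \<psi> x - \<psi> (T x)"
      using \<psi>T
    proof eventually_elim
      fix x assume "\<psi> (T x) = h (norm c * norm (f x))"
      moreover have "h (norm c * norm (f x)) \<le> h (norm (f x))"
        using True by (intro h_mono mult_left_le_one_le) auto
      ultimately show "0 \<le> \<psi> x - \<psi> (T x)" by (simp add: \<psi>_def)
    qed
    moreover have "(\<integral>x. \<psi> x - \<psi> (T x) \<partial>M) = 0" using int eq by simp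
    ultimately have "AE x in M. \<psi> x - \<psi> (T x) = 0"
      using int by (subst (asm) integral_nonneg_eq_0_iff_AE) auto
    then show ?thesis by eventually_elim simp
  next
    case False
    have "AE x in M. 0 \<le> \<psi> (T x) - \<psi> x"
      using \<psi>T
    proof eventually_elim
      fix x assume "\<psi> (T x) = h (norm c * norm (f x))"
      moreover have "h (norm (f x)) \<le> h (norm c * norm (f x))"
        using False by (intro h_mono) (auto simp: mult_le_cancel_right1)
      ultimately show "0 \<le> \<psi> (T x) - \<psi> x" by (simp add: \<psi>_def)
    qed
    moreover have "(\<integral>x. \<psi> (T x) - \<psi> x \<partial>M) = 0" using int eq by simp
    ultimately have "AE x in M. \<psi> (T x) - \<psi> x = 0"
      using int by (subst (asm) integral_nonneg_eq_0_iff_AE) auto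
    then show ?thesis by eventually_elim simp
  qed
  with \<psi>T show ?thesis
  proof eventually_elim
    fix x assume "\<psi> (T x) = h (norm c * norm (f x))" "\<psi> (T x) = \<psi> x"
    then have "norm c * norm (f x) = norm (f x)" by (rule_tac h_inj) (simp_all add: \<psi>_def)
    then show "f x = 0" using c by simp
  qed
qed

text \<open>For |c| = 1 the squashing z -> z / (1 + |z|) commutes with multiplication by c, so it
  turns f into a bounded eigenfunction. It is injective, so constancy carries back to f.\<close>

theorem eigenfunctions_constant_if_mixing:
  assumes mix: mixing_on_average
  shows eigenfunctions_constant
  unfolding eigenfunctions_constant_def
proof (intro allI impI)
  fix f :: "'a \<Rightarrow> complex" and c
  assume f[measurable]: "f \<in> borel_measurable M" and eig: "AE x in M. f (T x) = c * f x"
  show "\<exists>k. AE x in M. f x = k"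
  proof (cases "norm c = 1")
    case True
    define g where "g x = f x / of_real (1 + norm (f x))" for x
    have norm_g: "norm (z / of_real (1 + norm z)) = norm z / (1 + norm z)" for z :: complex
      unfolding norm_divide norm_of_real by (simp add: add_nonneg_nonneg)
    have inj: "z = w" if "z / of_real (1 + norm z) = w / of_real (1 + norm w)" for z w :: complex
    proof -
      have "norm z / (1 + norm z) = norm w / (1 + norm w)"
        using arg_cong[OF that, of norm] by (simp only: norm_g)
      then have "norm z * (1 + norm w) = norm w * (1 + norm z)"
        by (subst (asm) frac_eq_eq) (auto simp: add_nonneg_eq_0_iff)
      then have "norm z = norm w" by (simp add: algebra_simps)
      moreover have "complex_of_real (1 + norm w) \<noteq> 0"
        by (metis add_pos_nonneg less_irrefl norm_ge_zero of_real_eq_0_iff zero_less_one)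
      ultimately show ?thesis using that by simp
    qed
    have "\<exists>k. AE x in M. g x = k"
    proof (rule mixing_bounded_eigenfunction_constant[OF mix _ _ _ True])
      show "g \<in> borel_measurable M" unfolding g_def by measurable
      show "norm (g x) \<le> 1" for x unfolding g_def norm_g by (simp add: divide_le_eq add_pos_nonneg)
      show "AE x in M. g (T x) = c * g x"
        using eig by eventually_elim (simp add: g_def norm_mult True)
    qed
    then obtain k where k: "AE x in M. g x = k" ..
    \<comment> \<open>A value taken almost everywhere in a probability space is taken somewhere;
      such a point supplies the constant for f.\<close>
    have "\<exists>x. g x = k"
      using eventually_happens[OF k] by (simp add: ae_filter_eq_bot_iff emeasure_space_1)
    then obtain x0 where "g x0 = k" ..
    then have "AE x in M. f x = f x0"
      using k unfolding g_def by (auto intro!: inj elim!: eventually_mono simp del: of_real_add)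
    then show ?thesis by blast
  next
    case False
    then show ?thesis using eigenfunction_zero_if_norm_ne_1[OF f eig] by blast
  qed
qed

end

section \<open>Upper probabilities\<close>

lemma measure_preserving_map_if_inv_probs:
  assumes T: "T \<in> measurable M M" and Q: "Q \<in> inv_probs M T"
  shows "measure_preserving_map Q T"
proof -
  have sets: "sets Q = sets M" and inv: "\<And>A. A \<in> sets M \<Longrightarrow> measure Q (T -` A \<inter> space M) = measure Q A"
    using Q by (auto simp: inv_probs_def)
  interpret Q: prob_space Q using Q by (simp add: inv_probs_def)
  have sp: "space Q = space M" using sets by (rule sets_eq_imp_space_eq)
  have TQ: "T \<in> measurable Q Q" using T measurable_cong_sets[OF sets sets] by simp
  show ?thesis
  proof
    show "T \<in> measurable Q Q" by fact
    show "distr Q Q T = Q"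
      by (rule measure_eqI) (auto simp: emeasure_distr TQ Q.emeasure_eq_measure inv sets sp)
  qed
qed

locale invariant_upper_probability =
  fixes M :: "'a measure" and T :: "'a \<Rightarrow> 'a" and V :: "'a set \<Rightarrow> real"
  assumes T_meas [measurable]: "T \<in> measurable M M"
    and upper: "upper_probability M V" and inv: "invariant_capacity M T V"
begin

lemma V_empty: "V {} = 0"
  and V_mono: "A \<in> sets M \<Longrightarrow> B \<in> sets M \<Longrightarrow> A \<subseteq> B \<Longrightarrow> V A \<le> V B"
  and V_nonneg: "A \<in> sets M \<Longrightarrow> 0 \<le> V A"
  and V_le_1: "A \<in> sets M \<Longrightarrow> V A \<le> 1"
  using upper by (auto simp: upper_probability_def capacity_def)

lemma V_T: "A \<in> sets M \<Longrightarrow> V (T -` A \<inter> space M) = V A"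
  using inv by (auto simp: invariant_capacity_def)

lemma T_power_meas [measurable]: "(T ^^ i) \<in> measurable M M"
  by (induction i) auto

lemma T_power_sets: "A \<in> sets M \<Longrightarrow> (T ^^ i) -` A \<inter> space M \<in> sets M"
  by (rule measurable_sets[OF T_power_meas])

lemma vimage_Suc: "(T ^^ i) -` (T -` A \<inter> space M) \<inter> space M = (T ^^ Suc i) -` A \<inter> space M"
  using measurable_space[OF T_power_meas] by auto

lemma vimage_Suc': "T -` ((T ^^ i) -` A \<inter> space M) \<inter> space M = (T ^^ Suc i) -` A \<inter> space M"
  using measurable_space[OF T_meas] by (auto simp: funpow_swap1)

lemma V_T_power: "A \<in> sets M \<Longrightarrow> V ((T ^^ i) -` A \<inter> space M) = V A"
proof (induction i)
  case 0
  then show ?case using sets.sets_into_space[of A M] by (simp add: Int_absorb2)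
next
  case (Suc i)
  then have "V (T -` ((T ^^ i) -` A \<inter> space M) \<inter> space M) = V A"
    using V_T[OF T_power_sets] by metis
  then show ?case unfolding vimage_Suc' .
qed

section \<open>The core: countable additivity, compactness, invariant elements\<close>

lemma core_nonneg: "p \<in> core M V \<Longrightarrow> A \<in> sets M \<Longrightarrow> 0 \<le> p A"
  and core_space: "p \<in> core M V \<Longrightarrow> p (space M) = 1"
  and core_add: "p \<in> core M V \<Longrightarrow> A \<in> sets M \<Longrightarrow> B \<in> sets M \<Longrightarrow> A \<inter> B = {} \<Longrightarrow> p (A \<union> B) = p A + p B"
  and core_le: "p \<in> core M V \<Longrightarrow> A \<in> sets M \<Longrightarrow> p A \<le> V A"
  and core_outside: "p \<in> core M V \<Longrightarrow> A \<notin> sets M \<Longrightarrow> p A = 0"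
  by (auto simp: core_def)

lemma measure_in_core:
  assumes "prob_space P" "sets P = sets M" "\<And>A. A \<in> sets M \<Longrightarrow> measure P A \<le> V A"
  shows "measure P \<in> core M V"
proof -
  interpret prob_space P by fact
  have "space P = space M" using assms(2) by (rule sets_eq_imp_space_eq)
  then have "measure P (space M) = 1" using prob_space by simp
  then show ?thesis
    using assms(2,3) by (auto simp: core_def finite_measure_Union measure_notin_sets)
qed

lemma V_attained:
  assumes "A \<in> sets M"
  obtains P where "prob_space P" "sets P = sets M" "measure P \<in> core M V" "measure P A = V A"
proof -
  obtain \<Lambda> where L: "\<And>P. P \<in> \<Lambda> \<Longrightarrow> prob_space P \<and> sets P = sets M"
    "\<And>A P. A \<in> sets M \<Longrightarrow> P \<in> \<Lambda> \<Longrightarrow> measure P A \<le> V A" "\<And>A. A \<in> sets M \<Longrightarrow> \<exists>P\<in>\<Lambda>. measure P A = V A"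
    using upper unfolding upper_probability_def by metis
  obtain P where "P \<in> \<Lambda>" "measure P A = V A" using L(3)[OF assms] by auto
  then show ?thesis using L(1,2) by (intro that[of P] measure_in_core) auto
qed

text \<open>Dini's argument: the sets of measures giving small mass to the members of a decreasing
  sequence form an increasing open cover of the compact set defining the upper probability.\<close>

lemma V_decseq_null:
  assumes A: "\<And>n. A n \<in> sets M" "decseq A" "V (\<Inter>n. A n) = 0"
  shows "(\<lambda>n. V (A n)) \<longlonglongrightarrow> 0"
proof -
  obtain \<Lambda> where L: "\<And>P. P \<in> \<Lambda> \<Longrightarrow> prob_space P \<and> sets P = sets M"
    "compact ((\<lambda>P A. measure P A) ` \<Lambda>)"
    "\<And>A P. A \<in> sets M \<Longrightarrow> P \<in> \<Lambda> \<Longrightarrow> measure P A \<le> V A" "\<And>A. A \<in> sets M \<Longrightarrow> \<exists>P\<in>\<Lambda>. measure P A = V A"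
    using upper unfolding upper_probability_def by metis
  have AI: "(\<Inter>n. A n) \<in> sets M" using A by auto
  show ?thesis
  proof (rule LIMSEQ_I)
    fix e :: real assume e: "e > 0"
    define U where "U n = {p :: 'a set \<Rightarrow> real. p (A n) < e}" for n
    have "open (U n)" for n
      unfolding U_def by (intro open_Collect_less continuous_on_product_coordinates continuous_on_const)
    moreover have "(\<lambda>P A. measure P A) ` \<Lambda> \<subseteq> (\<Union>n. U n)"
    proof (intro subsetI, elim imageE)
      fix p P assume p: "p = measure P" "P \<in> \<Lambda>"
      interpret prob_space P using L(1) p by blast
      have "(\<lambda>n. prob (A n)) \<longlonglongrightarrow> prob (\<Inter>n. A n)"
        using A L(1)[OF p(2)] by (intro finite_Lim_measure_decseq) auto
      moreover have "prob (\<Inter>n. A n) \<le> 0" using L(3)[OF AI p(2)] A(3) by simp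
      ultimately have "eventually (\<lambda>n. prob (A n) < e) sequentially"
        using e order_tendstoD(2) by (metis le_less_trans)
      then show "p \<in> (\<Union>n. U n)" unfolding p U_def by (auto dest: eventually_happens)
    qed
    ultimately obtain I where I: "finite I" "(\<lambda>P A. measure P A) ` \<Lambda> \<subseteq> (\<Union>n\<in>I. U n)"
      using compactE_image[OF L(2), of UNIV U] by metis
    obtain N where N: "\<And>i. i \<in> I \<Longrightarrow> i \<le> N" using I(1) finite_nat_set_iff_bounded_le by auto
    have "norm (V (A n) - 0) < e" if "n \<ge> N" for n
    proof -
      obtain P where P: "P \<in> \<Lambda>" "measure P (A n) = V (A n)" using L(4)[OF A(1)] by auto
      interpret prob_space P using L(1) P by blast
      obtain i where i: "i \<in> I" "prob (A i) < e" using I(2) P(1) by (auto simp: U_def)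
      have "A n \<subseteq> A i" using A(2) N[OF i(1)] that by (auto simp: decseq_def)
      then have "prob (A n) \<le> prob (A i)" using A(1) L(1)[OF P(1)] by (intro finite_measure_mono) auto
      then show ?thesis using i P V_nonneg[OF A(1), of n] by simp
    qed
    then show "\<exists>N. \<forall>n\<ge>N. norm (V (A n) - 0) < e" by blast
  qed
qed

text \<open>Domination by V transfers continuity at the empty set to p. The final equality holds on
  all subsets: off the sigma-algebra \<open>core\<close> prescribes the value 0, which is also the
  default of \<open>measure\<close>.\<close>

lemma core_is_measure:
  assumes p: "p \<in> core M V"
  obtains P where "prob_space P" "sets P = sets M" "measure P = p"
proof -
  define P where "P = measure_of (space M) (sets M) (\<lambda>A. ennreal (p A))"
  have p0: "p {} = 0" using core_add[OF p, of "{}" "{}"] by simp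
  have pos: "positive (sets M) (\<lambda>A. ennreal (p A))" by (simp add: positive_def p0)
  have "countably_additive (sets M) (\<lambda>A. ennreal (p A))"
  proof (rule sets.empty_continuous_imp_countably_additive[OF pos])
    show "additive (sets M) (\<lambda>A. ennreal (p A))"
      by (auto simp: additive_def core_add[OF p] core_nonneg[OF p] ennreal_plus)
    fix A :: "nat \<Rightarrow> 'a set" assume A: "range A \<subseteq> sets M" "decseq A" "(\<Inter>i. A i) = {}"
    have "(\<lambda>i. p (A i)) \<longlonglongrightarrow> 0"
    proof (rule tendsto_sandwich[OF _ _ tendsto_const])
      show "(\<lambda>i. V (A i)) \<longlonglongrightarrow> 0" using A by (intro V_decseq_null) (auto simp: V_empty)
    qed (use A core_nonneg[OF p] core_le[OF p] in \<open>auto intro!: always_eventually\<close>)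
    then show "(\<lambda>i. ennreal (p (A i))) \<longlonglongrightarrow> 0"
      using tendsto_ennrealI by fastforce
  qed auto
  then have em: "emeasure P A = ennreal (p A)" if "A \<in> sets M" for A
    unfolding P_def using that pos by (intro emeasure_measure_of_sigma sets.sigma_algebra_axioms)
  have sets: "sets P = sets M" by (simp add: P_def)
  have sp: "space P = space M" by (simp add: P_def)
  have "measure P A = p A" for A
    by (cases "A \<in> sets M")
      (auto simp: measure_def em core_nonneg[OF p] core_outside[OF p] sets emeasure_notin_sets)
  moreover have "prob_space P" by (rule prob_spaceI) (simp add: sp em core_space[OF p])
  ultimately show ?thesis using sets by (intro that[of P]) auto
qed

text \<open>Each condition involves finitely many coordinates and is closed, so the core is a closed
  subset of a cube. The prescribed value 0 off the sigma-algebra keeps those coordinates in [0, 1]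
  too.\<close>

lemma compact_core: "compact (core M V)"
proof -
  have cont: "continuous_on UNIV (\<lambda>p :: 'a set \<Rightarrow> real. p A)" for A by (rule continuous_on_product_coordinates)
  have "core M V = (\<Inter>A\<in>sets M. {p. 0 \<le> p A}) \<inter> {p. p (space M) = 1} \<inter>
     (\<Inter>A\<in>sets M. \<Inter>B\<in>{B\<in>sets M. A \<inter> B = {}}. {p. p (A \<union> B) = p A + p B}) \<inter>
     (\<Inter>A\<in>sets M. {p. p A \<le> V A}) \<inter> (\<Inter>A\<in>- sets M. {p. p A = 0})"
    by (auto simp: core_def)
  also have "closed \<dots>"
    by (intro closed_Int closed_INT ballI closed_Collect_le closed_Collect_eq cont continuous_on_const continuous_on_add)
  finally have "closed (core M V)" .
  moreover have "compact (PiE UNIV (\<lambda>_. {0..1}) :: ('a set \<Rightarrow> real) set)"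
  proof -
    have "compactin (product_topology (\<lambda>_. euclidean) UNIV) (PiE (UNIV :: 'a set set) (\<lambda>_. {0..1 :: real}))"
      by (subst compactin_PiE) auto
    then show ?thesis by (simp add: euclidean_product_topology)
  qed
  moreover have "core M V \<subseteq> PiE UNIV (\<lambda>_. {0..1})"
  proof
    fix p assume p: "p \<in> core M V"
    have "p A \<in> {0..1}" for A
      using core_nonneg[OF p, of A] core_le[OF p, of A] V_le_1[of A] core_outside[OF p, of A] by (cases "A \<in> sets M") auto
    then show "p \<in> PiE UNIV (\<lambda>_. {0..1})" by auto
  qed
  ultimately show ?thesis by (metis compact_Int_closed inf.absorb_iff2)
qed

text \<open>Krylov--Bogoliubov: a cluster point of the averages of an arbitrary element of the core.\<close>

lemma invariant_in_core:
  obtains Q where "Q \<in> inv_probs M T" "measure Q \<in> core M V"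
proof -
  obtain P where P: "measure P \<in> core M V" using V_attained[OF sets.empty_sets] by metis
  define p where "p = measure P"
  have p: "p \<in> core M V" using P by (simp add: p_def)
  \<comment> \<open>Averages run over \<open>Suc n\<close> terms so that \<open>a 0\<close> already
    has total mass 1; the value 0 off the sigma-algebra puts them into the core.\<close>
  define a where "a n A = (if A \<in> sets M then (\<Sum>i<Suc n. p ((T ^^ i) -` A \<inter> space M)) / real (Suc n) else 0)" for n A
  have a_core: "a n \<in> core M V" for n
    unfolding core_def
  proof (intro CollectI conjI ballI allI impI)
    fix A assume A: "A \<in> sets M"
    show "0 \<le> a n A" using A T_power_sets[OF A] core_nonneg[OF p]
      by (auto simp: a_def simp del: sum.lessThan_Suc intro!: divide_nonneg_nonneg sum_nonneg)
    have "(\<Sum>i<Suc n. p ((T ^^ i) -` A \<inter> space M)) \<le> (\<Sum>i<Suc n. V A)"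
      using core_le[OF p T_power_sets[OF A]] V_T_power[OF A] by (intro sum_mono) simp
    then show "a n A \<le> V A" using A by (simp add: a_def divide_le_eq mult.commute del: sum.lessThan_Suc)
    fix B assume B: "B \<in> sets M" and AB: "A \<inter> B = {}"
    have "p ((T ^^ i) -` (A \<union> B) \<inter> space M) = p ((T ^^ i) -` A \<inter> space M) + p ((T ^^ i) -` B \<inter> space M)" for i
    proof -
      have "(T ^^ i) -` (A \<union> B) \<inter> space M = ((T ^^ i) -` A \<inter> space M) \<union> ((T ^^ i) -` B \<inter> space M)" by auto
      then show ?thesis using core_add[OF p T_power_sets[OF A, of i] T_power_sets[OF B, of i]] AB by auto
    qed
    then show "a n (A \<union> B) = a n A + a n B"
      using A B by (simp add: a_def sum.distrib add_divide_distrib del: sum.lessThan_Suc)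
  next
    have "(T ^^ i) -` space M \<inter> space M = space M" for i using measurable_space[OF T_power_meas] by auto
    then show "a n (space M) = 1" by (simp add: a_def core_space[OF p] del: sum.lessThan_Suc)
  qed (simp add: a_def)
  \<comment> \<open>The cluster point is taken in the sense of filters, since an uncountable product
    need not be sequentially compact.\<close>
  have "\<exists>q\<in>core M V. inf (nhds q) (filtermap a sequentially) \<noteq> bot"
    using compact_core unfolding compact_filter
    by (rule allE[of _ "filtermap a sequentially"]) (auto simp: a_core filtermap_bot_iff eventually_filtermap)
  then obtain q where q: "q \<in> core M V" "inf (nhds q) (filtermap a sequentially) \<noteq> bot" by auto
  have q_inv: "q (T -` A \<inter> space M) = q A" if A: "A \<in> sets M" for A
  proof -
    \<comment> \<open>The invariance defect at A depends on two coordinates only, hence continuously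
      on p. Along the common refinement of the two filters it tends to its value at q and, by
      telescoping, also to 0.\<close>
    define \<phi> where "\<phi> p = p (T -` A \<inter> space M) - p A" for p :: "'a set \<Rightarrow> real"
    have TA: "T -` A \<inter> space M \<in> sets M" using A by measurable
    have coord: "((\<lambda>p :: 'a set \<Rightarrow> real. p B) \<longlongrightarrow> q B) (nhds q)" for B
      using continuous_on_product_coordinates[of B, unfolded continuous_on_def]
        tendsto_at_iff_tendsto_nhds[of "\<lambda>p. p B" q] by auto
    have "(\<phi> \<longlongrightarrow> \<phi> q) (nhds q)" unfolding \<phi>_def by (intro tendsto_diff coord)
    then have 1: "(\<phi> \<longlongrightarrow> \<phi> q) (inf (nhds q) (filtermap a sequentially))" by (rule tendsto_mono[OF inf_le1])
    have "\<bar>\<phi> (a n)\<bar> \<le> 1 / real (Suc n)" for n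
    proof -
      have "(\<Sum>i<Suc n. p ((T ^^ i) -` (T -` A \<inter> space M) \<inter> space M)) = (\<Sum>i<Suc n. p ((T ^^ Suc i) -` A \<inter> space M))"
        unfolding vimage_Suc ..
      also have "\<dots> - (\<Sum>i<Suc n. p ((T ^^ i) -` A \<inter> space M)) = p ((T ^^ Suc n) -` A \<inter> space M) - p ((T ^^ 0) -` A \<inter> space M)"
        unfolding sum_subtractf[symmetric] by (rule sum_lessThan_telescope)
      finally have "\<phi> (a n) = (p ((T ^^ Suc n) -` A \<inter> space M) - p ((T ^^ 0) -` A \<inter> space M)) / real (Suc n)"
        using A TA by (simp only: \<phi>_def a_def if_True diff_divide_distrib[symmetric])
      moreover have "\<bar>p ((T ^^ Suc n) -` A \<inter> space M) - p ((T ^^ 0) -` A \<inter> space M)\<bar> \<le> 1"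
      proof -
        have "0 \<le> p B \<and> p B \<le> 1" if "B \<in> sets M" for B
          using core_nonneg[OF p that] core_le[OF p that] V_le_1[OF that] by auto
        from this[OF T_power_sets[OF A, of "Suc n"]] this[OF T_power_sets[OF A, of 0]]
        show ?thesis by linarith
      qed
      ultimately show ?thesis by (simp add: divide_right_mono del: funpow.simps)
    qed
    then have "(\<lambda>n. \<phi> (a n)) \<longlonglongrightarrow> 0"
      by (intro Lim_null_comparison[OF _ LIMSEQ_Suc[OF lim_const_over_n[of 1]]]) auto
    then have "(\<phi> \<longlongrightarrow> 0) (filtermap a sequentially)" by (simp add: filterlim_filtermap)
    then have 2: "(\<phi> \<longlongrightarrow> 0) (inf (nhds q) (filtermap a sequentially))" by (rule tendsto_mono[OF inf_le2])
    have "\<phi> q = 0" using q(2) 1 2 by (rule tendsto_unique)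
    then show ?thesis by (simp add: \<phi>_def)
  qed
  obtain Q where "prob_space Q" "sets Q = sets M" "measure Q = q" using core_is_measure[OF q(1)] by metis
  then show ?thesis using q q_inv by (intro that[of Q]) (auto simp: inv_probs_def)
qed

text \<open>If \<^term>\<open>Q\<close> does not charge \<^term>\<open>A\<close>, it does not charge the invariant set of points that
  visit \<^term>\<open>A\<close> infinitely often; as \<^term>\<open>V\<close> is invariant and continuous along the sets of late
  visits, nullity of that set forces \<^term>\<open>V A = 0\<close>.\<close>

lemma V_null_if_invariant_null:
  assumes Q: "Q \<in> inv_probs M T"
    and inv_null: "\<And>A. A \<in> sets M \<Longrightarrow> T -` A \<inter> space M = A \<Longrightarrow> measure Q A = 0 \<Longrightarrow> V A = 0"
    and A: "A \<in> sets M" "measure Q A = 0"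
  shows "V A = 0"
proof -
  interpret Q: measure_preserving_map Q T using T_meas Q by (rule measure_preserving_map_if_inv_probs)
  have sets: "sets Q = sets M" using Q by (simp add: inv_probs_def)
  have sp: "space Q = space M" using sets by (rule sets_eq_imp_space_eq)
  define R where "R n = (\<Union>i\<in>{n..}. (T ^^ i) -` A \<inter> space M)" for n
  have R: "R n \<in> sets M" for n
    unfolding R_def by (intro sets.countable_UN'' T_power_sets A(1)) auto
  have dec: "decseq R" unfolding R_def by (intro decseq_SucI UN_mono) auto
  define L where "L = (\<Inter>n. R n)"
  have L: "L \<in> sets M" unfolding L_def using R by auto
  have L_inv: "T -` L \<inter> space M = L"
  proof -
    have mem: "x \<in> L \<longleftrightarrow> x \<in> space M \<and> (\<forall>n. \<exists>i\<ge>n. (T ^^ i) x \<in> A)" for x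
      by (auto simp: L_def R_def)
    have "(\<forall>n. \<exists>i\<ge>n. (T ^^ i) (T x) \<in> A) \<longleftrightarrow> (\<forall>n. \<exists>i\<ge>n. (T ^^ i) x \<in> A)" for x
    proof -
      have *: "(T ^^ i) (T x) = (T ^^ Suc i) x" for i by (simp add: funpow_swap1)
      show ?thesis unfolding * by (metis Suc_le_D Suc_le_mono le_SucI)
    qed
    then show ?thesis using mem measurable_space[OF T_meas] by blast
  qed
  have "measure Q ((T ^^ i) -` A \<inter> space M) = 0" for i
    using Q.prob_vimage_T_power[of A i] A by (simp add: sets sp)
  then have "(T ^^ i) -` A \<inter> space M \<in> null_sets Q" for i
    using T_power_sets[OF A(1), of i] by (auto simp: null_sets_def sets Q.emeasure_eq_measure)
  then have "R 0 \<in> null_sets Q" unfolding R_def by (intro null_sets_UN') auto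
  moreover have "L \<subseteq> R 0" by (auto simp: L_def)
  ultimately have "L \<in> null_sets Q" using L sets by (metis null_sets_subset)
  then have "measure Q L = 0" by (simp add: null_sets_def measure_def)
  then have "V L = 0" using inv_null[OF L L_inv] by simp
  then have lim: "(\<lambda>n. V (R n)) \<longlonglongrightarrow> 0" using R dec unfolding L_def by (intro V_decseq_null)
  have "V A \<le> V (R n)" for n
  proof -
    have "V A = V ((T ^^ n) -` A \<inter> space M)" using V_T_power[OF A(1)] by simp
    also have "\<dots> \<le> V (R n)" by (rule V_mono[OF T_power_sets[OF A(1)] R]) (auto simp: R_def)
    finally show ?thesis .
  qed
  then have "V A \<le> 0" by (intro LIMSEQ_le_const[OF lim]) auto
  then show ?thesis using V_nonneg[OF A(1)] by linarith
qed

section \<open>Equivalence of the three conditions\<close>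

lemma mixing_wrt_imp_mixing_on_average:
  assumes Q: "Q \<in> inv_probs M T" "measure Q \<in> core M V" "mixing_wrt M T V Q"
  shows "measure_preserving_map.mixing_on_average Q T"
proof -
  interpret Q: measure_preserving_map Q T using T_meas Q(1) by (rule measure_preserving_map_if_inv_probs)
  have sets: "sets Q = sets M" using Q by (simp add: inv_probs_def)
  have sp: "space Q = space M" using sets by (rule sets_eq_imp_space_eq)
  show ?thesis unfolding Q.mixing_on_average_def
  proof (intro ballI cesaro_nullI_squares)
    fix B C assume "B \<in> sets Q" "C \<in> sets Q"
    \<comment> \<open>Since Q lies in the core, the hypothesis may be applied with P = Q.\<close>
    then show "(\<lambda>n. (1 / real n) * (\<Sum>i<n. \<bar>Q.corr B C i\<bar>\<^sup>2)) \<longlonglongrightarrow> 0"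
      using Q(2,3) unfolding mixing_wrt_def Q.corr_def sp sets by blast
  qed
qed

text \<open>Mixing on average passes from Q to the product Q x Q, where it implies
  ergodicity.\<close>

lemma wm_probs_if_mixing_wrt:
  assumes Q: "Q \<in> inv_probs M T" "measure Q \<in> core M V" "mixing_wrt M T V Q"
  shows "Q \<in> wm_probs M T"
proof -
  interpret Q: measure_preserving_map Q T using T_meas Q(1) by (rule measure_preserving_map_if_inv_probs)
  interpret S: measure_preserving_map "Q \<Otimes>\<^sub>M Q" "\<lambda>(x, y). (T x, T y)" by (rule Q.measure_preserving_map_prod)
  have "S.mixing_on_average"
    using Q.mixing_on_average_prod mixing_wrt_imp_mixing_on_average[OF Q] .
  then show ?thesis using Q(1) S.mixing_on_average_ergodic by (auto simp: wm_probs_def)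
qed

text \<open>Q and V have the same null sets, so a V-almost sure eigenfunction is one for Q, is
  constant for Q by mixing, and hence constant V-almost surely.\<close>

lemma weakly_mixing_cap_if_mixing_wrt:
  assumes Q: "Q \<in> inv_probs M T" "measure Q \<in> core M V" "mixing_wrt M T V Q"
  shows "weakly_mixing_cap M T V"
proof -
  interpret Q: measure_preserving_map Q T using T_meas Q(1) by (rule measure_preserving_map_if_inv_probs)
  have sets: "sets Q = sets M" using Q by (simp add: inv_probs_def)
  have sp: "space Q = space M" using sets by (rule sets_eq_imp_space_eq)
  have null: "V A = 0" if A: "A \<in> sets M" "measure Q A = 0" for A
  proof (rule V_null_if_invariant_null[OF Q(1) _ A])
    fix L assume L: "L \<in> sets M" "T -` L \<inter> space M = L" "measure Q L = 0"
    \<comment> \<open>For P attaining V at the invariant set L, mixing with B the whole space and C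
      = L has the constant terms (V L)^2, because Q L = 0. Their averages tend to 0 only if V L =
      0.\<close>
    obtain P where P: "measure P \<in> core M V" "measure P L = V L" using V_attained[OF L(1)] by metis
    have L_inv: "(T ^^ i) -` L \<inter> space M = L" for i
    proof (induction i)
      case 0 then show ?case using sets.sets_into_space[OF L(1)] by auto
    next
      case (Suc i) then show ?case using vimage_Suc'[of i L] L(2) by (simp only:)
    qed
    then have eq: "space M \<inter> ((T ^^ i) -` L \<inter> space M) = L" for i
      using sets.sets_into_space[OF L(1)] by auto
    have "(\<lambda>n. (1 / real n) * (\<Sum>i<n. \<bar>measure P (space M \<inter> ((T ^^ i) -` L \<inter> space M)) - measure P (space M) * measure Q L\<bar>\<^sup>2)) \<longlonglongrightarrow> 0"
      using Q(3) P(1) L(1) unfolding mixing_wrt_def by blast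
    then have "cesaro_null (\<lambda>i. V L)"
      unfolding eq L(3) P(2) by (intro cesaro_nullI_squares) simp
    then show "V L = 0" by (rule cesaro_null_const)
  qed
  have eig: "Q.eigenfunctions_constant"
    by (intro Q.eigenfunctions_constant_if_mixing mixing_wrt_imp_mixing_on_average Q)
  show ?thesis
    unfolding weakly_mixing_cap_def
  proof (intro conjI allI impI inv)
    fix f :: "'a \<Rightarrow> complex" assume f: "f \<in> borel_measurable M" and "\<exists>c. cap_AE M V (\<lambda>x. f (T x) = c * f x)"
    then obtain c N where N: "N \<in> sets M" "{x \<in> space M. f (T x) \<noteq> c * f x} \<subseteq> N" "V N = 0"
      by (auto simp: cap_AE_def)
    have "measure Q N = 0"
      using core_le[OF Q(2) N(1)] N(3) by (simp add: measure_le_0_iff)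
    then have "N \<in> null_sets Q" using N(1) by (auto simp: null_sets_def sets Q.emeasure_eq_measure)
    then have "AE x in Q. f (T x) = c * f x" using N(2) by (intro AE_I'[of N]) (auto simp: sp)
    moreover have "f \<in> borel_measurable Q" using f by (simp add: measurable_cong_sets[OF sets refl])
    ultimately obtain k where "AE x in Q. f x = k" using eig unfolding Q.eigenfunctions_constant_def by blast
    then obtain N' where N': "{x \<in> space Q. \<not> f x = k} \<subseteq> N'" "emeasure Q N' = 0" "N' \<in> sets Q" by (rule AE_E)
    then have "V N' = 0" by (intro null) (auto simp: sets measure_def)
    then show "\<exists>k. cap_AE M V (\<lambda>x. f x = k)"
      using N' by (auto simp: cap_AE_def sets sp)
  qed
qed

text \<open>Every element of the core is absolutely continuous with respect to Q, so its
  correlations are integrals against Q with an L^1 weight. For a bounded weight the averages vanish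
  by \<open>weak_mixing_averages\<close>.\<close>

lemma mixing_wrt_if_weakly_mixing_cap:
  assumes wm: "weakly_mixing_cap M T V" and Q: "Q \<in> inv_probs M T" "measure Q \<in> core M V"
  shows "mixing_wrt M T V Q"
proof -
  interpret Q: measure_preserving_map Q T using T_meas Q(1) by (rule measure_preserving_map_if_inv_probs)
  have sets: "sets Q = sets M" using Q by (simp add: inv_probs_def)
  have sp: "space Q = space M" using sets by (rule sets_eq_imp_space_eq)
  have wmD: "\<exists>k. cap_AE M V (\<lambda>x. f x = k)"
    if "f \<in> borel_measurable M" "cap_AE M V (\<lambda>x. f (T x) = c * f x)" for f :: "'a \<Rightarrow> complex" and c
    using wm that unfolding weakly_mixing_cap_def by blast
  have null: "V A = 0" if A: "A \<in> sets M" "measure Q A = 0" for A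
  proof (rule V_null_if_invariant_null[OF Q(1) _ A])
    fix L assume L: "L \<in> sets M" "T -` L \<inter> space M = L" "measure Q L = 0"
    \<comment> \<open>The indicator of an invariant set is an eigenfunction for the eigenvalue 1, so
      weak mixing makes it V-almost surely a constant k.\<close>
    define f where "f = (indicator L :: 'a \<Rightarrow> complex)"
    have "f (T x) = 1 * f x" if "x \<in> space M" for x using L(2) that by (auto simp: f_def indicator_def)
    then have "cap_AE M V (\<lambda>x. f (T x) = 1 * f x)"
      unfolding cap_AE_def by (intro bexI[of _ "{}"]) (auto simp: V_empty)
    moreover have "f \<in> borel_measurable M" using L(1) by (simp add: f_def)
    ultimately obtain k where "cap_AE M V (\<lambda>x. f x = k)" using wmD by blast
    then obtain N where N: "N \<in> sets M" "{x \<in> space M. f x \<noteq> k} \<subseteq> N" "V N = 0"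
      unfolding cap_AE_def by blast
    have QN: "measure Q N = 0" using core_le[OF Q(2) N(1)] N(3) by (simp add: measure_le_0_iff)
    \<comment> \<open>If k = 1, two Q-null sets would cover the space. Otherwise L lies in the
      exceptional V-null set.\<close>
    have "k \<noteq> 1"
    proof
      assume "k = 1"
      then have "space M \<subseteq> N \<union> L" using N(2) by (auto simp: f_def indicator_def split: if_splits)
      then have "measure Q (space M) \<le> measure Q (N \<union> L)"
        using N(1) L(1) by (intro Q.finite_measure_mono) (auto simp: sets)
      also have "\<dots> \<le> measure Q N + measure Q L"
        using N(1) L(1) by (intro measure_Un_le) (auto simp: sets)
      finally show False using QN L(3) core_space[OF Q(2)] by simp
    qed
    then have "L \<subseteq> N" using N(2) sets.sets_into_space[OF L(1)] by (auto simp: f_def indicator_def)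
    then show "V L = 0" using V_mono[OF L(1) N(1)] N(3) V_nonneg[OF L(1)] by simp
  qed
  have eig: "Q.eigenfunctions_constant"
    unfolding Q.eigenfunctions_constant_def
  proof (intro allI impI)
    fix f :: "'a \<Rightarrow> complex" and c assume f: "f \<in> borel_measurable Q" and "AE x in Q. f (T x) = c * f x"
    then obtain N where N: "{x \<in> space Q. \<not> f (T x) = c * f x} \<subseteq> N" "emeasure Q N = 0" "N \<in> sets Q"
      using AE_E by blast
    then have "V N = 0" by (intro null) (auto simp: sets measure_def)
    then have "cap_AE M V (\<lambda>x. f (T x) = c * f x)" using N by (auto simp: cap_AE_def sets sp)
    moreover have "f \<in> borel_measurable M" using f by (simp add: measurable_cong_sets[OF sets refl])
    ultimately obtain k where "cap_AE M V (\<lambda>x. f x = k)" using wmD by blast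
    then obtain N' where N': "N' \<in> sets M" "{x \<in> space M. f x \<noteq> k} \<subseteq> N'" "V N' = 0"
      unfolding cap_AE_def by blast
    have "measure Q N' = 0" using core_le[OF Q(2) N'(1)] N'(3) by (simp add: measure_le_0_iff)
    then have "N' \<in> null_sets Q" using N'(1) by (auto simp: null_sets_def sets Q.emeasure_eq_measure)
    then have "AE x in Q. f x = k" using N'(2) by (intro AE_I'[of N']) (auto simp: sp)
    then show "\<exists>k. AE x in Q. f x = k" ..
  qed
  show ?thesis
    unfolding mixing_wrt_def
  proof (intro ballI)
    fix p B C assume p: "p \<in> core M V" and B: "B \<in> sets M" and C: "C \<in> sets M"
    obtain P where P: "prob_space P" "sets P = sets M" "measure P = p" using core_is_measure[OF p] by metis
    interpret P: prob_space P by fact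
    have B'[measurable]: "B \<in> sets Q" and C'[measurable]: "C \<in> sets Q" using B C sets by auto
    \<comment> \<open>On a Q-null set V vanishes, and p lies between 0 and V.\<close>
    have ac: "absolutely_continuous Q P"
      unfolding absolutely_continuous_def
    proof
      fix A assume "A \<in> null_sets Q"
      then have A: "A \<in> sets M" "measure Q A = 0" by (auto simp: null_sets_def sets measure_def)
      have "p A = 0" using core_le[OF p A(1)] core_nonneg[OF p A(1)] null[OF A] by simp
      then show "A \<in> null_sets P" using A(1) P by (auto simp: null_sets_def P.emeasure_eq_measure)
    qed
    have sPQ: "sets P = sets Q" using P sets by simp
    obtain D where D[measurable]: "D \<in> borel_measurable Q" "AE x in Q. RN_deriv Q P x = ennreal (D x)" "\<And>x. 0 \<le> D x"
      using Q.real_RN_deriv[OF P.finite_measure_axioms ac sPQ] by metis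
    have PD: "P = density Q (\<lambda>x. ennreal (D x))"
    proof -
      have "P = density Q (RN_deriv Q P)" using Q.density_RN_deriv[OF ac sPQ] by simp
      also have "\<dots> = density Q (\<lambda>x. ennreal (D x))" using D(2) by (intro density_cong) auto
      finally show ?thesis .
    qed
    have D_int: "integrable Q D"
    proof (rule integrableI_nonneg)
      have "(\<integral>\<^sup>+x. ennreal (D x) \<partial>Q) = emeasure P (space Q)"
        unfolding PD by (subst emeasure_density) (auto intro!: nn_integral_cong)
      also have "\<dots> = 1" using P.emeasure_space_1 sets_eq_imp_space_eq[OF sPQ] by simp
      finally show "(\<integral>\<^sup>+x. ennreal (D x) \<partial>Q) < \<infinity>" by simp
    qed (use D in auto)
    have p_eq: "p A = (\<integral>x. indicator A x * D x \<partial>Q)" if "A \<in> sets Q" for A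
    proof -
      have "p A = (\<integral>x. indicator A x \<partial>P)" using that sPQ P(3) by (simp add: P.emeasure_eq_measure)
      also have "\<dots> = (\<integral>x. D x * indicator A x \<partial>Q)"
        unfolding PD using that D(3) by (subst integral_density) auto
      finally show ?thesis by (simp add: mult.commute)
    qed
    \<comment> \<open>Centred with Q, although B is measured by p: the term -p(B) Q(C) is then
      absorbed, and \<open>a i\<close> is the integral of the indicator of B times f o T^i against
      p.\<close>
    define f where "f x = indicator C x - measure Q C" for x
    have f[measurable]: "f \<in> borel_measurable Q" unfolding f_def by measurable
    have f_le: "\<bar>f x\<bar> \<le> 1" for x by (auto simp: f_def indicator_def)
    have f_int: "(\<integral>x. f x \<partial>Q) = 0"
      unfolding f_def by (subst Bochner_Integration.integral_diff) (auto simp: Q.prob_space Q.emeasure_eq_measure)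
    define a where "a i = p (B \<inter> ((T ^^ i) -` C \<inter> space M)) - p B * measure Q C" for i
    have int_bd: "integrable Q (\<lambda>x. h x * D x)" if "h \<in> borel_measurable Q" "\<And>x. \<bar>h x\<bar> \<le> 1" for h
      using that D(3) by (intro Bochner_Integration.integrable_bound[OF D_int]) (auto simp: abs_mult intro!: mult_left_le_one_le)
    have a_eq: "a i = (\<integral>x. indicator B x * f ((T ^^ i) x) * D x \<partial>Q)" for i
    proof -
      have "p (B \<inter> ((T ^^ i) -` C \<inter> space M)) = (\<integral>x. indicator (B \<inter> ((T ^^ i) -` C \<inter> space M)) x * D x \<partial>Q)"
        using B T_power_sets[OF C] by (intro p_eq) (auto simp: sets)
      also have "\<dots> = (\<integral>x. (indicator B x * indicator C ((T ^^ i) x)) * D x \<partial>Q)"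
        by (intro Bochner_Integration.integral_cong) (auto simp: indicator_def sp)
      finally have "a i = (\<integral>x. (indicator B x * indicator C ((T ^^ i) x)) * D x \<partial>Q) - (\<integral>x. (indicator B x * measure Q C) * D x \<partial>Q)"
        by (simp add: a_def p_eq B' algebra_simps flip: integral_mult_right_zero)
      also have "\<dots> = (\<integral>x. (indicator B x * indicator C ((T ^^ i) x)) * D x - (indicator B x * measure Q C) * D x \<partial>Q)"
        by (intro Bochner_Integration.integral_diff[symmetric] int_bd) (auto simp: indicator_def)
      also have "\<dots> = (\<integral>x. indicator B x * f ((T ^^ i) x) * D x \<partial>Q)"
        by (intro Bochner_Integration.integral_cong) (auto simp: f_def algebra_simps)
      finally show ?thesis .
    qed
    have "cesaro_null a"
    proof (rule cesaro_null_approx)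
      fix e :: real assume e: "e > 0"
      \<comment> \<open>Truncating the density gives the bounded weight that
        \<open>weak_mixing_averages\<close> requires. As |f| \<le> 1, the error is at most the L^1
        norm of the part cut off, uniformly in i.\<close>
      define Dk where "Dk k x = min (D x) (real k)" for k :: nat and x
      have Dk[measurable]: "Dk k \<in> borel_measurable Q" for k unfolding Dk_def by measurable
      have "(\<lambda>k. \<integral>x. D x - Dk k x \<partial>Q) \<longlonglongrightarrow> (\<integral>x. 0 \<partial>Q)"
      proof (rule integral_dominated_convergence[OF _ _ D_int])
        show "AE x in Q. (\<lambda>k. D x - Dk k x) \<longlonglongrightarrow> 0"
        proof (intro AE_I2 tendsto_eventually)
          fix x
          obtain K where "D x \<le> real K" using real_arch_simple by blast
          then show "eventually (\<lambda>k. D x - Dk k x = 0) sequentially"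
            unfolding eventually_sequentially by (intro exI[of _ K]) (auto simp: Dk_def)
        qed
        show "AE x in Q. norm (D x - Dk k x) \<le> D x" for k
          using D(3) by (auto simp: Dk_def)
      qed auto
      then have "eventually (\<lambda>k. (\<integral>x. D x - Dk k x \<partial>Q) < e) sequentially"
        using e order_tendstoD(2)[of _ 0 sequentially e] by simp
      then obtain k where k: "(\<integral>x. D x - Dk k x \<partial>Q) < e" by (auto dest: eventually_happens)
      have Dk_le: "0 \<le> Dk k x" "Dk k x \<le> D x" "Dk k x \<le> real k" for x using D(3) by (auto simp: Dk_def)
      have Dk_int: "integrable Q (Dk k)"
        using Dk_le D(3) by (intro Bochner_Integration.integrable_bound[OF D_int]) auto
      define \<phi> where "\<phi> x = indicator B x * Dk k x" for x
      have \<phi>: "\<phi> \<in> bounded_measurable Q"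
      proof (rule bounded_measurableI[where c="real k"])
        show "\<phi> \<in> borel_measurable Q" unfolding \<phi>_def by measurable
      qed (use Dk_le in \<open>auto simp: \<phi>_def indicator_def\<close>)
      define b where "b i = (\<integral>x. \<phi> x * f ((T ^^ i) x) \<partial>Q)" for i
      have "(\<lambda>n. (\<Sum>i<n. (b i)\<^sup>2) / real n) \<longlonglongrightarrow> 0"
        unfolding b_def using f_le f_int by (intro Q.weak_mixing_averages eig f \<phi>) auto
      then have "cesaro_null b" by (intro cesaro_nullI_squares) simp
      moreover have "\<bar>a i\<bar> \<le> \<bar>b i\<bar> + e" for i
      proof -
        have bf: "\<bar>indicator B x * f ((T ^^ i) x)\<bar> \<le> 1" for x
          using f_le[of "(T ^^ i) x"] by (auto simp: indicator_def)
        have int1: "integrable Q (\<lambda>x. indicator B x * f ((T ^^ i) x) * D x)"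
          using bf by (intro int_bd) auto
        have int2: "integrable Q (\<lambda>x. \<phi> x * f ((T ^^ i) x))"
          by (intro Q.bounded_measurable_integrable bounded_measurable_mult \<phi> bounded_measurable_comp[OF _ Q.T_power_measurable]
              bounded_measurableI[OF f f_le])
        have "a i - b i = (\<integral>x. indicator B x * f ((T ^^ i) x) * D x - \<phi> x * f ((T ^^ i) x) \<partial>Q)"
          unfolding a_eq b_def by (intro Bochner_Integration.integral_diff[symmetric] int1 int2)
        also have "\<bar>\<dots>\<bar> \<le> (\<integral>x. \<bar>indicator B x * f ((T ^^ i) x) * D x - \<phi> x * f ((T ^^ i) x)\<bar> \<partial>Q)"
          by (rule integral_abs_bound)
        also have "\<dots> \<le> (\<integral>x. D x - Dk k x \<partial>Q)"
        proof (intro integral_mono integrable_abs Bochner_Integration.integrable_diff int1 int2 D_int Dk_int)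
          fix x
          have "indicator B x * f ((T ^^ i) x) * D x - \<phi> x * f ((T ^^ i) x) = indicator B x * f ((T ^^ i) x) * (D x - Dk k x)"
            by (simp add: \<phi>_def algebra_simps)
          also have "\<bar>\<dots>\<bar> = \<bar>indicator B x * f ((T ^^ i) x)\<bar> * \<bar>D x - Dk k x\<bar>" by (rule abs_mult)
          also have "\<dots> \<le> 1 * \<bar>D x - Dk k x\<bar>" by (intro mult_right_mono bf) simp
          finally show "\<bar>indicator B x * f ((T ^^ i) x) * D x - \<phi> x * f ((T ^^ i) x)\<bar> \<le> D x - Dk k x"
            using Dk_le[of x] by simp
        qed
        finally show ?thesis using k by linarith
      qed
      ultimately show "\<exists>b. cesaro_null b \<and> (\<forall>i. \<bar>a i\<bar> \<le> \<bar>b i\<bar> + e)" by blast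
    qed
    moreover have "\<bar>a i\<bar> \<le> 1" for i
    proof -
      have "0 \<le> p (B \<inter> ((T ^^ i) -` C \<inter> space M))" "p (B \<inter> ((T ^^ i) -` C \<inter> space M)) \<le> 1"
        unfolding P(3)[symmetric] by auto
      moreover have "0 \<le> p B * measure Q C" "p B * measure Q C \<le> 1"
        unfolding P(3)[symmetric] by (auto intro!: mult_le_one)
      ultimately show ?thesis unfolding a_def by linarith
    qed
    ultimately show "(\<lambda>n. (1 / real n) * (\<Sum>i<n. \<bar>p (B \<inter> ((T ^^ i) -` C \<inter> space M)) - p B * measure Q C\<bar>\<^sup>2)) \<longlonglongrightarrow> 0"
      using cesaro_null_squares[of a] by (simp only: a_def)
  qed
qed

end

theorem theorem5p8:
  fixes M :: "'a measure" and T :: "'a \<Rightarrow> 'a" and V :: "'a set \<Rightarrow> real"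
  assumes "T \<in> measurable M M"
    and "upper_probability M V"
    and "invariant_capacity M T V"
  shows "(weakly_mixing_cap M T V \<longleftrightarrow>
            (\<exists>Q\<in>wm_probs M T. measure Q \<in> core M V \<and> mixing_wrt M T V Q))
       \<and> ((\<exists>Q\<in>wm_probs M T. measure Q \<in> core M V \<and> mixing_wrt M T V Q) \<longleftrightarrow>
            (\<exists>Q\<in>inv_probs M T. measure Q \<in> core M V \<and> mixing_wrt M T V Q))"
proof -
  interpret invariant_upper_probability M T V using assms by unfold_locales
  have "wm_probs M T \<subseteq> inv_probs M T" by (auto simp: wm_probs_def)
  \<comment> \<open>Under weak mixing of V, any invariant element of the core can serve as
    Q.\<close>
  moreover have "\<exists>Q\<in>inv_probs M T. measure Q \<in> core M V \<and> mixing_wrt M T V Q" if "weakly_mixing_cap M T V"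
    using invariant_in_core mixing_wrt_if_weakly_mixing_cap[OF that] by metis
  ultimately show ?thesis
    using wm_probs_if_mixing_wrt weakly_mixing_cap_if_mixing_wrt by blast
qed

end
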